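(* Let $d$ be a positive integer and let $\delta>d/2$ be a real number. Define $$Q_\delta(r)={}_1F_2\left(\delta;\,2\delta,\,2\delta+\frac12;\,-\frac{r^2}{4}\right)\qquad(r\ge0),$$ let $$\Psi_{d,\delta}(t)=\frac{1}{B(2\delta-d,\,2\delta)}\int_t^1(s^2-t^2)^{\delta-\frac{d+1}{2}}(1-s)^{2\delta-1}\,ds\quad\text{for }0\le t\le1,\qquad \Psi_{d,\delta}(t)=0\ \text{ for } t>1,$$ and let $$\tau_{d,\delta}=\frac{2^{1-d}\,\Gamma(4\delta)\,\Gamma\left(\delta-\frac d2\right)}{\Gamma(\delta)\,\Gamma(4\delta-d)\,\Gamma\left(\frac d2\right)}.$$ Then the following hold. (i) $Q_\delta$ is positive definite on $\mathbb{R}^d$, and for $r\ge0$, $$Q_\delta(r)=\frac{1}{B(2\delta,\,2\delta)}\int_0^\infty\Omega_{\delta-\frac12}(rt)\,(1-t)_+^{2\delta-1}\,t^{2\delta-1}\,dt=\tau_{d,\delta}\int_0^\infty\Omega_{\frac{d-2}{2}}(rt)\,\Psi_{d,\delta}(t)\,t^{d-1}\,dt.$$ (ii) $0<Q_\delta(r)\le1$ for each $r\ge0$, and as $r\to\infty$, $$Q_\delta(r)=\frac{\Gamma(4\delta)}{\Gamma(2\delta)}\,r^{-2\delta}+O\left(r^{-\min(2\delta+2,\,3\delta)}\right).$$ Moreover, $Q_\delta(r)\approx(1+r)^{-2\delta}$ for $r\ge0$. (iii) $Q_\delta\in C([0,\infty))\cap L^1\left([0,\infty),\,r^{d-1}dr\right)$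 and $$\Psi_{d,\delta}(t)=\frac{1}{2^{d-2}\,[\Gamma(d/2)]^2\,\tau_{d,\delta}}\int_0^\infty\Omega_{\frac{d-2}{2}}(rt)\,Q_\delta(r)\,r^{d-1}\,dr\qquad(t\ge0).$$ As a consequence, $\Psi_{d,\delta}$ is positive definite on $\mathbb{R}^d$.
   Context: Notation. For $\lambda>-1$, $\Omega_\lambda:\mathbb{R}\to\mathbb{R}$ is $$\Omega_\lambda(t)=\Gamma(\lambda+1)\sum_{k=0}^\infty \frac{(-1)^k}{k!\,\Gamma(\lambda+k+1)}\left(\frac t2\right)^{2k}=\Gamma(\lambda+1)(t/2)^{-\lambda}J_\lambda(t),$$ where $J_\lambda$ is the Bessel function of the first kind. The generalized hypergeometric function is ${}_pF_q(a_1,\dots,a_p;b_1,\dots,b_q;r)=\sum_{k\ge0}\frac{(a_1)_k\cdots(a_p)_k}{k!\,(b_1)_k\cdots(b_q)_k}r^k$, with $(a)_0=1$ and $(a)_k=a(a+1)\cdots(a+k-1)$ for $k\ge1$. $B(a,b)=\int_0^1 t^{a-1}(1-t)^{b-1}dt$ is the Euler beta function, and $x_+=\max(x,0)$. For real functions $f,g$ on a set $X$, $f(x)\approx g(x)$ for $x\in X$ means there are positive constants $c_1,c_2$ with $c_1g(x)\le f(x)\le c_2 g(x)$ for all $x\in X$. A function $\Phi$ on $\mathbb{R}^d$ is positive definite if $\sum_{j,k=1}^N\Phi(\mathbf{x}_j-\mathbf{x}_k)z_j\overline{z_k}\ge0$ for every $N$, all (pairwise distinct) $\mathbf{x}_1,\dots,\mathbf{x}_N\in\mathbb{R}^d$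 and all $z_1,\dots,z_N\in\mathbb{C}$, with equality only when $z_1=\cdots=z_N=0$. A function $\phi$ on $[0,\infty)$ is positive definite on $\mathbb{R}^d$ if its radial extension $\mathbf{x}\mapsto\phi(|\mathbf{x}|)$, $\mathbf{x}\in\mathbb{R}^d$, is positive definite, where $|\cdot|$ is the Euclidean norm. *)

theory Defs
  imports "HOL-Analysis.Analysis" "HOL-Library.Landau_Symbols"
begin

text \<open>
  The sum ranges over the indices \<open>0, \<dots>, N - 1\<close>. It is a complex number; membership in
  \<open>\<real>\<^sub>\<ge>\<^sub>0\<close> says that it is real and nonnegative.
\<close>

definition positive_definite :: "('a::real_normed_vector \<Rightarrow> complex) \<Rightarrow> bool" where
  "positive_definite \<Phi> \<longleftrightarrow>
    (\<forall>(N::nat) (x :: nat \<Rightarrow> 'a) (z :: nat \<Rightarrow> complex). inj_on x {..<N} \<longrightarrow>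
      (\<Sum>j<N. \<Sum>k<N. \<Phi> (x j - x k) * z j * cnj (z k)) \<in> \<real>\<^sub>\<ge>\<^sub>0 \<and>
      ((\<Sum>j<N. \<Sum>k<N. \<Phi> (x j - x k) * z j * cnj (z k)) = 0 \<longrightarrow> (\<forall>j<N. z j = 0)))"

text \<open>
  The space of dimension \<open>d = CARD('n)\<close> is \<open>real ^ 'n\<close>. Only the values of \<open>\<phi>\<close> on
  \<open>{0..}\<close> matter.
\<close>

definition radially_positive_definite :: "'n::finite itself \<Rightarrow> (real \<Rightarrow> real) \<Rightarrow> bool" where
  "radially_positive_definite _ \<phi> \<longleftrightarrow>
    positive_definite (\<lambda>x :: real ^ 'n. complex_of_real (\<phi> (norm x)))"

definition comparable_on :: "'a set \<Rightarrow> ('a \<Rightarrow> real) \<Rightarrow> ('a \<Rightarrow> real) \<Rightarrow> bool" where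
  "comparable_on X f g \<longleftrightarrow>
    (\<exists>c1>0. \<exists>c2>0. \<forall>x\<in>X. c1 * g x \<le> f x \<and> f x \<le> c2 * g x)"

text \<open>The normalised Bessel function \<open>\<Gamma>(\<nu>+1) (t/2)\<^bsup>-\<nu>\<^esup> J\<^sub>\<nu>(t)\<close>, meant for \<open>\<nu> > -1\<close>.\<close>

definition Omega :: "real \<Rightarrow> real \<Rightarrow> real" where
  "Omega \<nu> t = Gamma (\<nu> + 1) *
     (\<Sum>k. (-1) ^ k / (fact k * Gamma (\<nu> + real k + 1)) * (t / 2) ^ (2 * k))"

definition hypergeometric :: "real list \<Rightarrow> real list \<Rightarrow> real \<Rightarrow> real" where
  "hypergeometric as bs r = eval_fps (fps_hypergeo as bs 1) r"

definition Q :: "real \<Rightarrow> real \<Rightarrow> real" where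
  "Q \<delta> r = hypergeometric [\<delta>] [2 * \<delta>, 2 * \<delta> + 1 / 2] (- (r ^ 2 / 4))"

text \<open>
  Meant for \<open>t \<ge> 0\<close>; the value \<open>0\<close> for \<open>t < 0\<close> is arbitrary.
  \<open>Beta\<close> agrees with Euler's integral by \<open>has_integral_Beta_real\<close>.
\<close>

definition Psi :: "nat \<Rightarrow> real \<Rightarrow> real \<Rightarrow> real" where
  "Psi d \<delta> t =
    (if 0 \<le> t \<and> t \<le> 1 then
       1 / Beta (2 * \<delta> - real d) (2 * \<delta>) *
       (LINT s:{t..1}|lborel.
          (s ^ 2 - t ^ 2) powr (\<delta> - (real d + 1) / 2) * (1 - s) powr (2 * \<delta> - 1))
     else 0)"

definition tau :: "nat \<Rightarrow> real \<Rightarrow> real" where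
  "tau d \<delta> =
    2 powr (1 - real d) * Gamma (4 * \<delta>) * Gamma (\<delta> - real d / 2) /
    (Gamma \<delta> * Gamma (4 * \<delta> - real d) * Gamma (real d / 2))"

end

theory Submission
  imports Defs "HOL-Complex_Analysis.Cauchy_Integral_Formula" "HOL-Real_Asymp.Real_Asymp"
begin

text \<open>
  Both integral representations of \<open>Q\<close> follow by integrating the power series of \<open>\<Omega>\<close> termwise,
  the moments of the weights being Beta values. The second one says that \<open>Q\<close> is, up to a
  positive factor, the Fourier transform on \<open>\<real>\<^sup>d\<close> of the nonnegative radial function given by
  \<open>\<Psi>\<close>: polar coordinates are replaced by the remark that the image under the norm of
  the measure \<open>(x \<bullet> y)\<^sup>2\<^sup>k dy\<close> is homogeneous, hence a multiple of \<open>t\<^sup>d\<^sup>+\<^sup>2\<^sup>k\<^sup>-\<^sup>1 dt\<close>, with a factor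
  that is read off from Gaussian integrals. Positive definiteness of \<open>Q\<close> is then immediate, and
  Fourier inversion gives part (iii) once \<open>Q\<close> is known to be positive and integrable.

  Positivity comes from the identity, up to a positive factor,
  \<open>Q(r) = \<integral> \<Omega>(r t / 2)\<^sup>2 t\<^sup>2\<^sup>\<delta> (1 - t\<^sup>2)\<^sup>\<delta>\<^sup>-\<^sup>1 dt\<close> over \<open>[0, 1]\<close>, with \<open>\<Omega>\<close> of index \<open>\<delta> - 1/2\<close>.
  For the asymptotics, \<open>Q(r)\<close> is written as a multiple of
  \<open>\<integral> (1 - s)\<^sup>2\<^sup>\<delta>\<^sup>-\<^sup>1 \<integral> cos (r t) (s\<^sup>2 - t\<^sup>2)\<^sup>\<delta>\<^sup>-\<^sup>1 dt ds\<close> over \<open>0 \<le> t \<le> s \<le> 1\<close>, and both integrals are moved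
  to vertical half lines in the upper half plane. The contribution of \<open>t = 0\<close> is purely
  imaginary and drops out; that of \<open>s = 0\<close> gives the main term with error \<open>r\<^sup>-\<^sup>2\<^sup>\<delta>\<^sup>-\<^sup>2\<close>, and
  that of \<open>s = 1\<close> is \<open>O(r\<^sup>-\<^sup>3\<^sup>\<delta>)\<close>.
\<close>

subsection \<open>Gamma and Beta integrals\<close>

text \<open>As \<open>\<delta>\<close> may be close to 1/2, the exponents
  \<open>\<delta> - 1\<close> and \<open>\<delta> - (d + 1) / 2\<close> can be negative. Weights are
  then unbounded at an end point, so substitutions and contours stop short of it, and power
  estimates must serve both signs of the exponent. The critical integral at 0 is that of y^(2 delta
  - 2), which converges exactly for \<open>\<delta> > 1 / 2\<close>. All series are kept even, with
  coefficients at most 1/(2k)!, those of cosh. A weight of bounded support can then be integrated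
  termwise, and an integral formula becomes an identity between moments. The square behind
  positivity comes from 0F1(c)^2 = 1F2(c - 1/2; c, 2c - 1) at four times the argument, a relative of
  Clausen's formula, with c = delta + 1/2. A Beta weight in t^2 then replaces the lower parameter
  delta + 1/2 by 2 delta + 1/2, which gives \<open>Q\<close>. The main contribution has no
  correction of order r^(-2 delta - 1), because the linear term of (1 - i x)^(2 delta - 1) is purely
  imaginary and only a real part is kept.\<close>

lemma has_bochner_integral_of_has_integral:
  fixes f :: "real \<Rightarrow> real"
  assumes "f \<in> borel_measurable borel" "S \<in> sets borel" "\<And>x. x \<in> S \<Longrightarrow> 0 \<le> f x" "(f has_integral I) S"
  shows "has_bochner_integral lborel (\<lambda>x. indicat_real S x * f x) I"
proof (rule has_bochner_integral_nn_integral)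
  show "(\<lambda>x. indicat_real S x * f x) \<in> borel_measurable lborel"
    using assms(1,2) by simp
  show "AE x in lborel. 0 \<le> indicat_real S x * f x"
    using assms(3) by (auto simp: indicator_def)
  show "0 \<le> I" using assms(3,4) by (rule has_integral_nonneg[rotated])
  show "(\<integral>\<^sup>+ x. ennreal (indicat_real S x * f x) \<partial>lborel) = ennreal I"
    by (rule nn_integral_has_integral_lebesgue[OF assms(3,4)])
qed

lemma nn_integral_of_has_bochner_integral:
  assumes "has_bochner_integral M f x" "\<And>y. 0 \<le> (f y :: real)"
  shows "(\<integral>\<^sup>+ y. ennreal (f y) \<partial>M) = ennreal x"
  using nn_integral_eq_integral[OF integrable.intros[OF assms(1)]] assms
  by (simp add: has_bochner_integral_integral_eq)

lemma integrable_product_lborel: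
  fixes f :: "'a::euclidean_space \<Rightarrow> real" and g :: "'b::euclidean_space \<Rightarrow> real"
  assumes f: "integrable lborel f" and g: "integrable lborel g"
  shows "integrable (lborel \<Otimes>\<^sub>M lborel) (\<lambda>(x, y). f x * g y)"
proof (rule lborel_pair.Fubini_integrable)
  show "integrable lborel (\<lambda>x. LINT y|lborel. norm (case (x, y) of (x, y) \<Rightarrow> f x * g y))"
    using f by (simp add: abs_mult)
qed (use f g in auto)

lemma has_bochner_integral_Gamma:
  fixes a r :: real
  assumes a: "0 < a" and r: "0 < r"
  shows "has_bochner_integral lborel (\<lambda>t. indicat_real {0..} t * (t powr (a - 1) * exp (- (r * t))))
           (Gamma a / r powr a)"
proof -
  have "has_bochner_integral lborel (\<lambda>t. indicat_real {0..} t * (t powr (a - 1) / exp t)) (Gamma a)"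
    using Gamma_integral_real[OF a] by (intro has_bochner_integral_of_has_integral) auto
  hence "has_bochner_integral lborel
     (\<lambda>t. indicat_real {0..} (0 + r * t) * ((0 + r * t) powr (a - 1) / exp (0 + r * t))) (Gamma a /\<^sub>R \<bar>r\<bar>)"
    using r by (subst lborel_has_bochner_integral_real_affine_iff[symmetric]) auto
  hence "has_bochner_integral lborel
     (\<lambda>t. r powr (1 - a) * (indicat_real {0..} (0 + r * t) * ((0 + r * t) powr (a - 1) / exp (0 + r * t))))
     (r powr (1 - a) * (Gamma a /\<^sub>R \<bar>r\<bar>))"
    by (intro has_bochner_integral_mult_right)
  moreover have "r powr (1 - a) * (Gamma a /\<^sub>R \<bar>r\<bar>) = Gamma a / r powr a"
    using r by (simp add: powr_diff field_simps)
  moreover have "(\<lambda>t. r powr (1 - a) * (indicat_real {0..} (0 + r * t) * ((0 + r * t) powr (a - 1) / exp (0 + r * t))))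
      = (\<lambda>t. indicat_real {0..} t * (t powr (a - 1) * exp (- (r * t))))"
    using r by (auto simp: fun_eq_iff indicator_def powr_mult powr_diff exp_minus field_simps zero_le_mult_iff)
  ultimately show ?thesis by simp
qed

lemma has_bochner_integral_Beta:
  fixes a b :: real
  assumes "0 < a" "0 < b"
  shows "has_bochner_integral lborel (\<lambda>t. indicat_real {0..1} t * (t powr (a - 1) * (1 - t) powr (b - 1))) (Beta a b)"
  using has_integral_Beta_real[OF assms] by (intro has_bochner_integral_of_has_integral) auto

text \<open>The substitution t = s sqrt u. With the exponent written as \<open>2 * m - 1\<close>,
  the power of t together with dt becomes s^(2m) u^(m-1) du / 2, so a Beta integral remains.\<close>

lemma has_bochner_integral_Beta_square:
  fixes s m b :: real
  assumes s: "0 < s" and m: "0 < m" and b: "0 < b"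
  shows "has_bochner_integral lborel
    (\<lambda>t. indicat_real {0..s} t * (t powr (2 * m - 1) * (s\<^sup>2 - t\<^sup>2) powr (b - 1)))
    (s powr (2 * m + 2 * b - 2) * Beta m b / 2)"
proof -
  define f where "f = (\<lambda>t. t powr (2 * m - 1) * (s\<^sup>2 - t\<^sup>2) powr (b - 1))"
  define g where "g = (\<lambda>u. s * sqrt u)"
  define g' where "g' = (\<lambda>u. s / (2 * sqrt u))"
  define h where "h = (\<lambda>u. s powr (2 * m + 2 * b - 2) / 2 * (u powr (m - 1) * (1 - u) powr (b - 1)))"
  have fg: "f (g u) * g' u = h u" if "0 < u" "u < 1" for u
  proof -
    have 1: "(s * sqrt u) powr (2 * m - 1) = s powr (2 * m - 1) * u powr (m - 1 / 2)"
      using that s by (simp add: powr_mult powr_half_sqrt[symmetric] powr_powr algebra_simps)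
    have "s\<^sup>2 - (s * sqrt u)\<^sup>2 = s\<^sup>2 * (1 - u)"
      using that by (simp add: power_mult_distrib algebra_simps)
    hence "(s\<^sup>2 - (s * sqrt u)\<^sup>2) powr (b - 1) = (s\<^sup>2) powr (b - 1) * (1 - u) powr (b - 1)"
      using that by (simp only: powr_mult)
    moreover have "(s\<^sup>2) powr (b - 1) = s powr (2 * b - 2)"
      using s powr_powr[of s 2 "b - 1"] by (simp add: right_diff_distrib)
    ultimately have 2: "(s\<^sup>2 - (s * sqrt u)\<^sup>2) powr (b - 1) = s powr (2 * b - 2) * (1 - u) powr (b - 1)"
      by simp
    have 3: "s / (2 * sqrt u) = s powr 1 * u powr (- 1 / 2) / 2"
      using that s by (simp add: powr_half_sqrt[symmetric] powr_minus_divide)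
    have 4: "s powr (2 * m + 2 * b - 2) = s powr (2 * m - 1) * s powr (2 * b - 2) * s powr 1"
      by (simp only: powr_add[symmetric]) (rule arg_cong, simp)
    have 5: "u powr (m - 1) = u powr (m - 1 / 2) * u powr (- 1 / 2)"
      by (simp add: powr_add[symmetric])
    show ?thesis
      unfolding f_def g_def g'_def h_def 1 2 3 4 5 by (simp only: mult_ac times_divide_eq_left times_divide_eq_right)
  qed
  have hB: "has_bochner_integral lborel (\<lambda>u. indicat_real {0..1} u * h u) (s powr (2 * m + 2 * b - 2) * Beta m b / 2)"
    using has_bochner_integral_mult_right[OF has_bochner_integral_Beta[OF m b], of "s powr (2 * m + 2 * b - 2) / 2"]
    unfolding h_def by (simp add: algebra_simps)
  have hset: "set_integrable lborel {0..1} h" "(LINT u:{0..1}|lborel. h u) = s powr (2 * m + 2 * b - 2) * Beta m b / 2"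
    using hB unfolding set_integrable_def set_lebesgue_integral_def has_bochner_integral_iff by auto
  have ee: "einterval 0 1 = {0<..<1::real}" by (simp add: einterval_eq zero_ereal_def one_ereal_def)
  have xx: "0 < x" "x < 1" if "0 < ereal x" "ereal x < 1" for x :: real
    using that by (auto simp: one_ereal_def)
  \<comment> \<open>The substitution rule asks for smoothness only inside (0, 1): \<open>g'\<close>
    is unbounded near 0, and \<open>f\<close> is unbounded near \<open>s\<close> when b < 1.\<close>
  have p1: "DERIV g x :> g' x" if "0 < ereal x" "ereal x < 1" for x
    unfolding g_def g'_def using xx[OF that]
    by (auto intro!: derivative_eq_intros simp: field_simps)
  have p2: "isCont f (g x)" if "0 < ereal x" "ereal x < 1" for x
  proof -
    have "(g x)\<^sup>2 < s\<^sup>2" using xx[OF that] s by (simp add: g_def power_mult_distrib)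
    thus "isCont f (g x)" unfolding f_def using xx[OF that] s
      by (intro continuous_intros) (auto simp: g_def)
  qed
  have p3: "isCont g' x" if "0 < ereal x" "ereal x < 1" for x
    unfolding g'_def using xx[OF that] by (intro continuous_intros) auto
  have p4: "0 \<le> f (g x)" for x by (simp add: f_def)
  have p5: "0 \<le> g' x" if "0 \<le> ereal x" "ereal x \<le> 1" for x
    using s that by (simp add: g'_def)
  have p6: "((ereal \<circ> g \<circ> real_of_ereal) \<longlongrightarrow> 0) (at_right 0)"
  proof -
    have "((\<lambda>x. ereal (g x)) \<longlongrightarrow> ereal (g 0)) (at_right 0)"
      unfolding g_def by (intro tendsto_intros)
    thus ?thesis by (simp add: zero_ereal_def at_right_ereal filterlim_filtermap o_def g_def)
  qed
  have p7: "((ereal \<circ> g \<circ> real_of_ereal) \<longlongrightarrow> ereal s) (at_left 1)"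
  proof -
    have "((\<lambda>x. ereal (g x)) \<longlongrightarrow> ereal (g 1)) (at_left 1)"
      unfolding g_def by (intro tendsto_intros)
    thus ?thesis by (simp add: one_ereal_def at_left_ereal filterlim_filtermap o_def g_def)
  qed
  have p8: "set_integrable lborel (einterval 0 1) (\<lambda>x. f (g x) * g' x)"
  proof -
    have "set_integrable lborel {0<..<1} h"
      by (rule set_integrable_subset[OF hset(1)]) auto
    hence "set_integrable lborel {0<..<1} (\<lambda>x. f (g x) * g' x)"
      by (rule set_integrable_cong[THEN iffD1, rotated -1]) (auto simp: fg)
    thus ?thesis by (simp add: ee)
  qed
  have "(0::ereal) < 1" by simp
  note sub = interval_integral_substitution_nonneg[OF this p1 p2 p3 p4 p5 p6 p7 p8]
  have L1: "(LBINT x=0..1. (f (g x) * g' x)) = (LINT u:{0<..<1}|lborel. h u)"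
    unfolding interval_lebesgue_integral_def ee using fg
    by (auto intro!: set_lebesgue_integral_cong)
  have null: "AE x in lborel. x \<noteq> (0::real)" "AE x in lborel. x \<noteq> (1::real)" "AE x in lborel. x \<noteq> s"
    by (rule AE_lborel_singleton)+
  have L2: "(LINT u:{0<..<1}|lborel. h u) = (LINT u:{0..1}|lborel. h u)"
    unfolding set_lebesgue_integral_def h_def
    by (intro integral_cong_AE) (use null in \<open>auto simp: indicator_def elim!: eventually_elim2\<close>)
  have e2: "einterval 0 (ereal s) = {0<..<s}" by (simp add: einterval_eq zero_ereal_def)
  have "has_bochner_integral lborel (\<lambda>t. indicat_real {0<..<s} t * f t) (s powr (2 * m + 2 * b - 2) * Beta m b / 2)"
    using sub s L1 L2 hset(2) unfolding interval_lebesgue_integral_def e2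
    by (simp add: has_bochner_integral_iff set_integrable_def set_lebesgue_integral_def)
  thus ?thesis
    unfolding f_def
    by (rule has_bochner_integral_cong_AE[THEN iffD1, rotated -1]) (use null in \<open>auto simp: indicator_def elim!: eventually_elim2\<close>)
qed

subsection \<open>Even power series\<close>

text \<open>The common form of cos, \<open>Omega\<close>, \<open>Q\<close> and the square of
  \<open>Omega\<close>. The bound 1/(2k)! assumed of the coefficients below makes cosh a majorant of
  all of them.\<close>

definition even_series :: "(nat \<Rightarrow> real) \<Rightarrow> real \<Rightarrow> real" where
  "even_series a t = (\<Sum>k. a k * t ^ (2 * k))"

lemma even_series_0: "even_series a 0 = a 0"
proof -
  have "(\<lambda>k. a k * 0 ^ (2 * k)) = (\<lambda>k. a k * 0 ^ k)"
    by (auto simp: fun_eq_iff power_0_left)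
  thus ?thesis using powser_sums_zero[of a] by (simp add: even_series_def sums_iff)
qed

lemma summable_cosh_terms: "summable (\<lambda>k. t ^ (2 * k) / fact (2 * k) :: real)"
proof -
  have "summable (\<lambda>n. inverse (fact n) * \<bar>t\<bar> ^ n :: real)" by (rule summable_exp)
  hence "summable ((\<lambda>n. inverse (fact n) * \<bar>t\<bar> ^ n :: real) \<circ> (\<lambda>k. 2 * k))"
    by (rule summable_reindex) (auto simp: inj_def)
  thus ?thesis by (simp add: o_def divide_inverse power_even_abs mult.commute)
qed

context
  fixes a :: "nat \<Rightarrow> real"
  assumes a: "\<And>k. \<bar>a k\<bar> \<le> 1 / fact (2 * k)"
begin

lemma even_series_term_le: "\<bar>a k * t ^ (2 * k)\<bar> \<le> t ^ (2 * k) / fact (2 * k)"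
proof -
  have "\<bar>a k * t ^ (2 * k)\<bar> = \<bar>a k\<bar> * t ^ (2 * k)" by (simp add: abs_mult power_even_abs)
  also have "\<dots> \<le> 1 / fact (2 * k) * t ^ (2 * k)" by (intro mult_right_mono a) simp
  finally show ?thesis by simp
qed

lemma summable_even_series_abs: "summable (\<lambda>k. \<bar>a k * t ^ (2 * k)\<bar>)"
  by (rule summable_comparison_test_ev[OF _ summable_cosh_terms[of t]])
     (auto intro!: always_eventually even_series_term_le)

lemma summable_even_series: "summable (\<lambda>k. a k * t ^ (2 * k))"
  by (rule summable_rabs_cancel[OF summable_even_series_abs])

lemma even_series_sums: "(\<lambda>k. a k * t ^ (2 * k)) sums even_series a t"
  unfolding even_series_def by (rule summable_sums[OF summable_even_series])

lemma isCont_even_series: "isCont (even_series a) t"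
proof -
  have "summable (\<lambda>k. a k * x ^ k)" for x
  proof -
    \<comment> \<open>Evaluation at sqrt |x| turns absolute convergence in t into absolute
      convergence of the ordinary power series in x = t^2, whose continuity is known.\<close>
    have "summable (\<lambda>k. norm (a k * (sqrt \<bar>x\<bar>) ^ (2 * k)))"
      using summable_even_series_abs[of "sqrt \<bar>x\<bar>"] by simp
    hence "summable (\<lambda>k. norm (a k * x ^ k))" by (simp add: power_mult abs_mult power_abs)
    thus ?thesis by (rule summable_norm_cancel)
  qed
  hence "isCont (\<lambda>x. \<Sum>k. a k * x ^ k) x" for x by (rule isCont_powser_converges_everywhere)
  hence "isCont (\<lambda>t. (\<Sum>k. a k * (t ^ 2) ^ k)) t"
    by (intro isCont_o2[where g = "\<lambda>x. \<Sum>k. a k * x ^ k" and f = "\<lambda>t. t ^ 2"]) auto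
  thus ?thesis by (simp add: even_series_def[abs_def] power_mult)
qed

text \<open>Where the weight lives, the k-th term is at most B^(2k)/(2k)! |w|, and these bounds sum
  to cosh B |w|. The measure is arbitrary because the lemma serves both the real line and Euclidean
  space.\<close>

lemma
  fixes w f :: "'b \<Rightarrow> real"
  assumes w: "integrable M w" and f [measurable]: "f \<in> borel_measurable M"
    and B: "\<And>x. x \<in> space M \<Longrightarrow> w x \<noteq> 0 \<Longrightarrow> \<bar>f x\<bar> \<le> B"
  shows integrable_even_series: "integrable M (\<lambda>x. even_series a (f x) * w x)"
    and integral_even_series_sums:
      "(\<lambda>k. a k * (LINT x|M. f x ^ (2 * k) * w x)) sums (LINT x|M. even_series a (f x) * w x)"
proof -
  let ?g = "\<lambda>k x. a k * f x ^ (2 * k) * w x"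
  have wM [measurable]: "w \<in> borel_measurable M" using w by (rule borel_measurable_integrable)
  \<comment> \<open>\<open>B\<close> may be negative if \<open>w\<close> vanishes identically, hence
    the absolute value.\<close>
  have bd: "norm (f x ^ (2 * k) * w x) \<le> norm (\<bar>B\<bar> ^ (2 * k) * w x)" if "x \<in> space M" for x k
  proof (cases "w x = 0")
    case False
    hence "\<bar>f x\<bar> ^ (2 * k) \<le> \<bar>B\<bar> ^ (2 * k)" using B[OF that] by (intro power_mono) auto
    thus ?thesis by (simp add: abs_mult mult_right_mono power_abs)
  qed simp
  have int0: "integrable M (\<lambda>x. f x ^ (2 * k) * w x)" for k
    by (rule Bochner_Integration.integrable_bound[OF integrable_mult_right[OF w, of "\<bar>B\<bar> ^ (2 * k)"]])
       (use bd in auto)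
  have int: "integrable M (?g k)" for k
    using integrable_mult_right[OF int0[of k], of "a k"] by (simp add: mult.assoc)
  have le: "norm (?g k x) \<le> \<bar>B\<bar> ^ (2 * k) / fact (2 * k) * norm (w x)" if "x \<in> space M" for k x
  proof -
    have "norm (?g k x) = \<bar>a k\<bar> * norm (f x ^ (2 * k) * w x)" by (simp add: abs_mult)
    also have "\<dots> \<le> 1 / fact (2 * k) * norm (\<bar>B\<bar> ^ (2 * k) * w x)"
      by (intro mult_mono a bd that) auto
    finally show ?thesis by (simp add: abs_mult)
  qed
  have s1: "AE x in M. summable (\<lambda>k. norm (?g k x))"
  proof (rule AE_I2)
    fix x assume "x \<in> space M"
    show "summable (\<lambda>k. norm (?g k x))"
      using summable_mult2[OF summable_even_series_abs[of "f x"], of "\<bar>w x\<bar>"]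
      by (simp add: abs_mult)
  qed
  have "(LINT x|M. norm (?g k x)) \<le> \<bar>B\<bar> ^ (2 * k) / fact (2 * k) * (LINT x|M. norm (w x))" for k
    by (subst integral_mult_right_zero[symmetric], rule integral_mono_AE)
       (use int w le in auto)
  hence s2: "summable (\<lambda>k. LINT x|M. norm (?g k x))"
    by (intro summable_comparison_test_ev[OF _ summable_mult2[OF summable_cosh_terms[of "\<bar>B\<bar>"]]] always_eventually)
       auto
  have e: "(\<Sum>k. ?g k x) = even_series a (f x) * w x" for x
    using suminf_mult2[OF summable_even_series[of "f x"], of "w x"]
    by (simp add: even_series_def)
  show "integrable M (\<lambda>x. even_series a (f x) * w x)"
    using integrable_suminf[OF int s1 s2] by (simp only: e)
  show "(\<lambda>k. a k * (LINT x|M. f x ^ (2 * k) * w x)) sums (LINT x|M. even_series a (f x) * w x)"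
    using sums_integral[OF int s1 s2] unfolding e by (simp only: mult.assoc integral_mult_right_zero)
qed

end

text \<open>(2k)! = 4^k k! (1/2)_k, so a denominator at least as large as this one is dominated by
  the coefficient of cosh.\<close>

lemma abs_coeff_le:
  fixes p :: "nat \<Rightarrow> real"
  assumes "pochhammer (1 / 2) k \<le> p k"
  shows "\<bar>(- 1) ^ k / (4 ^ k * fact k * p k)\<bar> \<le> 1 / fact (2 * k)"
proof -
  have "0 < pochhammer (1 / 2 :: real) k" by (rule pochhammer_pos) simp
  thus ?thesis using assms by (simp add: fact_double power_mult abs_mult frac_le)
qed

lemma pochhammer_mono:
  fixes x y :: real
  assumes "0 \<le> x" "x \<le> y"
  shows "pochhammer x n \<le> pochhammer y n"
  unfolding pochhammer_prod using assms by (intro prod_mono) auto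

definition Omega_coeff :: "real \<Rightarrow> nat \<Rightarrow> real" where
  "Omega_coeff \<nu> k = (- 1) ^ k / (4 ^ k * fact k * pochhammer (\<nu> + 1) k)"

text \<open>The domination by cosh starts at index -1/2, which is also the smallest index that
  occurs: (d - 2)/2 for d = 1.\<close>

lemma abs_Omega_coeff_le:
  assumes "- 1 / 2 \<le> \<nu>"
  shows "\<bar>Omega_coeff \<nu> k\<bar> \<le> 1 / fact (2 * k)"
  unfolding Omega_coeff_def using assms by (intro abs_coeff_le pochhammer_mono) auto

lemma Omega_eq_even_series:
  assumes "- 1 / 2 \<le> \<nu>"
  shows "Omega \<nu> t = even_series (Omega_coeff \<nu>) t"
proof -
  have nn: "\<nu> + 1 \<notin> \<int>\<^sub>\<le>\<^sub>0" using assms by (auto simp: nonpos_Ints_def)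
  have G: "Gamma (\<nu> + 1) > 0" "\<And>k. Gamma (\<nu> + real k + 1) > 0"
    using assms by (auto intro!: Gamma_real_pos)
  have "Gamma (\<nu> + 1) * ((-1) ^ k / (fact k * Gamma (\<nu> + real k + 1)) * (t / 2) ^ (2 * k))
      = Omega_coeff \<nu> k * t ^ (2 * k)" for k
  proof -
    have "(t / 2) ^ (2 * k) = t ^ (2 * k) / 4 ^ k" by (simp add: power_divide power_mult)
    thus ?thesis using G(1) G(2)[of k] unfolding Omega_coeff_def pochhammer_Gamma[OF nn]
      by (simp add: field_simps add_ac)
  qed
  note e = this
  have sm: "summable (\<lambda>k. (-1) ^ k / (fact k * Gamma (\<nu> + real k + 1)) * (t / 2) ^ (2 * k))"
  proof -
    have "summable (\<lambda>k. Gamma (\<nu> + 1) * ((-1) ^ k / (fact k * Gamma (\<nu> + real k + 1)) * (t / 2) ^ (2 * k)))"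
      unfolding e using abs_Omega_coeff_le[OF assms] by (rule summable_even_series)
    from summable_mult_D[OF this] show ?thesis using G(1) by simp
  qed
  show ?thesis unfolding Omega_def even_series_def e[symmetric]
    by (rule suminf_mult[OF sm, symmetric])
qed

lemma Omega_0:
  assumes "- 1 / 2 \<le> \<nu>"
  shows "Omega \<nu> 0 = 1"
  unfolding Omega_eq_even_series[OF assms] even_series_0 by (simp add: Omega_coeff_def)

lemma isCont_Omega:
  assumes "- 1 / 2 \<le> \<nu>"
  shows "isCont (Omega \<nu>) t"
proof -
  have "Omega \<nu> = even_series (Omega_coeff \<nu>)" by (rule ext) (rule Omega_eq_even_series[OF assms])
  thus ?thesis using isCont_even_series[OF abs_Omega_coeff_le[OF assms]] by simp
qed

definition Q_coeff :: "real \<Rightarrow> nat \<Rightarrow> real" where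
  "Q_coeff \<delta> k = (- 1) ^ k * pochhammer \<delta> k / (4 ^ k * fact k * pochhammer (2 * \<delta>) k * pochhammer (2 * \<delta> + 1 / 2) k)"

lemma Q_eq_even_series: "Q \<delta> r = even_series (Q_coeff \<delta>) r"
  unfolding Q_def hypergeometric_def eval_fps_def even_series_def Q_coeff_def
proof (intro suminf_cong)
  fix k
  have "(- (r\<^sup>2 / 4)) ^ k = (- 1) ^ k * r ^ (2 * k) / 4 ^ k"
    by (simp add: power_minus[of "r\<^sup>2 / 4"] power_divide power_mult)
  thus "fps_nth (fps_hypergeo [\<delta>] [2 * \<delta>, 2 * \<delta> + 1 / 2] 1) k * (- (r\<^sup>2 / 4)) ^ k
      = (- 1) ^ k * pochhammer \<delta> k / (4 ^ k * fact k * pochhammer (2 * \<delta>) k * pochhammer (2 * \<delta> + 1 / 2) k) * r ^ (2 * k)"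
    by (simp add: mult_ac)
qed

lemma abs_Q_coeff_le:
  assumes "0 < \<delta>"
  shows "\<bar>Q_coeff \<delta> k\<bar> \<le> 1 / fact (2 * k)"
proof -
  have p: "0 < pochhammer \<delta> k" "pochhammer \<delta> k \<le> pochhammer (2 * \<delta>) k" "0 < pochhammer (2 * \<delta>) k"
    "0 < pochhammer (2 * \<delta> + 1 / 2) k"
    using assms by (auto intro!: pochhammer_pos pochhammer_mono)
  have "Q_coeff \<delta> k = (pochhammer \<delta> k / pochhammer (2 * \<delta>) k) * ((- 1) ^ k / (4 ^ k * fact k * pochhammer (2 * \<delta> + 1 / 2) k))"
    by (simp add: Q_coeff_def mult_ac)
  also have "\<bar>\<dots>\<bar> \<le> 1 * (1 / fact (2 * k))"
    unfolding abs_mult using p assms by (intro mult_mono abs_coeff_le pochhammer_mono) auto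
  finally show ?thesis by simp
qed

text \<open>The cosine thus belongs to the same family, and cosine integrals are covered by the
  moment comparison for \<open>Omega\<close>.\<close>

lemma Omega_minus_half: "Omega (- 1 / 2) t = cos t"
proof -
  have "Omega_coeff (- 1 / 2) k * t ^ (2 * k) = (- 1) ^ k / fact (2 * k) * t ^ (2 * k)" for k
    by (simp add: Omega_coeff_def fact_double power_mult)
  moreover have "(\<lambda>k. Omega_coeff (- 1 / 2) k * t ^ (2 * k)) sums Omega (- 1 / 2) t"
    unfolding Omega_eq_even_series[OF order_refl]
    by (rule even_series_sums[OF abs_Omega_coeff_le]) simp
  ultimately have "(\<lambda>k. (- 1) ^ k / fact (2 * k) * t ^ (2 * k)) sums Omega (- 1 / 2) t" by simp
  moreover have "(\<lambda>k. (- 1) ^ k / fact (2 * k) * t ^ (2 * k)) sums cos t"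
    using cos_paired[of t] .
  ultimately show ?thesis by (rule sums_unique2)
qed

subsection \<open>Integral representations\<close>

lemma Gamma_duplication_real:
  fixes z :: real
  assumes "0 < z"
  shows "Gamma z * Gamma (z + 1 / 2) = 2 powr (1 - 2 * z) * sqrt pi * Gamma (2 * z)"
proof -
  have 1: "complex_of_real z \<notin> \<int>\<^sub>\<le>\<^sub>0" "complex_of_real z + 1 / 2 \<notin> \<int>\<^sub>\<le>\<^sub>0"
    using assms by (auto elim!: nonpos_Ints_cases simp: complex_eq_iff)
  have "complex_of_real (Gamma z * Gamma (z + 1 / 2))
      = Gamma (complex_of_real z) * Gamma (complex_of_real z + 1 / 2)"
    using Gamma_complex_of_real[of "z + 1 / 2"] by (simp add: Gamma_complex_of_real)
  also have "\<dots> = exp ((1 - 2 * complex_of_real z) * complex_of_real (ln 2)) * complex_of_real (sqrt pi) * Gamma (2 * complex_of_real z)"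
    by (rule Gamma_legendre_duplication[OF 1])
  also have "\<dots> = complex_of_real (exp ((1 - 2 * z) * ln 2) * sqrt pi * Gamma (2 * z))"
    using Gamma_complex_of_real[of "2 * z"] by (simp add: exp_of_real[symmetric])
  finally show ?thesis unfolding of_real_eq_iff by (simp add: powr_def)
qed

lemma Beta_pos: "0 < a \<Longrightarrow> 0 < b \<Longrightarrow> 0 < Beta a (b :: real)"
  by (simp add: Beta_def)

lemma Beta_shift:
  fixes a b :: real
  assumes "0 < a" "0 < b"
  shows "Beta (a + real k) b = Beta a b * pochhammer a k / pochhammer (a + b) k"
proof -
  have n: "a \<notin> \<int>\<^sub>\<le>\<^sub>0" "a + b \<notin> \<int>\<^sub>\<le>\<^sub>0" using assms by (auto simp: nonpos_Ints_def)
  have g: "0 < Gamma a" "0 < Gamma (a + b)" "0 < Gamma (a + b + real k)"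
    using assms by (auto intro!: Gamma_real_pos)
  show ?thesis unfolding Beta_def pochhammer_Gamma[OF n(1)] pochhammer_Gamma[OF n(2)]
    using g by (simp add: add_ac)
qed

text \<open>Integrating against a Beta weight with second parameter b raises the index by b: the
  factor (nu + 1)_k cancels and (nu + b + 1)_k takes its place. This is Poisson's and Sonine's
  integral at the level of coefficients.\<close>

lemma Omega_coeff_Beta:
  assumes "- 1 / 2 \<le> \<nu>" "0 < b"
  shows "Omega_coeff \<nu> k * Beta (\<nu> + 1 + real k) b = Beta (\<nu> + 1) b * Omega_coeff (\<nu> + b) k"
proof -
  have "pochhammer (\<nu> + 1) k > 0" using assms by (intro pochhammer_pos) auto
  thus ?thesis using assms by (subst Beta_shift) (auto simp: Omega_coeff_def add_ac)
qed

text \<open>A shift by 2k produces (2 delta)_2k / (4 delta)_2k, and duplication splits it into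
  (delta)_k (delta + 1/2)_k over (2 delta)_k (2 delta + 1/2)_k. The factor (delta + 1/2)_k cancels
  the parameter of \<open>Omega\<close>, which leaves the 1F2 of \<open>Q\<close>.\<close>

lemma Omega_coeff_Beta_2:
  assumes "0 < \<delta>"
  shows "Omega_coeff (\<delta> - 1 / 2) k * Beta (2 * \<delta> + real (2 * k)) (2 * \<delta>) = Beta (2 * \<delta>) (2 * \<delta>) * Q_coeff \<delta> k"
proof -
  have p: "0 < pochhammer \<delta> k" "0 < pochhammer (\<delta> + 1 / 2) k" "0 < pochhammer (2 * \<delta>) k"
    "0 < pochhammer (2 * \<delta> + 1 / 2) k"
    using assms by (auto intro!: pochhammer_pos)
  have d: "0 < 2 * \<delta>" using assms by simp
  have e: "2 * \<delta> + 2 * \<delta> = 2 * (2 * \<delta>)" by simp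
  have "Beta (2 * \<delta> + real (2 * k)) (2 * \<delta>) = Beta (2 * \<delta>) (2 * \<delta>) *
     (pochhammer \<delta> k * pochhammer (\<delta> + 1 / 2) k / (pochhammer (2 * \<delta>) k * pochhammer (2 * \<delta> + 1 / 2) k))"
    unfolding Beta_shift[of "2 * \<delta>" "2 * \<delta>" "2 * k", OF d d]
      e pochhammer_double by simp
  thus ?thesis using p by (simp add: Omega_coeff_def Q_coeff_def mult_ac add_ac)
qed

text \<open>Every integral formula for \<open>Omega\<close> and \<open>Q\<close> below is an
  instance: only the even moments of the weight enter. \<open>R\<close> is the scale at which the
  resulting series is evaluated; it differs from 1 only in Poisson's integral over [0, s].\<close>

lemma even_series_moments:
  fixes w :: "real \<Rightarrow> real" and m a b :: "nat \<Rightarrow> real"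
  assumes a: "\<And>k. \<bar>a k\<bar> \<le> 1 / fact (2 * k)"
    and w: "\<And>k. has_bochner_integral lborel (\<lambda>t. t ^ (2 * k) * w t) (m k)"
    and s: "\<And>t. w t \<noteq> 0 \<Longrightarrow> \<bar>t\<bar> \<le> B"
    and b: "\<And>k. \<bar>b k\<bar> \<le> 1 / fact (2 * k)" "\<And>k. a k * m k = c * (b k * R ^ (2 * k))"
  shows "has_bochner_integral lborel (\<lambda>t. even_series a (r * t) * w t) (c * even_series b (r * R))"
proof -
  have w0: "integrable lborel w" using w[of 0] by (simp add: has_bochner_integral_iff)
  have sr: "\<bar>r * t\<bar> \<le> \<bar>r\<bar> * B" if "w t \<noteq> 0" for t
    using s[OF that] by (auto simp: abs_mult intro: mult_left_mono)
  have "(LINT t|lborel. (r * t) ^ (2 * k) * w t) = r ^ (2 * k) * m k" for k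
    using has_bochner_integral_mult_right[OF w[of k], of "r ^ (2 * k)"]
    by (simp add: has_bochner_integral_iff power_mult_distrib mult.assoc)
  hence "a k * (LINT t|lborel. (r * t) ^ (2 * k) * w t) = c * (b k * (r * R) ^ (2 * k))" for k
    using arg_cong[OF b(2)[of k], of "\<lambda>x. r ^ (2 * k) * x"] by (simp add: power_mult_distrib mult_ac)
  hence "(\<lambda>k. c * (b k * (r * R) ^ (2 * k))) sums (LINT t|lborel. even_series a (r * t) * w t)"
    using integral_even_series_sums[OF a w0, of "\<lambda>t. r * t" "\<bar>r\<bar> * B"] sr by simp
  moreover have "(\<lambda>k. c * (b k * (r * R) ^ (2 * k))) sums (c * even_series b (r * R))"
    by (intro sums_mult even_series_sums b)
  ultimately have "(LINT t|lborel. even_series a (r * t) * w t) = c * even_series b (r * R)"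
    by (rule sums_unique2)
  moreover have "integrable lborel (\<lambda>t. even_series a (r * t) * w t)"
    by (rule integrable_even_series[OF a w0]) (use sr in auto)
  ultimately show ?thesis by (simp add: has_bochner_integral_iff)
qed

text \<open>Poisson's integral for the Bessel function of index b - 1/2, obtained by raising the
  index -1/2 of the cosine by b.\<close>

lemma Poisson_Omega:
  assumes "0 < s" "0 < b"
  shows "has_bochner_integral lborel (\<lambda>t. indicat_real {0..s} t * (cos (r * t) * (s\<^sup>2 - t\<^sup>2) powr (b - 1)))
     (s powr (2 * b - 1) * Beta (1 / 2) b / 2 * Omega (b - 1 / 2) (r * s))"
proof -
  define w where "w = (\<lambda>t. indicat_real {0..s} t * (s\<^sup>2 - t\<^sup>2) powr (b - 1))"
  have "has_bochner_integral lborel (\<lambda>t. even_series (Omega_coeff (- 1 / 2)) (r * t) * w t)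
     (s powr (2 * b - 1) * Beta (1 / 2) b / 2 * even_series (Omega_coeff (b - 1 / 2)) (r * s))"
  proof (rule even_series_moments)
    fix k
    have "has_bochner_integral lborel
      (\<lambda>t. indicat_real {0..s} t * (t powr (2 * (real k + 1 / 2) - 1) * (s\<^sup>2 - t\<^sup>2) powr (b - 1)))
      (s powr (2 * (real k + 1 / 2) + 2 * b - 2) * Beta (real k + 1 / 2) b / 2)"
      by (rule has_bochner_integral_Beta_square) (use assms in auto)
    moreover have ex: "2 * (real k + 1 / 2) - 1 = real (2 * k)" by simp
    have pw: "t powr (2 * (real k + 1 / 2) - 1) = t ^ (2 * k)" if "0 < t" for t
      unfolding ex by (rule powr_realpow[OF that])
    \<comment> \<open>For k = 0 the two integrands differ at t = 0, since \<open>0 powr 0\<close> is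
      0 but \<open>0 ^ 0\<close> is 1.\<close>
    moreover have "AE t in lborel. t \<noteq> (0::real)" by (rule AE_lborel_singleton)
    hence "AE t in lborel. indicat_real {0..s} t * (t powr (2 * (real k + 1 / 2) - 1) * (s\<^sup>2 - t\<^sup>2) powr (b - 1))
       = t ^ (2 * k) * w t"
      by eventually_elim (use pw in \<open>auto simp: w_def indicator_def\<close>)
    ultimately show "has_bochner_integral lborel (\<lambda>t. t ^ (2 * k) * w t)
       (s powr (2 * (real k + 1 / 2) + 2 * b - 2) * Beta (real k + 1 / 2) b / 2)"
      by (subst (asm) has_bochner_integral_cong_AE) (auto simp: w_def)
    have "2 * (real k + 1 / 2) + 2 * b - 2 = (2 * b - 1) + real (2 * k)" by simp
    hence "s powr (2 * (real k + 1 / 2) + 2 * b - 2) = s powr (2 * b - 1) * s ^ (2 * k)"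
      using assms by (simp only: powr_add powr_realpow)
    thus "Omega_coeff (- 1 / 2) k * (s powr (2 * (real k + 1 / 2) + 2 * b - 2) * Beta (real k + 1 / 2) b / 2)
      = (s powr (2 * b - 1) * Beta (1 / 2) b / 2) * (Omega_coeff (b - 1 / 2) k * s ^ (2 * k))"
      using Omega_coeff_Beta[of "- 1 / 2" b k] assms by (simp add: add_ac)
    show "\<bar>Omega_coeff (- 1 / 2) k\<bar> \<le> 1 / fact (2 * k)" by (rule abs_Omega_coeff_le) simp
    show "\<bar>Omega_coeff (b - 1 / 2) k\<bar> \<le> 1 / fact (2 * k)" by (rule abs_Omega_coeff_le) (use assms in simp)
  next
    show "\<bar>t\<bar> \<le> s" if "w t \<noteq> 0" for t using that by (auto simp: w_def indicator_def split: if_splits)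
  qed
  moreover have "even_series (Omega_coeff (b - 1 / 2)) (r * s) = Omega (b - 1 / 2) (r * s)"
    using assms by (simp add: Omega_eq_even_series)
  moreover have "even_series (Omega_coeff (- 1 / 2)) (r * t) = cos (r * t)" for t
    using Omega_eq_even_series[of "- 1 / 2" "r * t"] by (simp add: Omega_minus_half[simplified])
  ultimately show ?thesis by (simp add: w_def mult_ac)
qed

lemma Q_first_integral:
  assumes "0 < \<delta>"
  shows "has_bochner_integral lborel
     (\<lambda>t. indicat_real {0..1} t * (Omega (\<delta> - 1 / 2) (r * t) * (1 - t) powr (2 * \<delta> - 1) * t powr (2 * \<delta> - 1)))
     (Beta (2 * \<delta>) (2 * \<delta>) * Q \<delta> r)"
proof -
  define w where "w = (\<lambda>t. indicat_real {0..1} t * ((1 - t) powr (2 * \<delta> - 1) * t powr (2 * \<delta> - 1)))"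
  have "has_bochner_integral lborel (\<lambda>t. even_series (Omega_coeff (\<delta> - 1 / 2)) (r * t) * w t)
     (Beta (2 * \<delta>) (2 * \<delta>) * even_series (Q_coeff \<delta>) (r * 1))"
  proof (rule even_series_moments)
    fix k
    have "has_bochner_integral lborel
      (\<lambda>t. indicat_real {0..1} t * (t powr (2 * \<delta> + real (2 * k) - 1) * (1 - t) powr (2 * \<delta> - 1)))
      (Beta (2 * \<delta> + real (2 * k)) (2 * \<delta>))"
      by (rule has_bochner_integral_Beta) (use assms in auto)
    moreover have "indicat_real {0..1} t * (t powr (2 * \<delta> + real (2 * k) - 1) * (1 - t) powr (2 * \<delta> - 1))
       = t ^ (2 * k) * w t" for t
    proof (cases "t = 0")
      case False
      have "t powr (2 * \<delta> + real (2 * k) - 1) = t powr (2 * \<delta> - 1) * t ^ (2 * k)" if "0 \<le> t"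
        using that False powr_add[of t "2 * \<delta> - 1" "real (2 * k)"] powr_realpow[of t "2 * k"]
        by (simp add: algebra_simps)
      thus ?thesis by (auto simp: w_def indicator_def)
    qed (simp add: w_def)
    ultimately show "has_bochner_integral lborel (\<lambda>t. t ^ (2 * k) * w t) (Beta (2 * \<delta> + real (2 * k)) (2 * \<delta>))"
      by simp
    show "Omega_coeff (\<delta> - 1 / 2) k * Beta (2 * \<delta> + real (2 * k)) (2 * \<delta>)
      = Beta (2 * \<delta>) (2 * \<delta>) * (Q_coeff \<delta> k * 1 ^ (2 * k))"
      using Omega_coeff_Beta_2[OF assms, of k] by simp
    show "\<bar>Omega_coeff (\<delta> - 1 / 2) k\<bar> \<le> 1 / fact (2 * k)" by (rule abs_Omega_coeff_le) (use assms in simp)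
    show "\<bar>Q_coeff \<delta> k\<bar> \<le> 1 / fact (2 * k)" by (rule abs_Q_coeff_le[OF assms])
  next
    show "\<bar>t\<bar> \<le> 1" if "w t \<noteq> 0" for t using that by (auto simp: w_def indicator_def split: if_splits)
  qed
  moreover have "even_series (Omega_coeff (\<delta> - 1 / 2)) (r * t) = Omega (\<delta> - 1 / 2) (r * t)" for t
    using assms by (simp add: Omega_eq_even_series)
  ultimately show ?thesis by (simp add: w_def Q_eq_even_series mult_ac)
qed

text \<open>The sum of both end values is a bound whatever the sign of \<open>a\<close>, which
  spares a case distinction on \<open>\<delta> - 1\<close> and \<open>\<delta> - (d + 1) / 2\<close>
  in all later estimates.\<close>

lemma powr_le_sum:
  fixes l w h a :: real
  assumes "0 < l" "l \<le> w" "w \<le> h"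
  shows "w powr a \<le> l powr a + h powr a"
proof (cases "0 \<le> a")
  case True
  hence "w powr a \<le> h powr a" using assms by (intro powr_mono2) auto
  thus ?thesis by (smt (verit) powr_ge_zero)
next
  case False
  hence "w powr a \<le> l powr a" using assms by (intro powr_mono2') auto
  thus ?thesis by (smt (verit) powr_ge_zero)
qed

text \<open>Separates the variables of the kernel (y + 2x)^p, using y <= y + 2x <= 3 max x y, so
  that each part can be integrated as a Gamma integral.\<close>

lemma powr_add_double_le:
  fixes x y p :: real
  assumes "0 < x" "0 < y"
  shows "(y + 2 * x) powr p \<le> (1 + 3 powr p) * y powr p + 3 powr p * x powr p"
proof -
  have "(y + 2 * x) powr p \<le> y powr p + (3 * max x y) powr p"
    using assms by (intro powr_le_sum) auto
  also have "(3 * max x y) powr p \<le> 3 powr p * (y powr p + x powr p)"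
    using assms by (auto simp: powr_mult max_def intro!: mult_left_mono)
  finally show ?thesis by (simp add: algebra_simps)
qed

section \<open>The kernel \<open>Psi\<close>: continuity and moments\<close>

definition Psi_integral :: "real \<Rightarrow> real \<Rightarrow> real \<Rightarrow> real" where
  "Psi_integral a b t = (LINT s:{t..1}|lborel. (s\<^sup>2 - t\<^sup>2) powr a * (1 - s) powr b)"

text \<open>What remains of \<open>Psi_integral\<close> after s = t + (1 - t) u. Since s^2 - t^2 =
  (1 - t) u (2 t + (1 - t) u), a power (1 - t)^(a+b+1) splits off, and the rest is continuous up to
  both end points.\<close>

definition Psi_factor :: "real \<Rightarrow> real \<Rightarrow> real \<Rightarrow> real" where
  "Psi_factor a b t = (LINT u:{0..1}|lborel. u powr a * (1 - u) powr b * (2 * t + (1 - t) * u) powr a)"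

context
  fixes a b :: real
  assumes a: "- 1 / 2 < a" and b: "- 1 < b"
begin

text \<open>A majorant independent of t, from u <= 2 t + (1 - t) u <= 2. Its worst term is u^(2a),
  integrable because 2a > -1; for the exponent in \<open>Psi\<close> this is exactly
  \<open>\<delta> > d / 2\<close>.\<close>

lemma Psi_dominant_integrable:
  "integrable lborel (\<lambda>u. indicat_real {0..1} u * (u powr a * (1 - u) powr b * (u powr a + 2 powr a)))"
proof -
  have 1: "integrable lborel (\<lambda>u. indicat_real {0..1} u * (u powr (2 * a + 1 - 1) * (1 - u) powr (b + 1 - 1)))"
    "integrable lborel (\<lambda>u. indicat_real {0..1} u * (u powr (a + 1 - 1) * (1 - u) powr (b + 1 - 1)))"
    using a b has_bochner_integral_Beta[of "2 * a + 1" "b + 1"] has_bochner_integral_Beta[of "a + 1" "b + 1"]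
    by (auto simp: has_bochner_integral_iff)
  have "integrable lborel (\<lambda>u. indicat_real {0..1} u * (u powr (2 * a) * (1 - u) powr b) +
      2 powr a * (indicat_real {0..1} u * (u powr a * (1 - u) powr b)))"
    using 1 by (intro Bochner_Integration.integrable_add integrable_mult_right) simp_all
  moreover have "u powr (2 * a) = u powr a * u powr a" for u :: real
    by (simp add: powr_add[symmetric])
  ultimately show ?thesis by (simp add: algebra_simps)
qed

lemma Psi_dominant_le:
  assumes "0 \<le> t" "t \<le> 1"
  shows "norm (indicat_real {0..1} u * (u powr a * (1 - u) powr b * (2 * t + (1 - t) * u) powr a))
    \<le> indicat_real {0..1} u * (u powr a * (1 - u) powr b * (u powr a + 2 powr a))"
proof (cases "0 < u \<and> u \<le> 1")
  case True
  have "u \<le> 2 * t + (1 - t) * u" "2 * t + (1 - t) * u \<le> 2"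
  proof -
    have "2 * t + (1 - t) * u = u + t * (2 - u)" by (simp add: algebra_simps)
    moreover have "0 \<le> t * (2 - u)" "t * (2 - u) \<le> 1 * (2 - u)"
      using True assms by (auto intro!: mult_right_mono)
    ultimately show "u \<le> 2 * t + (1 - t) * u" "2 * t + (1 - t) * u \<le> 2" by auto
  qed
  hence "(2 * t + (1 - t) * u) powr a \<le> u powr a + 2 powr a"
    using True by (intro powr_le_sum) auto
  thus ?thesis by (auto simp: indicator_def intro!: mult_left_mono)
qed (auto simp: indicator_def)

lemma Psi_factor_integrable:
  assumes "0 \<le> t" "t \<le> 1"
  shows "integrable lborel (\<lambda>u. indicat_real {0..1} u * (u powr a * (1 - u) powr b * (2 * t + (1 - t) * u) powr a))"
  by (rule Bochner_Integration.integrable_bound[OF Psi_dominant_integrable])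
     (use Psi_dominant_le[OF assms] in \<open>auto intro!: always_eventually order_trans[OF _ abs_ge_self]\<close>)

lemma Psi_factor_continuous: "continuous_on {0..1} (Psi_factor a b)"
proof (rule continuous_on_sequentiallyI)
  fix x :: "nat \<Rightarrow> real" and t
  assume x: "\<forall>n. x n \<in> {0..1}" "t \<in> {0..1}" "x \<longlonglongrightarrow> t"
  show "(\<lambda>n. Psi_factor a b (x n)) \<longlonglongrightarrow> Psi_factor a b t"
    unfolding Psi_factor_def set_lebesgue_integral_def real_scaleR_def
  proof (rule integral_dominated_convergence[where w = "\<lambda>u. indicat_real {0..1} u * (u powr a * (1 - u) powr b * (u powr a + 2 powr a))"])
    show "AE u in lborel. (\<lambda>n. indicat_real {0..1} u * (u powr a * (1 - u) powr b * (2 * x n + (1 - x n) * u) powr a))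
       \<longlonglongrightarrow> indicat_real {0..1} u * (u powr a * (1 - u) powr b * (2 * t + (1 - t) * u) powr a)"
    proof (rule AE_I2)
      fix u :: real
      show "(\<lambda>n. indicat_real {0..1} u * (u powr a * (1 - u) powr b * (2 * x n + (1 - x n) * u) powr a))
       \<longlonglongrightarrow> indicat_real {0..1} u * (u powr a * (1 - u) powr b * (2 * t + (1 - t) * u) powr a)"
      proof (cases "0 < u \<and> u \<le> 1")
        case True
        have "2 * t + (1 - t) * u = u + t * (2 - u)" by (simp add: algebra_simps)
        moreover have "0 \<le> t * (2 - u)" using True x by auto
        ultimately have "2 * t + (1 - t) * u \<noteq> 0" using True by auto
        thus ?thesis by (intro tendsto_intros x(3)) auto
      qed (auto simp: indicator_def)
    qed
    show "AE u in lborel. norm (indicat_real {0..1} u * (u powr a * (1 - u) powr b * (2 * x n + (1 - x n) * u) powr a))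
      \<le> indicat_real {0..1} u * (u powr a * (1 - u) powr b * (u powr a + 2 powr a))" for n
      using Psi_dominant_le x(1) by (intro always_eventually allI) auto
  qed (use Psi_dominant_integrable in auto)
qed

lemma Psi_integral_has_bochner_integral:
  assumes t: "0 \<le> t" "t \<le> 1"
  shows "has_bochner_integral lborel (\<lambda>s. indicat_real {t..1} s * ((s\<^sup>2 - t\<^sup>2) powr a * (1 - s) powr b))
     ((1 - t) powr (a + b + 1) * Psi_factor a b t)"
\<comment> \<open>The substitution degenerates at t = 1, where the domain of integration is a single
  point.\<close>
proof (cases "t = 1")
  case True
  have "indicat_real {1..1} s * ((s\<^sup>2 - 1\<^sup>2) powr a * (1 - s) powr b) = 0" for s :: real
    by (auto simp: indicator_def)
  hence "(\<lambda>s. indicat_real {1..1} s * ((s\<^sup>2 - 1\<^sup>2) powr a * (1 - s) powr b)) = (\<lambda>s. 0)" by blast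
  thus ?thesis using True by (simp add: has_bochner_integral_zero)
next
  case False
  hence t1: "t < 1" using t by simp
  let ?g = "\<lambda>u. indicat_real {0..1} u * (u powr a * (1 - u) powr b * (2 * t + (1 - t) * u) powr a)"
  let ?f = "\<lambda>s. indicat_real {t..1} s * ((s\<^sup>2 - t\<^sup>2) powr a * (1 - s) powr b)"
  have e: "?f (t + (1 - t) * u) = (1 - t) powr (a + b) * ?g u" for u
  proof -
    have ind: "indicat_real {t..1} (t + (1 - t) * u) = indicat_real {0..1} u"
    proof -
      have "t + (1 - t) * u \<le> 1 \<longleftrightarrow> u \<le> 1"
      proof -
        have "t + (1 - t) * u \<le> 1 \<longleftrightarrow> (1 - t) * u \<le> (1 - t) * 1" by auto
        thus ?thesis using t1 mult_le_cancel_left_pos[of "1 - t" u 1] by simp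
      qed
      thus ?thesis using t1 by (auto simp: indicator_def zero_le_mult_iff)
    qed
    have "(t + (1 - t) * u)\<^sup>2 - t\<^sup>2 = (1 - t) * (u * (2 * t + (1 - t) * u))"
      by (simp add: power2_eq_square algebra_simps)
    moreover have "1 - (t + (1 - t) * u) = (1 - t) * (1 - u)" by (simp add: algebra_simps)
    moreover have "0 \<le> 2 * t + (1 - t) * u" if "0 \<le> u" using that t by simp
    ultimately show ?thesis unfolding ind using t1
      by (auto simp: powr_mult powr_add indicator_def)
  qed
  have "has_bochner_integral lborel ?g (Psi_factor a b t)"
    using Psi_factor_integrable[OF t] by (simp add: has_bochner_integral_iff Psi_factor_def set_lebesgue_integral_def)
  hence "has_bochner_integral lborel (\<lambda>u. ?f (t + (1 - t) * u)) ((1 - t) powr (a + b) * Psi_factor a b t)"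
    unfolding e by (rule has_bochner_integral_mult_right)
  moreover have "(1 - t) powr (a + b) * Psi_factor a b t = ((1 - t) powr (a + b + 1) * Psi_factor a b t) /\<^sub>R \<bar>1 - t\<bar>"
    using t1 by (simp add: powr_add field_simps)
  ultimately have "has_bochner_integral lborel (\<lambda>u. ?f (t + (1 - t) * u)) (((1 - t) powr (a + b + 1) * Psi_factor a b t) /\<^sub>R \<bar>1 - t\<bar>)"
    by simp
  thus ?thesis using t1 by (subst lborel_has_bochner_integral_real_affine_iff[of "1 - t" _ _ t]) auto
qed

lemma Psi_integral_eq:
  assumes "0 \<le> t" "t \<le> 1"
  shows "Psi_integral a b t = (1 - t) powr (a + b + 1) * Psi_factor a b t"
  using Psi_integral_has_bochner_integral[OF assms]
  by (simp add: Psi_integral_def set_lebesgue_integral_def has_bochner_integral_iff)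

lemma Psi_integral_nonneg: "0 \<le> Psi_integral a b t"
  unfolding Psi_integral_def set_lebesgue_integral_def by (rule Bochner_Integration.integral_nonneg) (auto simp: indicator_def)

text \<open>The origin of the normalisation of \<open>Psi\<close>: with its exponents this is
  \<open>Beta (2 * \<delta> - real d) (2 * \<delta>)\<close>, so \<open>Psi\<close> takes the value
  1 at 0.\<close>

lemma Psi_integral_0: "Psi_integral a b 0 = Beta (2 * a + 1) (b + 1)"
proof -
  have dbl: "u powr (a * 2) = u powr a * u powr a" for u :: real
    by (simp add: powr_add[symmetric] mult.commute)
  have "Psi_integral a b 0 = (LINT u:{0..1}|lborel. u powr (2 * a + 1 - 1) * (1 - u) powr (b + 1 - 1))"
    unfolding Psi_integral_eq[of 0, simplified] Psi_factor_def set_lebesgue_integral_def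
    by (simp add: dbl mult_ac)
  also have "\<dots> = Beta (2 * a + 1) (b + 1)"
    using has_bochner_integral_Beta[of "2 * a + 1" "b + 1"] a b
    by (simp add: set_lebesgue_integral_def has_bochner_integral_iff)
  finally show ?thesis .
qed

lemma Psi_integral_continuous:
  assumes "0 < a + b + 1"
  shows "continuous_on {0..1} (Psi_integral a b)"
proof -
  have "continuous_on {0..1} (\<lambda>t. (1 - t) powr (a + b + 1) * Psi_factor a b t)"
    using assms by (intro continuous_intros continuous_on_powr' Psi_factor_continuous) auto
  thus ?thesis by (rule continuous_on_cong[THEN iffD1, rotated -1]) (auto simp: Psi_integral_eq)
qed

text \<open>Tonelli on the triangle 0 <= t <= s <= 1. The integral over t is a Beta value times
  s^(2m+2a), and the remaining one over s is again a Beta integral.\<close>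

lemma Psi_integral_moment:
  assumes m: "0 < m" and ab: "0 < a + b + 1"
  shows "has_bochner_integral lborel (\<lambda>t. indicat_real {0..1} t * (t powr (2 * m - 1) * Psi_integral a b t))
     (Beta m (a + 1) / 2 * Beta (2 * m + 2 * a + 1) (b + 1))"
proof (rule has_bochner_integral_nn_integral)
  let ?k = "\<lambda>t s. if 0 \<le> t \<and> t \<le> s \<and> s \<le> 1 then ennreal (t powr (2 * m - 1) * ((s\<^sup>2 - t\<^sup>2) powr a * (1 - s) powr b)) else 0"
  have "(\<lambda>t. indicat_real {0..1} t *\<^sub>R Psi_integral a b t) \<in> borel_measurable borel"
    by (rule borel_measurable_continuous_on_indicator[OF _ Psi_integral_continuous[OF ab]]) simp
  hence "(\<lambda>t. (indicat_real {0..1} t *\<^sub>R Psi_integral a b t) * t powr (2 * m - 1)) \<in> borel_measurable borel"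
    by (rule borel_measurable_times) simp
  thus "(\<lambda>t. indicat_real {0..1} t * (t powr (2 * m - 1) * Psi_integral a b t)) \<in> borel_measurable lborel"
    by (simp add: mult_ac)
  have "Beta m (a + 1) > 0" "Beta (2 * m + 2 * a + 1) (b + 1) > 0"
    using m a b by (auto intro!: Beta_pos)
  thus "0 \<le> Beta m (a + 1) / 2 * Beta (2 * m + 2 * a + 1) (b + 1)" by simp
  show "AE t in lborel. 0 \<le> indicat_real {0..1} t * (t powr (2 * m - 1) * Psi_integral a b t)"
    using Psi_integral_nonneg by (auto simp: indicator_def)
  have "(\<integral>\<^sup>+ t. ennreal (indicat_real {0..1} t * (t powr (2 * m - 1) * Psi_integral a b t)) \<partial>lborel)
     = (\<integral>\<^sup>+ t. \<integral>\<^sup>+ s. ?k t s \<partial>lborel \<partial>lborel)"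
  proof (rule nn_integral_cong)
    fix t :: real
    show "ennreal (indicat_real {0..1} t * (t powr (2 * m - 1) * Psi_integral a b t)) = (\<integral>\<^sup>+ s. ?k t s \<partial>lborel)"
    proof (cases "0 \<le> t \<and> t \<le> 1")
      case True
      have "has_bochner_integral lborel (\<lambda>s. t powr (2 * m - 1) * (indicat_real {t..1} s * ((s\<^sup>2 - t\<^sup>2) powr a * (1 - s) powr b)))
        (t powr (2 * m - 1) * Psi_integral a b t)"
        using Psi_integral_has_bochner_integral[of t] True Psi_integral_eq[of t]
        by (intro has_bochner_integral_mult_right) auto
      from nn_integral_of_has_bochner_integral[OF this]
      have "(\<integral>\<^sup>+ s. ennreal (t powr (2 * m - 1) * (indicat_real {t..1} s * ((s\<^sup>2 - t\<^sup>2) powr a * (1 - s) powr b))) \<partial>lborel)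
         = ennreal (t powr (2 * m - 1) * Psi_integral a b t)" by simp
      moreover have "ennreal (t powr (2 * m - 1) * (indicat_real {t..1} s * ((s\<^sup>2 - t\<^sup>2) powr a * (1 - s) powr b))) = ?k t s" for s
        using True by (auto simp: indicator_def)
      ultimately show ?thesis using True by simp
    next
      case False
      hence k: "?k t = (\<lambda>s. 0)" by auto
      show ?thesis unfolding k using False by (auto simp: indicator_def)
    qed
  qed
  also have "\<dots> = (\<integral>\<^sup>+ s. \<integral>\<^sup>+ t. ?k t s \<partial>lborel \<partial>lborel)"
    by (rule lborel_pair.Fubini'[symmetric]) measurable
  also have "\<dots> = (\<integral>\<^sup>+ s. ennreal (Beta m (a + 1) / 2 * (indicat_real {0..1} s * (s powr (2 * m + 2 * a + 1 - 1) * (1 - s) powr (b + 1 - 1)))) \<partial>lborel)"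
  proof (rule nn_integral_cong_AE)
    have "AE s in lborel. s \<noteq> (0::real)" by (rule AE_lborel_singleton)
    thus "AE s in lborel. (\<integral>\<^sup>+ t. ?k t s \<partial>lborel) =
      ennreal (Beta m (a + 1) / 2 * (indicat_real {0..1} s * (s powr (2 * m + 2 * a + 1 - 1) * (1 - s) powr (b + 1 - 1))))"
    proof eventually_elim
      fix s :: real assume s0: "s \<noteq> 0"
      show "(\<integral>\<^sup>+ t. ?k t s \<partial>lborel) =
        ennreal (Beta m (a + 1) / 2 * (indicat_real {0..1} s * (s powr (2 * m + 2 * a + 1 - 1) * (1 - s) powr (b + 1 - 1))))"
      proof (cases "0 \<le> s \<and> s \<le> 1")
        case True
        have h: "has_bochner_integral lborel (\<lambda>t. (1 - s) powr b * (indicat_real {0..s} t * (t powr (2 * m - 1) * (s\<^sup>2 - t\<^sup>2) powr (a + 1 - 1))))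
          ((1 - s) powr b * (s powr (2 * m + 2 * (a + 1) - 2) * Beta m (a + 1) / 2))"
          using True s0 m a by (intro has_bochner_integral_mult_right has_bochner_integral_Beta_square) auto
        from nn_integral_of_has_bochner_integral[OF h]
        have "(\<integral>\<^sup>+ t. ennreal ((1 - s) powr b * (indicat_real {0..s} t * (t powr (2 * m - 1) * (s\<^sup>2 - t\<^sup>2) powr (a + 1 - 1)))) \<partial>lborel)
           = ennreal ((1 - s) powr b * (s powr (2 * m + 2 * (a + 1) - 2) * Beta m (a + 1) / 2))" by simp
        moreover have "ennreal ((1 - s) powr b * (indicat_real {0..s} t * (t powr (2 * m - 1) * (s\<^sup>2 - t\<^sup>2) powr (a + 1 - 1)))) = ?k t s" for t
          using True by (auto simp: indicator_def mult_ac)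
        ultimately show ?thesis using True by (simp add: mult_ac)
      next
        case False
        hence k: "(\<lambda>t. ?k t s) = (\<lambda>t. 0)" by auto
        show ?thesis unfolding k using False by (auto simp: indicator_def)
      qed
    qed
  qed
  also have "\<dots> = ennreal (Beta m (a + 1) / 2 * Beta (2 * m + 2 * a + 1) (b + 1))"
  proof -
    have h: "has_bochner_integral lborel (\<lambda>s. Beta m (a + 1) / 2 * (indicat_real {0..1} s * (s powr (2 * m + 2 * a + 1 - 1) * (1 - s) powr (b + 1 - 1))))
       (Beta m (a + 1) / 2 * Beta (2 * m + 2 * a + 1) (b + 1))"
      using m a b by (intro has_bochner_integral_mult_right has_bochner_integral_Beta) auto
    have "0 < Beta m (a + 1)" using m a by (intro Beta_pos) auto
    thus ?thesis
      using nn_integral_of_has_bochner_integral[OF h] by simp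
  qed
  finally show "(\<integral>\<^sup>+ t. ennreal (indicat_real {0..1} t * (t powr (2 * m - 1) * Psi_integral a b t)) \<partial>lborel)
     = ennreal (Beta m (a + 1) / 2 * Beta (2 * m + 2 * a + 1) (b + 1))" .
qed

end

context
  fixes d :: nat and \<delta> :: real
  assumes d: "1 \<le> d" and \<delta>: "real d / 2 < \<delta>"
begin

lemma Psi_exponents:
  "- 1 / 2 < \<delta> - (real d + 1) / 2" "- 1 < 2 * \<delta> - 1" "0 < \<delta> - (real d + 1) / 2 + (2 * \<delta> - 1) + 1"
  "1 / 2 < \<delta>" "0 < 2 * \<delta> - real d"
  using d \<delta> by (auto simp: field_simps)

lemma Psi_eq:
  "Psi d \<delta> t = (if 0 \<le> t \<and> t \<le> 1
     then Psi_integral (\<delta> - (real d + 1) / 2) (2 * \<delta> - 1) t / Beta (2 * \<delta> - real d) (2 * \<delta>) else 0)"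
  by (simp add: Psi_def Psi_integral_def)

lemma Psi_nonneg: "0 \<le> Psi d \<delta> t"
  using Psi_integral_nonneg Psi_exponents Beta_pos[of "2 * \<delta> - real d" "2 * \<delta>"] by (auto simp: Psi_eq)

lemma Psi_0: "Psi d \<delta> 0 = 1"
proof -
  have "0 < Beta (2 * \<delta> - real d) (2 * \<delta>)" using Psi_exponents by (intro Beta_pos) auto
  moreover have "2 * (\<delta> - (real d + 1) / 2) + 1 = 2 * \<delta> - real d" by (simp add: field_simps)
  moreover note Psi_integral_0[OF Psi_exponents(1,2)]
  ultimately show ?thesis by (simp only: Psi_eq) simp
qed

lemma Psi_eq_0: "1 \<le> t \<Longrightarrow> Psi d \<delta> t = 0"
  using Psi_integral_eq[OF Psi_exponents(1,2), of 1] by (auto simp: Psi_eq)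

text \<open>The pieces on [0, 1] and beyond fit at t = 1 because the power of 1 - t that splits off
  has the positive exponent 3 delta - (d + 1)/2.\<close>

lemma Psi_continuous: "continuous_on {0..} (Psi d \<delta>)"
proof -
  have "continuous_on {0..1} (\<lambda>t. Psi_integral (\<delta> - (real d + 1) / 2) (2 * \<delta> - 1) t / Beta (2 * \<delta> - real d) (2 * \<delta>))"
    using Beta_pos[of "2 * \<delta> - real d" "2 * \<delta>"] Psi_exponents
    by (intro continuous_intros Psi_integral_continuous) auto
  hence "continuous_on {0..1} (Psi d \<delta>)"
    by (rule continuous_on_cong[THEN iffD1, rotated -1]) (auto simp: Psi_eq)
  moreover have "continuous_on {1..} (Psi d \<delta>)"
    by (rule continuous_on_cong[THEN iffD1, OF refl _ continuous_on_const[of _ 0]]) (auto simp: Psi_eq_0)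
  ultimately have "continuous_on ({0..1} \<union> {1..}) (Psi d \<delta>)"
    by (intro continuous_on_closed_Un) auto
  moreover have "{0..1} \<union> {1..} = {0::real..}" by auto
  ultimately show ?thesis by simp
qed

lemma tau_pos: "0 < tau d \<delta>"
  unfolding tau_def using d \<delta> Psi_exponents
  by (intro divide_pos_pos mult_pos_pos Gamma_real_pos) auto

text \<open>\<open>tau\<close> is the reciprocal of the constant that the moments of
  \<open>Psi\<close> produce. The closed form results from the duplication formula at delta - d/2
  and at delta; the powers of 2 and the square roots of pi cancel.\<close>

lemma tau_Beta:
  "tau d \<delta> * (Beta (real d / 2) (\<delta> - (real d - 1) / 2) / 2 / Beta (2 * \<delta> - real d) (2 * \<delta>)) * Beta (2 * \<delta>) (2 * \<delta>) = 1"
proof -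
  have pos: "0 < \<delta> - real d / 2" "0 < \<delta>" "0 < 2 * \<delta> - real d" "0 < 4 * \<delta> - real d" "0 < real d / 2"
    "0 < \<delta> - (real d - 1) / 2" "0 < \<delta> + 1 / 2"
    using d \<delta> by (auto simp: field_simps)
  have "0 < 2 * \<delta>" "0 < 4 * \<delta>" using pos by auto
  note G = pos[THEN Gamma_real_pos] this[THEN Gamma_real_pos]
  have 1: "Gamma (\<delta> - real d / 2) * Gamma (\<delta> - (real d - 1) / 2) = 2 powr (1 - 2 * \<delta> + real d) * sqrt pi * Gamma (2 * \<delta> - real d)"
    using Gamma_duplication_real[OF pos(1)] by (simp add: algebra_simps diff_divide_distrib)
  have 2: "Gamma \<delta> * Gamma (\<delta> + 1 / 2) = 2 powr (1 - 2 * \<delta>) * sqrt pi * Gamma (2 * \<delta>)"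
    by (rule Gamma_duplication_real[OF pos(2)])
  have 3: "Beta (real d / 2) (\<delta> - (real d - 1) / 2) = Gamma (real d / 2) * Gamma (\<delta> - (real d - 1) / 2) / Gamma (\<delta> + 1 / 2)"
    by (simp add: Beta_def algebra_simps diff_divide_distrib)
  have 4: "Beta (2 * \<delta> - real d) (2 * \<delta>) = Gamma (2 * \<delta> - real d) * Gamma (2 * \<delta>) / Gamma (4 * \<delta> - real d)"
    by (simp add: Beta_def algebra_simps)
  have 5: "Beta (2 * \<delta>) (2 * \<delta>) = Gamma (2 * \<delta>) * Gamma (2 * \<delta>) / Gamma (4 * \<delta>)"
    by (simp add: Beta_def)
  have 6: "2 powr (1 - real d) * 2 powr (1 - 2 * \<delta> + real d) = 2 * 2 powr (1 - 2 * \<delta>)"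
  proof -
    have "2 powr (1 - real d) * 2 powr (1 - 2 * \<delta> + real d) = 2 powr (1 + (1 - 2 * \<delta>))"
      by (simp add: powr_add[symmetric])
    also have "\<dots> = 2 powr 1 * 2 powr (1 - 2 * \<delta>)" by (rule powr_add)
    finally show ?thesis by simp
  qed
  have "tau d \<delta> * (Beta (real d / 2) (\<delta> - (real d - 1) / 2) / 2 / Beta (2 * \<delta> - real d) (2 * \<delta>)) * Beta (2 * \<delta>) (2 * \<delta>)
     = (2 powr (1 - real d) * (Gamma (\<delta> - real d / 2) * Gamma (\<delta> - (real d - 1) / 2)) * Gamma (2 * \<delta>))
       / (2 * (Gamma \<delta> * Gamma (\<delta> + 1 / 2)) * Gamma (2 * \<delta> - real d))"
    unfolding tau_def 3 4 5 using G by (simp add: divide_simps)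
  also have "\<dots> = (2 powr (1 - real d) * 2 powr (1 - 2 * \<delta> + real d)) * (sqrt pi * Gamma (2 * \<delta> - real d) * Gamma (2 * \<delta>))
       / (2 * 2 powr (1 - 2 * \<delta>) * (sqrt pi * Gamma (2 * \<delta>) * Gamma (2 * \<delta> - real d)))"
    unfolding 1 2 by (simp only: mult_ac)
  also have "\<dots> = 1" unfolding 6 using G by simp
  finally show ?thesis .
qed

text \<open>Each moment of \<open>Psi\<close> is a product of two Beta values. The first raises the
  index from (d - 2)/2 to delta - 1/2; the second is the one that already turned
  \<open>Omega (\<delta> - 1 / 2)\<close> into \<open>Q\<close>.\<close>

lemma Q_second_integral:
  "has_bochner_integral lborel (\<lambda>t. indicat_real {0..} t * (Omega ((real d - 2) / 2) (r * t) * Psi d \<delta> t * t ^ (d - 1)))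
     (Q \<delta> r / tau d \<delta>)"
proof -
  let ?al = "\<delta> - (real d + 1) / 2" and ?be = "2 * \<delta> - 1" and ?B = "Beta (2 * \<delta> - real d) (2 * \<delta>)"
  define w where "w = (\<lambda>t. indicat_real {0..} t * (Psi d \<delta> t * t ^ (d - 1)))"
  have nu: "- 1 / 2 \<le> (real d - 2) / 2" using d by simp
  have Bp: "0 < ?B" using Psi_exponents by (intro Beta_pos) auto
  have "has_bochner_integral lborel (\<lambda>t. even_series (Omega_coeff ((real d - 2) / 2)) (r * t) * w t)
     (1 / tau d \<delta> * even_series (Q_coeff \<delta>) (r * 1))"
  proof (rule even_series_moments)
    fix k
    let ?m = "real d / 2 + real k"
    have m: "0 < ?m" using d by simp
    have hb: "has_bochner_integral lborel (\<lambda>t. 1 / ?B * (indicat_real {0..1} t * (t powr (2 * ?m - 1) * Psi_integral ?al ?be t)))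
       (1 / ?B * (Beta ?m (?al + 1) / 2 * Beta (2 * ?m + 2 * ?al + 1) (?be + 1)))"
      using Psi_exponents m by (intro has_bochner_integral_mult_right Psi_integral_moment) auto
    \<comment> \<open>The point 0 is excluded because for d = 1 and k = 0 the exponent is 0, where
      \<open>powr\<close> and \<open>^\<close> disagree at 0.\<close>
    have "1 / ?B * (indicat_real {0..1} t * (t powr (2 * ?m - 1) * Psi_integral ?al ?be t)) = t ^ (2 * k) * w t"
      if "t \<noteq> 0" for t
    proof -
      have "2 * ?m - 1 = real (2 * k) + real (d - 1)" using d by (simp add: of_nat_diff)
      hence "t powr (2 * ?m - 1) = t ^ (2 * k) * t ^ (d - 1)" if "0 < t"
        using that by (simp only: powr_add powr_realpow)
      thus ?thesis using that by (auto simp: w_def Psi_eq indicator_def)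
    qed
    hence "AE t in lborel. 1 / ?B * (indicat_real {0..1} t * (t powr (2 * ?m - 1) * Psi_integral ?al ?be t)) = t ^ (2 * k) * w t"
      using AE_lborel_singleton[of "0::real"] by auto
    moreover have "w \<in> borel_measurable borel"
    proof -
      have "continuous_on {0..} (\<lambda>t. Psi d \<delta> t * t ^ (d - 1))"
        by (intro continuous_intros Psi_continuous)
      from borel_measurable_continuous_on_indicator[OF _ this] show ?thesis by (simp add: w_def)
    qed
    ultimately have *: "has_bochner_integral lborel (\<lambda>t. t ^ (2 * k) * w t)
       (1 / ?B * (Beta ?m (?al + 1) / 2 * Beta (2 * ?m + 2 * ?al + 1) (?be + 1)))"
      using borel_measurable_has_bochner_integral[OF hb]
      by (intro has_bochner_integral_cong_AE[THEN iffD1, OF _ _ _ hb]) simp_all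
    have e: "?al + 1 = \<delta> - (real d - 1) / 2" "2 * ?m + 2 * ?al + 1 = 2 * \<delta> + real (2 * k)" "?be + 1 = 2 * \<delta>"
      by (auto simp: field_simps)
    show "has_bochner_integral lborel (\<lambda>t. t ^ (2 * k) * w t)
       (1 / ?B * (Beta ?m (\<delta> - (real d - 1) / 2) / 2 * Beta (2 * \<delta> + real (2 * k)) (2 * \<delta>)))"
      using * unfolding e .
    let ?o = "Omega_coeff ((real d - 2) / 2) k" and ?b = "\<delta> - (real d - 1) / 2"
    have o: "?o * Beta ?m ?b = Beta (real d / 2) ?b * Omega_coeff (\<delta> - 1 / 2) k"
    proof -
      have "0 < ?b" using \<delta> by (simp add: field_simps)
      have "(real d - 2) / 2 + 1 + real k = ?m" "(real d - 2) / 2 + 1 = real d / 2"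
        "(real d - 2) / 2 + ?b = \<delta> - 1 / 2" by (auto simp: field_simps)
      with Omega_coeff_Beta[OF nu \<open>0 < ?b\<close>, of k] show ?thesis by metis
    qed
    have "?o * (1 / ?B * (Beta ?m ?b / 2 * Beta (2 * \<delta> + real (2 * k)) (2 * \<delta>)))
      = (?o * Beta ?m ?b) * (1 / ?B / 2) * Beta (2 * \<delta> + real (2 * k)) (2 * \<delta>)" by simp
    also have "\<dots> = Beta (real d / 2) ?b / 2 / ?B * (Omega_coeff (\<delta> - 1 / 2) k * Beta (2 * \<delta> + real (2 * k)) (2 * \<delta>))"
      unfolding o by simp
    also have "\<dots> = (Beta (real d / 2) ?b / 2 / ?B * Beta (2 * \<delta>) (2 * \<delta>)) * Q_coeff \<delta> k"
      using Psi_exponents by (subst Omega_coeff_Beta_2) auto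
    also have "Beta (real d / 2) ?b / 2 / ?B * Beta (2 * \<delta>) (2 * \<delta>) = 1 / tau d \<delta>"
      using inverse_unique[OF tau_Beta[unfolded mult.assoc[of "tau d \<delta>"]]] by (simp add: inverse_eq_divide)
    finally show "?o * (1 / ?B * (Beta ?m ?b / 2 * Beta (2 * \<delta> + real (2 * k)) (2 * \<delta>)))
      = 1 / tau d \<delta> * (Q_coeff \<delta> k * 1 ^ (2 * k))" by simp
    show "\<bar>?o\<bar> \<le> 1 / fact (2 * k)" by (rule abs_Omega_coeff_le[OF nu])
    show "\<bar>Q_coeff \<delta> k\<bar> \<le> 1 / fact (2 * k)" by (rule abs_Q_coeff_le) (use Psi_exponents in auto)
  next
    show "\<bar>t\<bar> \<le> 1" if "w t \<noteq> 0" for t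
      using that Psi_eq_0[of t] by (cases "1 \<le> t") (auto simp: w_def indicator_def split: if_splits)
  qed
  moreover have "even_series (Omega_coeff ((real d - 2) / 2)) (r * t) = Omega ((real d - 2) / 2) (r * t)" for t
    using Omega_eq_even_series[OF nu] by simp
  ultimately show ?thesis by (simp add: w_def Q_eq_even_series mult_ac)
qed

end

subsection \<open>Radial integrals in Euclidean space\<close>

lemma nn_integral_lborel_affine:
  fixes f :: "'a::euclidean_space \<Rightarrow> ennreal"
  assumes [measurable]: "f \<in> borel_measurable borel" and "c \<noteq> 0"
  shows "(\<integral>\<^sup>+ y. f y \<partial>lborel) = ennreal (\<bar>c\<bar> ^ DIM('a)) * (\<integral>\<^sup>+ y. f (t + c *\<^sub>R y) \<partial>lborel)"
  by (subst lborel_affine[OF assms(2), of t]) (simp add: nn_integral_density nn_integral_distr nn_integral_cmult)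

lemma nn_integral_power_Icc:
  fixes R :: real
  assumes "0 < n" "0 \<le> R"
  shows "(\<integral>\<^sup>+ t. ennreal (t ^ (n - 1)) * indicator {0..R} t \<partial>lborel) = ennreal (R ^ n / n)"
proof -
  have "(\<integral>\<^sup>+ t. ennreal (t ^ (n - 1)) * indicator {0..R} t \<partial>lborel) = ennreal (R ^ n / n - 0 ^ n / n)"
  proof (rule nn_integral_FTC_Icc)
    fix t :: real assume "t \<in> {0..R}"
    show "DERIV (\<lambda>x. x ^ n / n) t :> t ^ (n - 1)"
      using assms by (auto intro!: derivative_eq_intros)
  qed (use assms in auto)
  thus ?thesis using assms by (simp add: zero_power)
qed

text \<open>The integral of (x . y)^(2k) over the unit sphere, expressed through the unit ball: the
  ball integral is homogeneous of degree \<open>DIM('a) + 2 * k\<close> in the radius, and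
  differentiating in the radius brings this factor down.\<close>

definition moment_const :: "'a::euclidean_space \<Rightarrow> nat \<Rightarrow> real" where
  "moment_const x k = (DIM('a) + 2 * k) * enn2real (\<integral>\<^sup>+ y. ennreal ((x \<bullet> y) ^ (2 * k)) * indicator (cball 0 1) y \<partial>lborel)"

lemma moment_const_nonneg: "0 \<le> moment_const x k"
  by (simp add: moment_const_def)

lemma moment_cball:
  fixes x :: "'a::euclidean_space"
  assumes R: "0 \<le> R"
  shows "(\<integral>\<^sup>+ y. ennreal ((x \<bullet> y) ^ (2 * k)) * indicator (cball 0 R) y \<partial>lborel)
    = ennreal (moment_const x k * R ^ (DIM('a) + 2 * k) / (DIM('a) + 2 * k))"
proof -
  have [measurable]: "cball (0::'a) r \<in> sets borel" for r by simp
  let ?I = "\<lambda>R. (\<integral>\<^sup>+ y. ennreal ((x \<bullet> y) ^ (2 * k)) * indicator (cball 0 R) y \<partial>lborel)"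
  \<comment> \<open>\<open>enn2real\<close> sends infinity to 0, so finiteness is needed before
    \<open>moment_const\<close> can be converted back.\<close>
  have fin: "?I 1 < \<infinity>"
  proof -
    have "?I 1 \<le> (\<integral>\<^sup>+ (y::'a). ennreal (norm x ^ (2 * k)) * indicator (cball 0 1) y \<partial>lborel)"
    proof (rule nn_integral_mono)
      fix y :: 'a
      show "ennreal ((x \<bullet> y) ^ (2 * k)) * indicator (cball 0 1) y \<le> ennreal (norm x ^ (2 * k)) * indicator (cball 0 1) y"
      proof (cases "norm y \<le> 1")
        case True
        have "\<bar>x \<bullet> y\<bar> \<le> norm x * norm y" by (rule Cauchy_Schwarz_ineq2)
        also have "\<dots> \<le> norm x" using True by (simp add: mult_left_le)
        finally have "\<bar>x \<bullet> y\<bar> ^ (2 * k) \<le> norm x ^ (2 * k)" by (intro power_mono) auto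
        thus ?thesis by (simp add: indicator_def power_even_abs)
      qed simp
    qed
    also have "\<dots> = ennreal (norm x ^ (2 * k)) * emeasure lborel (cball (0::'a) 1)"
      by (subst nn_integral_cmult) auto
    also have "\<dots> < \<infinity>" using emeasure_lborel_cball_finite[of "0::'a" 1] by (simp add: ennreal_mult_less_top)
    finally show ?thesis .
  qed
  have c1: "?I 1 = ennreal (moment_const x k / (DIM('a) + 2 * k))"
    using fin add_pos_nonneg[of "real DIM('a)" "2 * real k"] by (auto simp: moment_const_def)
  show ?thesis
  proof (cases "R = 0")
    case True
    have "?I 0 = (\<integral>\<^sup>+ (y::'a). 0 \<partial>lborel)"
    proof (rule nn_integral_cong_AE)
      show "AE y in lborel. ennreal ((x \<bullet> y) ^ (2 * k)) * indicator (cball 0 0) y = 0"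
        using AE_lborel_singleton[of "0::'a"] by eventually_elim (simp add: indicator_def)
    qed
    thus ?thesis using True by (simp add: zero_power)
  next
    case False
    with R have R0: "0 < R" by simp
    have "?I R = ennreal (\<bar>R\<bar> ^ DIM('a)) * (\<integral>\<^sup>+ y. ennreal ((x \<bullet> (0 + R *\<^sub>R y)) ^ (2 * k)) * indicator (cball 0 R) (0 + R *\<^sub>R y) \<partial>lborel)"
      using R0 by (intro nn_integral_lborel_affine) auto
    also have "(\<lambda>y. ennreal ((x \<bullet> (0 + R *\<^sub>R y)) ^ (2 * k)) * indicator (cball 0 R) (0 + R *\<^sub>R y))
       = (\<lambda>y. ennreal (R ^ (2 * k)) * (ennreal ((x \<bullet> y) ^ (2 * k)) * indicator (cball 0 1) y))"
      using R0 by (auto simp: fun_eq_iff indicator_def power_mult_distrib ennreal_mult')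
    also have "(\<integral>\<^sup>+ y. ennreal (R ^ (2 * k)) * (ennreal ((x \<bullet> y) ^ (2 * k)) * indicator (cball 0 1) y) \<partial>lborel) = ennreal (R ^ (2 * k)) * ?I 1"
      by (rule nn_integral_cmult) measurable
    finally show ?thesis unfolding c1 using R0 moment_const_nonneg[of x k]
      by (simp add: ennreal_mult'[symmetric] power_add mult_ac)
  qed
qed

text \<open>Both measures are determined by their values on the half lines \<open>{..R}\<close>, and
  these are finite integrals over balls. A negative R gives 0 on both sides.\<close>

lemma radial_measure:
  fixes x :: "'a::euclidean_space"
  shows "distr (density lborel (\<lambda>y. ennreal ((x \<bullet> y) ^ (2 * k)))) borel norm
    = density lborel (\<lambda>t. ennreal (indicat_real {0..} t * (moment_const x k * t ^ (DIM('a) + 2 * k - 1))))"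
    (is "?M = ?N")
proof (rule measure_eqI_generator_eq[where E = "range atMost" and \<Omega> = UNIV and A = "\<lambda>n. {..real n}"])
  let ?n = "DIM('a) + 2 * k"
  have n: "0 < ?n" by simp
  have M: "emeasure ?M {..R} = (\<integral>\<^sup>+ y. ennreal ((x \<bullet> y) ^ (2 * k)) * indicator (cball 0 R) y \<partial>lborel)" for R
  proof -
    have "norm -` {..R} = (cball 0 R :: 'a set)" by auto
    thus ?thesis by (simp add: emeasure_distr emeasure_density)
  qed
  show "emeasure ?M (A :: real set) = emeasure ?N A" if A: "A \<in> range atMost" for A
  proof -
    from A obtain R where R: "A = {..R}" by auto
    show ?thesis
    proof (cases "0 \<le> R")
      case True
      have "emeasure ?N {..R} = (\<integral>\<^sup>+ t. ennreal (indicat_real {0..} t * (moment_const x k * t ^ (?n - 1))) * indicator {..R} t \<partial>lborel)"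
        by (simp add: emeasure_density)
      also have "\<dots> = (\<integral>\<^sup>+ t. ennreal (moment_const x k) * (ennreal (t ^ (?n - 1)) * indicator {0..R} t) \<partial>lborel)"
        by (intro nn_integral_cong) (use moment_const_nonneg[of x k] in \<open>auto simp: indicator_def ennreal_mult'\<close>)
      also have "\<dots> = ennreal (moment_const x k) * ennreal (R ^ ?n / ?n)"
        by (subst nn_integral_cmult) (auto simp: nn_integral_power_Icc[OF n True] simp del: One_nat_def)
      also have "\<dots> = emeasure ?M {..R}"
        unfolding M moment_cball[OF True] using moment_const_nonneg[of x k] by (simp add: ennreal_mult'[symmetric])
      finally show ?thesis by (simp add: R)
    next
      case False
      hence e: "indicator (cball 0 R) y = (0::ennreal)" for y :: 'a by (simp add: indicator_def order_trans[OF norm_ge_zero])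
      have "emeasure ?M {..R} = 0" unfolding M e by simp
      moreover have "emeasure ?N {..R} = (\<integral>\<^sup>+ t. ennreal (indicat_real {0..} t * (moment_const x k * t ^ (?n - 1))) * indicator {..R} t \<partial>lborel)"
        by (simp add: emeasure_density)
      moreover have "(\<lambda>t. ennreal (indicat_real {0..} t * (moment_const x k * t ^ (?n - 1))) * indicator {..R} t) = (\<lambda>t. 0)"
        using False by (auto simp: indicator_def)
      ultimately show ?thesis by (simp add: R)
    qed
  qed
  show "Int_stable (range atMost :: real set set)" by (auto simp: Int_stable_def)
  show "sets ?M = sigma_sets UNIV (range atMost)" "sets ?N = sigma_sets UNIV (range atMost)"
    by (simp_all add: borel_eq_atMost)
  show "(\<Union>i. {..real i}) = UNIV" using real_arch_simple by auto
  show "emeasure ?M {..real i} \<noteq> \<infinity>" for i unfolding M by (subst moment_cball) auto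
qed auto

lemma
  fixes x :: "'a::euclidean_space" and F :: "real \<Rightarrow> real"
  assumes [measurable]: "F \<in> borel_measurable borel"
  shows integrable_radial_moment: "integrable lborel (\<lambda>y. (x \<bullet> y) ^ (2 * k) * F (norm y)) \<longleftrightarrow>
      integrable lborel (\<lambda>t. indicat_real {0..} t * (moment_const x k * t ^ (DIM('a) + 2 * k - 1)) * F t)"
    and integral_radial_moment: "(LINT y|lborel. (x \<bullet> y) ^ (2 * k) * F (norm y)) =
      (LINT t|lborel. indicat_real {0..} t * (moment_const x k * t ^ (DIM('a) + 2 * k - 1)) * F t)"
proof -
  let ?D = "density lborel (\<lambda>y. ennreal ((x \<bullet> y) ^ (2 * k)))"
  have nn: "AE t in lborel. 0 \<le> indicat_real {0..} t * (moment_const x k * t ^ (DIM('a) + 2 * k - 1))"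
    using moment_const_nonneg[of x k] by (auto simp: indicator_def)
  have "integrable (distr ?D borel norm) F \<longleftrightarrow> integrable lborel (\<lambda>y. (x \<bullet> y) ^ (2 * k) * F (norm y))"
    by (subst integrable_distr_eq) (auto simp: integrable_real_density)
  thus "integrable lborel (\<lambda>y. (x \<bullet> y) ^ (2 * k) * F (norm y)) \<longleftrightarrow>
      integrable lborel (\<lambda>t. indicat_real {0..} t * (moment_const x k * t ^ (DIM('a) + 2 * k - 1)) * F t)"
    unfolding radial_measure using nn by (subst (asm) integrable_real_density) auto
  have "(LINT t|distr ?D borel norm. F t) = (LINT y|lborel. (x \<bullet> y) ^ (2 * k) * F (norm y))"
    by (subst integral_distr) (auto simp: integral_real_density)
  thus "(LINT y|lborel. (x \<bullet> y) ^ (2 * k) * F (norm y)) =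
      (LINT t|lborel. indicat_real {0..} t * (moment_const x k * t ^ (DIM('a) + 2 * k - 1)) * F t)"
    unfolding radial_measure using nn by (subst (asm) integral_real_density) auto
qed

lemma moment_const_0:
  fixes x :: "'a::euclidean_space"
  shows "moment_const x 0 = 2 * pi powr (DIM('a) / 2) / Gamma (DIM('a) / 2)"
proof -
  have "(\<integral>\<^sup>+ (y::'a). indicator (cball 0 1) y \<partial>lborel) = ennreal (unit_ball_vol DIM('a))"
    by (simp add: emeasure_cball)
  hence "moment_const x 0 = DIM('a) * unit_ball_vol DIM('a)"
    by (simp add: moment_const_def)
  also have "\<dots> = 2 * pi powr (DIM('a) / 2) / Gamma (DIM('a) / 2)"
  proof -
    have "Gamma (DIM('a) / 2 + 1) = DIM('a) / 2 * Gamma (DIM('a) / 2 :: real)"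
      by (rule Gamma_plus1) (use nonpos_Ints_nonpos[of "DIM('a) / 2 :: real"] in auto)
    moreover have "Gamma (DIM('a) / 2 :: real) > 0" by (intro Gamma_real_pos) simp
    ultimately show ?thesis unfolding unit_ball_vol_def by (simp only:) (simp add: divide_simps)
  qed
  finally show ?thesis .
qed

section \<open>Gaussian moments and the value of \<open>moment_const\<close>\<close>

lemma has_bochner_integral_Gauss_power:
  assumes n: "0 < (n::nat)"
  shows "has_bochner_integral lborel (\<lambda>t. indicat_real {0..} t * (t ^ (n - 1) * exp (- t\<^sup>2 / 2)))
     (2 powr (n / 2 - 1) * Gamma (n / 2))"
proof -
  define f where "f = (\<lambda>t::real. t ^ (n - 1) * exp (- t\<^sup>2 / 2))"
  define g where "g = (\<lambda>u::real. sqrt (2 * u))"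
  define g' where "g' = (\<lambda>u::real. 1 / sqrt (2 * u))"
  define h where "h = (\<lambda>u::real. 2 powr (n / 2 - 1) * (u powr (n / 2 - 1) * exp (- (1 * u))))"
  have fg: "f (g u) * g' u = h u" if "0 < u" for u
  proof -
    have "sqrt (2 * u) ^ (n - 1) = sqrt (2 * u) powr real (n - 1)"
      using that by (subst powr_realpow) auto
    also have "\<dots> = (2 * u) powr ((real n - 1) / 2)"
      using that n by (simp add: powr_half_sqrt[symmetric] powr_powr of_nat_diff)
    also have "\<dots> / sqrt (2 * u) = (2 * u) powr ((real n - 1) / 2 - 1 / 2)"
      using that by (simp add: powr_half_sqrt[symmetric] powr_diff)
    also have "(real n - 1) / 2 - 1 / 2 = n / 2 - 1" by (simp add: field_simps)
    finally have "sqrt (2 * u) ^ (n - 1) / sqrt (2 * u) = 2 powr (n / 2 - 1) * u powr (n / 2 - 1)"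
      using that by (simp add: powr_mult)
    moreover have "f (g u) * g' u = sqrt (2 * u) ^ (n - 1) / sqrt (2 * u) * exp (- u)"
      using that by (simp add: f_def g_def g'_def)
    ultimately show ?thesis by (simp add: h_def)
  qed
  have hG: "has_bochner_integral lborel (\<lambda>u. indicat_real {0..} u * h u) (2 powr (n / 2 - 1) * (Gamma (n / 2) / 1 powr (n / 2)))"
    using has_bochner_integral_mult_right[OF has_bochner_integral_Gamma[of "n / 2" 1], of "2 powr (n / 2 - 1)"] n
    unfolding h_def by (simp add: mult_ac)
  have hset: "set_integrable lborel {0..} h" "(LINT u:{0..}|lborel. h u) = 2 powr (n / 2 - 1) * Gamma (n / 2)"
    using hG unfolding set_integrable_def set_lebesgue_integral_def has_bochner_integral_iff by auto
  have ee: "einterval 0 \<infinity> = {0::real<..}" by (auto simp add: einterval_def zero_ereal_def)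
  have xx: "0 < x" if "0 < ereal x" for x :: real using that by auto
  have p1: "DERIV g x :> g' x" if "0 < ereal x" "ereal x < \<infinity>" for x
    unfolding g_def g'_def using xx[OF that(1)]
    by (auto intro!: derivative_eq_intros simp: field_simps)
  have p2: "isCont f (g x)" if "0 < ereal x" "ereal x < \<infinity>" for x
    unfolding f_def by (intro continuous_intros) auto
  have p3: "isCont g' x" if "0 < ereal x" "ereal x < \<infinity>" for x
    unfolding g'_def using xx[OF that(1)] by (intro continuous_intros) auto
  have p4: "0 \<le> f (g x)" if "0 < ereal x" "ereal x < \<infinity>" for x using xx[OF that(1)] by (simp add: f_def g_def)
  have p5: "0 \<le> g' x" if "0 \<le> ereal x" "ereal x \<le> \<infinity>" for x
    using that by (simp add: g'_def)
  have p6: "((ereal \<circ> g \<circ> real_of_ereal) \<longlongrightarrow> 0) (at_right 0)"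
  proof -
    have "((\<lambda>x. ereal (g x)) \<longlongrightarrow> ereal (g 0)) (at_right 0)"
      unfolding g_def by (intro tendsto_intros)
    thus ?thesis by (simp add: zero_ereal_def at_right_ereal filterlim_filtermap o_def g_def)
  qed
  have p7: "((ereal \<circ> g \<circ> real_of_ereal) \<longlongrightarrow> \<infinity>) (at_left \<infinity>)"
  proof -
    have "filterlim g at_top at_top" unfolding g_def
      by (intro filterlim_compose[OF sqrt_at_top] filterlim_tendsto_pos_mult_at_top[OF tendsto_const]) (auto simp: filterlim_ident)
    thus ?thesis by (simp add: at_left_PInf filterlim_filtermap o_def tendsto_PInfty_eq_at_top)
  qed
  have p8: "set_integrable lborel (einterval 0 \<infinity>) (\<lambda>x. f (g x) * g' x)"
  proof -
    have "set_integrable lborel {0<..} h"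
      by (rule set_integrable_subset[OF hset(1)]) auto
    hence "set_integrable lborel {0<..} (\<lambda>x. f (g x) * g' x)"
      by (rule set_integrable_cong[THEN iffD1, rotated -1]) (auto simp: fg)
    thus ?thesis by (simp add: ee)
  qed
  have "(0::ereal) < \<infinity>" by simp
  note sub = interval_integral_substitution_nonneg[OF this p1 p2 p3 p4 p5 p6 p7 p8]
  have L1: "(LBINT x=0..\<infinity>. (f (g x) * g' x)) = (LINT u:{0<..}|lborel. h u)"
    unfolding interval_lebesgue_integral_def ee using fg
    by (auto intro!: set_lebesgue_integral_cong)
  have null: "AE x in lborel. x \<noteq> (0::real)" by (rule AE_lborel_singleton)
  have L2: "(LINT u:{0<..}|lborel. h u) = (LINT u:{0..}|lborel. h u)"
    unfolding set_lebesgue_integral_def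
  proof (rule integral_cong_AE)
    show "AE x in lborel. indicat_real {0<..} x *\<^sub>R h x = indicat_real {0..} x *\<^sub>R h x"
      using null by eventually_elim (simp add: indicator_def)
  qed (simp_all add: h_def)
  have hb: "has_bochner_integral lborel (\<lambda>t. indicat_real {0<..} t * f t) (2 powr (n / 2 - 1) * Gamma (n / 2))"
    using sub L1 L2 hset(2) unfolding interval_lebesgue_integral_def ee
    by (simp add: has_bochner_integral_iff set_integrable_def set_lebesgue_integral_def)
  have ae: "AE t in lborel. indicat_real {0<..} t * f t = indicat_real {0..} t * f t"
    using null by eventually_elim (simp add: indicator_def)
  have [measurable]: "f \<in> borel_measurable borel" unfolding f_def by simp
  have "has_bochner_integral lborel (\<lambda>t. indicat_real {0..} t * f t) (2 powr (n / 2 - 1) * Gamma (n / 2))"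
    by (rule has_bochner_integral_cong_AE[THEN iffD1, OF _ _ ae hb]) simp_all
  thus ?thesis unfolding f_def .
qed

text \<open>The moment of order 2k of x . y under exp(-|y|^2/2), written in the form that radial
  integration gives. Knowing it in closed form amounts to knowing
  \<open>moment_const\<close>.\<close>

definition Gauss_moment :: "'a::euclidean_space \<Rightarrow> nat \<Rightarrow> real" where
  "Gauss_moment x k = moment_const x k * (2 powr ((DIM('a) + 2 * k) / 2 - 1) * Gamma ((DIM('a) + 2 * k) / 2))"

lemma has_bochner_integral_Gauss_moment:
  fixes x :: "'a::euclidean_space"
  shows "has_bochner_integral lborel (\<lambda>y. (x \<bullet> y) ^ (2 * k) * exp (- (norm y)\<^sup>2 / 2)) (Gauss_moment x k)"
proof -
  let ?n = "DIM('a) + 2 * k"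
  have n: "0 < ?n" by simp
  have "has_bochner_integral lborel (\<lambda>t. moment_const x k * (indicat_real {0..} t * (t ^ (?n - 1) * exp (- t\<^sup>2 / 2))))
      (moment_const x k * (2 powr (?n / 2 - 1) * Gamma (?n / 2)))"
    by (intro has_bochner_integral_mult_right has_bochner_integral_Gauss_power n)
  moreover have "(\<lambda>t. moment_const x k * (indicat_real {0..} t * (t ^ (?n - 1) * exp (- t\<^sup>2 / 2))))
     = (\<lambda>t. indicat_real {0..} t * (moment_const x k * t ^ (?n - 1)) * exp (- t\<^sup>2 / 2))" by (simp add: mult_ac)
  ultimately have A: "has_bochner_integral lborel (\<lambda>t. indicat_real {0..} t * (moment_const x k * t ^ (?n - 1)) * exp (- t\<^sup>2 / 2))
      (moment_const x k * (2 powr (?n / 2 - 1) * Gamma (?n / 2)))" by (simp only:)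
  have m: "(\<lambda>t::real. exp (- t\<^sup>2 / 2)) \<in> borel_measurable borel" by simp
  show ?thesis
    unfolding has_bochner_integral_iff Gauss_moment_def
      integrable_radial_moment[where F = "\<lambda>t. exp (- t\<^sup>2 / 2)", OF m]
      integral_radial_moment[where F = "\<lambda>t. exp (- t\<^sup>2 / 2)", OF m]
    using A unfolding has_bochner_integral_iff .
qed

lemma Gauss_moment_nonneg: "0 \<le> Gauss_moment x k"
proof -
  have "(0::real) < (DIM('a) + 2 * k) / 2" by (simp add: add_pos_nonneg)
  thus ?thesis unfolding Gauss_moment_def using moment_const_nonneg[of x k] Gamma_real_pos
    by (intro mult_nonneg_nonneg) (auto intro: less_imp_le)
qed

lemma Gauss_moment_0:
  fixes x :: "'a::euclidean_space"
  shows "Gauss_moment x 0 = (2 * pi) powr (DIM('a) / 2)"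
proof -
  have "Gamma (DIM('a) / 2 :: real) \<noteq> 0" using Gamma_real_pos[of "DIM('a) / 2"] by force
  thus ?thesis by (simp add: Gauss_moment_def moment_const_0 powr_diff powr_mult)
qed

lemma cosh_sums: "(\<lambda>k. x ^ (2 * k) / fact (2 * k)) sums cosh (x :: real)"
proof -
  have "(\<lambda>n. if even n then x ^ n /\<^sub>R fact n else 0) sums cosh x" by (rule cosh_converges)
  moreover have "strict_mono (\<lambda>k::nat. 2 * k)" by (auto simp: strict_mono_def)
  ultimately have "(\<lambda>k. (if even (2 * k) then x ^ (2 * k) /\<^sub>R fact (2 * k) else 0)) sums cosh x"
    by (subst sums_mono_reindex) (auto elim!: oddE evenE)
  thus ?thesis by (simp add: divide_inverse mult.commute)
qed

text \<open>Completing the square: the translation by x changes the exponent into |x|^2/2 -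
  |y|^2/2.\<close>

lemma nn_integral_exp_Gauss:
  fixes x :: "'a::euclidean_space"
  shows "(\<integral>\<^sup>+ y. ennreal (exp (x \<bullet> y - (norm y)\<^sup>2 / 2)) \<partial>lborel) = ennreal (exp ((norm x)\<^sup>2 / 2) * Gauss_moment (0::'a) 0)"
proof -
  have G: "(\<integral>\<^sup>+ (y::'a). ennreal (exp (- (norm y)\<^sup>2 / 2)) \<partial>lborel) = ennreal (Gauss_moment (0::'a) 0)"
    using has_bochner_integral_Gauss_moment[of "0::'a" 0]
      nn_integral_eq_integral[of lborel "\<lambda>y::'a. exp (- (norm y)\<^sup>2 / 2)"] by (simp add: has_bochner_integral_iff)
  have "(\<integral>\<^sup>+ y. ennreal (exp (x \<bullet> y - (norm y)\<^sup>2 / 2)) \<partial>lborel)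
     = (\<integral>\<^sup>+ y. ennreal (exp (x \<bullet> (x + 1 *\<^sub>R y) - (norm (x + 1 *\<^sub>R y))\<^sup>2 / 2)) \<partial>lborel)"
    by (subst nn_integral_lborel_affine[of _ 1 x]) auto
  also have "\<dots> = (\<integral>\<^sup>+ (y::'a). ennreal (exp ((norm x)\<^sup>2 / 2)) * ennreal (exp (- (norm y)\<^sup>2 / 2)) \<partial>lborel)"
  proof (intro nn_integral_cong)
    fix y :: 'a
    have "x \<bullet> (x + 1 *\<^sub>R y) - (norm (x + 1 *\<^sub>R y))\<^sup>2 / 2 = (norm x)\<^sup>2 / 2 + - (norm y)\<^sup>2 / 2"
      by (simp add: power2_norm_eq_inner inner_add_left inner_add_right inner_commute field_simps)
    thus "ennreal (exp (x \<bullet> (x + 1 *\<^sub>R y) - (norm (x + 1 *\<^sub>R y))\<^sup>2 / 2))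
      = ennreal (exp ((norm x)\<^sup>2 / 2)) * ennreal (exp (- (norm y)\<^sup>2 / 2))"
      by (simp only: exp_add) (simp add: ennreal_mult')
  qed
  also have "\<dots> = ennreal (exp ((norm x)\<^sup>2 / 2)) * ennreal (Gauss_moment (0::'a) 0)"
    by (subst nn_integral_cmult) (simp_all only: G, measurable)
  finally show ?thesis by (simp add: ennreal_mult')
qed

text \<open>Both sides are the integral of cosh(x . y) exp(-|y|^2/2), once termwise and once by
  completing the square. With cosh all terms are nonnegative, so the exchange needs no
  domination.\<close>

lemma Gauss_moment_sums:
  fixes x :: "'a::euclidean_space"
  shows "(\<lambda>k. Gauss_moment x k / fact (2 * k)) sums (exp ((norm x)\<^sup>2 / 2) * Gauss_moment (0::'a) 0)"
proof -
  let ?G = "\<lambda>y::'a. exp (- (norm y)\<^sup>2 / 2)"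
  let ?C = "exp ((norm x)\<^sup>2 / 2) * Gauss_moment (0::'a) 0"
  have C: "0 \<le> ?C" by (intro mult_nonneg_nonneg Gauss_moment_nonneg) simp
  have t: "(\<integral>\<^sup>+ y. ennreal ((x \<bullet> y) ^ (2 * k) / fact (2 * k) * ?G y) \<partial>lborel) = ennreal (Gauss_moment x k / fact (2 * k))" for k
    using has_bochner_integral_mult_right[OF has_bochner_integral_Gauss_moment[of x k], of "1 / fact (2 * k)"]
      nn_integral_eq_integral[of lborel "\<lambda>y. (x \<bullet> y) ^ (2 * k) / fact (2 * k) * ?G y"]
    by (simp add: has_bochner_integral_iff)
  have e: "ennreal (cosh (x \<bullet> y) * ?G y) = (\<Sum>k. ennreal ((x \<bullet> y) ^ (2 * k) / fact (2 * k) * ?G y))" for y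
    by (rule suminf_ennreal_eq[OF _ sums_mult2[OF cosh_sums], symmetric]) (simp add: zero_le_even_power)
  have "(\<integral>\<^sup>+ y. ennreal (cosh (x \<bullet> y) * ?G y) \<partial>lborel) = (\<Sum>k. ennreal (Gauss_moment x k / fact (2 * k)))"
    unfolding e by (subst nn_integral_suminf, measurable) (simp only: t)
  moreover have "(\<integral>\<^sup>+ y. ennreal (cosh (x \<bullet> y) * ?G y) \<partial>lborel) = ennreal ?C"
  proof -
    have "ennreal (cosh (x \<bullet> y) * ?G y) = ennreal (1 / 2) * (ennreal (exp (x \<bullet> y - (norm y)\<^sup>2 / 2)) + ennreal (exp ((- x) \<bullet> y - (norm y)\<^sup>2 / 2)))" for y
    proof -
      have "exp (x \<bullet> y - (norm y)\<^sup>2 / 2) = exp (x \<bullet> y) * ?G y" "exp ((- x) \<bullet> y - (norm y)\<^sup>2 / 2) = exp (- (x \<bullet> y)) * ?G y"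
        by (simp_all add: exp_add[symmetric])
      thus ?thesis by (subst ennreal_plus[symmetric], simp, simp, subst ennreal_mult'[symmetric])
         (simp_all add: cosh_def algebra_simps)
    qed
    hence "(\<integral>\<^sup>+ y. ennreal (cosh (x \<bullet> y) * ?G y) \<partial>lborel) = ennreal (1 / 2) * (ennreal ?C + ennreal ?C)"
      using nn_integral_exp_Gauss[of x] nn_integral_exp_Gauss[of "- x"]
      by (simp only:) (subst nn_integral_cmult, simp, subst nn_integral_add, simp, simp, simp)
    also have "\<dots> = ennreal (1 / 2 * (?C + ?C))"
      by (subst ennreal_plus[OF C C, symmetric], subst ennreal_mult'[symmetric]) simp_all
    finally show ?thesis by (simp add: mult.commute)
  qed
  ultimately have "(\<Sum>k. ennreal (Gauss_moment x k / fact (2 * k))) = ennreal ?C" by simp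
  moreover have "(\<lambda>k. ennreal (Gauss_moment x k / fact (2 * k))) sums (\<Sum>k. ennreal (Gauss_moment x k / fact (2 * k)))"
    by (intro summable_sums summableI)
  ultimately have "(\<lambda>k. ennreal (Gauss_moment x k / fact (2 * k))) sums ennreal ?C" by simp
  thus ?thesis using C Gauss_moment_nonneg[of x] by (subst (asm) sums_ennreal) auto
qed

lemma Gauss_moment_scale:
  "Gauss_moment (s *\<^sub>R x) k = s ^ (2 * k) * Gauss_moment x k"
proof -
  have "has_bochner_integral lborel (\<lambda>y. s ^ (2 * k) * ((x \<bullet> y) ^ (2 * k) * exp (- (norm y)\<^sup>2 / 2))) (s ^ (2 * k) * Gauss_moment x k)"
    by (intro has_bochner_integral_mult_right has_bochner_integral_Gauss_moment)
  moreover have "s ^ (2 * k) * ((x \<bullet> y) ^ (2 * k) * exp (- (norm y)\<^sup>2 / 2)) = ((s *\<^sub>R x) \<bullet> y) ^ (2 * k) * exp (- (norm y)\<^sup>2 / 2)" for y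
    by (simp add: power_mult_distrib)
  ultimately have A: "has_bochner_integral lborel (\<lambda>y. ((s *\<^sub>R x) \<bullet> y) ^ (2 * k) * exp (- (norm y)\<^sup>2 / 2)) (s ^ (2 * k) * Gauss_moment x k)"
    by (simp only:)
  show ?thesis by (rule has_bochner_integral_eq[OF has_bochner_integral_Gauss_moment A])
qed

text \<open>Vanishing on the nonnegative half line is enough because the zeros of a nonzero power
  series are isolated.\<close>

lemma power_series_eq_0:
  fixes c :: "nat \<Rightarrow> real"
  assumes "\<And>v. (\<lambda>k. c k * v ^ k) sums f v" "\<And>v. 0 \<le> v \<Longrightarrow> f v = 0"
  shows "c k = 0"
proof -
  have "f 0 = 0" using assms(2) by simp
  moreover have "(\<lambda>k. c k * 0 ^ k) sums c 0" using powser_sums_zero[of c] by simp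
  ultimately have c0: "c 0 = 0" using assms(1)[of 0] sums_unique2 by metis
  show ?thesis
  proof (rule ccontr)
    assume k: "c k \<noteq> 0"
    with c0 have "0 < k" by (cases k) auto
    obtain s where s: "0 < s" "\<And>z. z \<in> cball 0 s - {0} \<Longrightarrow> f z \<noteq> 0"
      by (rule powser_0_nonzero[of 1 0 c f k]) (use assms k \<open>0 < k\<close> in auto)
    thus False using assms(2)[of s] s(2)[of s] by auto
  qed
qed

text \<open>By homogeneity, replacing x by \<open>sqrt v *\<^sub>R x\<close> turns the generating
  identity into a power series in v, and its coefficients are compared with those of the exponential
  series.\<close>

lemma Gauss_moment_eq:
  fixes x :: "'a::euclidean_space"
  shows "Gauss_moment x k = (2 * pi) powr (DIM('a) / 2) * (norm x) ^ (2 * k) * fact (2 * k) / (2 ^ k * fact k)"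
proof -
  let ?I = "(2 * pi) powr (DIM('a) / 2)"
  let ?c = "\<lambda>k. Gauss_moment x k / fact (2 * k) - ?I * (((norm x)\<^sup>2 / 2) ^ k / fact k)"
  have 1: "(\<lambda>k. Gauss_moment x k / fact (2 * k) * v ^ k) sums (exp ((norm x)\<^sup>2 / 2 * v) * ?I)" if "0 \<le> v" for v
  proof -
    have "sqrt v ^ (2 * k) = v ^ k" for k using that by (simp add: power_mult)
    thus ?thesis using Gauss_moment_sums[of "sqrt v *\<^sub>R x"] that
      by (simp add: Gauss_moment_scale Gauss_moment_0 power_mult_distrib mult_ac)
  qed
  have 2: "(\<lambda>k. ?I * (((norm x)\<^sup>2 / 2) ^ k / fact k) * v ^ k) sums (?I * exp ((norm x)\<^sup>2 / 2 * v))" for v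
  proof -
    have "(\<lambda>k. I * (a ^ k / fact k) * v ^ k) sums (I * exp (a * v))" for I a :: real
    proof -
      have "I * ((a * v) ^ k /\<^sub>R fact k) = I * (a ^ k / fact k) * v ^ k" for k
        by (simp add: power_mult_distrib divide_inverse)
      thus ?thesis using sums_mult[OF exp_converges[of "a * v"], of I] by simp
    qed
    thus ?thesis .
  qed
  \<comment> \<open>The series must converge for negative v as well, where sqrt v no longer gives a
    generating identity; absolute convergence at |v| supplies this.\<close>
  have sm: "summable (\<lambda>k. ?c k * v ^ k)" for v
  proof -
    have "summable (\<lambda>k. Gauss_moment x k / fact (2 * k) * \<bar>v\<bar> ^ k)" using 1[of "\<bar>v\<bar>"] by (auto simp: sums_iff)
    hence "summable (\<lambda>k. norm (Gauss_moment x k / fact (2 * k) * v ^ k))"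
      using Gauss_moment_nonneg[of x] by (simp add: abs_mult power_abs)
    hence "summable (\<lambda>k. Gauss_moment x k / fact (2 * k) * v ^ k)" by (rule summable_norm_cancel)
    from summable_diff[OF this] 2[of v] show ?thesis by (simp add: left_diff_distrib sums_iff)
  qed
  have "?c k = 0"
  proof (rule power_series_eq_0[of ?c "\<lambda>v. \<Sum>k. ?c k * v ^ k"])
    show "(\<lambda>k. ?c k * v ^ k) sums (\<Sum>k. ?c k * v ^ k)" for v by (rule summable_sums[OF sm])
    fix v :: real assume v: "0 \<le> v"
    have z: "exp ((norm x)\<^sup>2 / 2 * v) * ?I - ?I * exp ((norm x)\<^sup>2 / 2 * v) = 0" by simp
    have "(\<lambda>k. ?c k * v ^ k) sums 0"
      unfolding left_diff_distrib using sums_diff[OF 1[OF v] 2[of v]] unfolding z .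
    thus "(\<Sum>k. ?c k * v ^ k) = 0" by (simp add: sums_iff)
  qed
  thus ?thesis unfolding power_mult[of "norm x"] by (simp add: field_simps power_divide)
qed

text \<open>The left side is the k-th term of the cosine integrated over the unit sphere. The
  identity therefore says that the mean of cos(x . y) over the sphere is \<open>Omega\<close> of
  index (d - 2)/2 at |x|.\<close>

lemma moment_const_eq:
  fixes x :: "'a::euclidean_space"
  shows "(- 1) ^ k / fact (2 * k) * moment_const x k
    = 2 * pi powr (DIM('a) / 2) / Gamma (DIM('a) / 2) * (Omega_coeff ((real DIM('a) - 2) / 2) k * norm x ^ (2 * k))"
proof -
  let ?h = "real DIM('a) / 2"
  have h: "0 < ?h" by simp
  have G: "0 < Gamma ?h" "0 < Gamma (?h + k)" using h by (auto intro!: Gamma_real_pos add_pos_nonneg)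
  have n: "?h \<notin> \<int>\<^sub>\<le>\<^sub>0" using h nonpos_Ints_nonpos[of ?h] by linarith
  have e: "(DIM('a) + 2 * k) / 2 = ?h + k" by (simp add: field_simps)
  have p: "pochhammer ?h k = Gamma (?h + k) / Gamma ?h" by (rule pochhammer_Gamma[OF n])
  have "moment_const x k * (2 powr (?h + k - 1) * Gamma (?h + k)) = (2 * pi) powr ?h * norm x ^ (2 * k) * fact (2 * k) / (2 ^ k * fact k)"
    using Gauss_moment_eq[of x k] unfolding Gauss_moment_def e .
  moreover have "2 powr (?h + k - 1) = 2 powr ?h * 2 ^ k / 2"
    by (simp add: powr_add powr_diff powr_realpow)
  moreover have "(2 * pi) powr ?h = 2 powr ?h * pi powr ?h" by (simp add: powr_mult)
  ultimately have "moment_const x k * (2 powr ?h * 2 ^ k / 2 * Gamma (?h + k)) = 2 powr ?h * pi powr ?h * norm x ^ (2 * k) * fact (2 * k) / (2 ^ k * fact k)"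
    by (simp only:)
  note calc = this
  have m: "moment_const x k = 2 * pi powr ?h * norm x ^ (2 * k) * fact (2 * k) / (4 ^ k * fact k * Gamma (?h + k))"
  proof -
    have alg: "m = 2 * P * N * F / (u * u * g * B)"
      if "m * (t * u / 2 * B) = t * P * N * F / (u * g)" "t \<noteq> 0" "u \<noteq> 0" "B \<noteq> 0" "g \<noteq> 0" for m t u B P N F g :: real
      using that by (simp add: divide_simps mult_ac)
    have "(4::real) ^ k = 2 ^ k * 2 ^ k" by (simp add: power_mult_distrib[symmetric])
    moreover have "Gamma (?h + k) \<noteq> 0" using G by linarith
    ultimately show ?thesis using alg[OF calc] by simp
  qed
  have nu: "(real DIM('a) - 2) / 2 + 1 = ?h" by (simp add: field_simps)
  have alg: "a / f * (2 * P * N * f / (q * g * B)) = 2 * P / A * (a / (q * g * (B / A)) * N)"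
    if "f \<noteq> 0" "A \<noteq> 0" for a f P N q g A B :: real
  proof -
    have "a / f * (2 * P * N * f / (q * g * B)) = 2 * P * N * a / (q * g * B)"
      using that by simp
    also have "\<dots> = 2 * P / A * (a / (q * g * (B / A)) * N)"
      using that by (simp only: divide_divide_eq_right times_divide_eq_right times_divide_eq_left divide_divide_eq_left) (simp add: mult_ac)
    finally show ?thesis .
  qed
  have G': "Gamma ?h \<noteq> 0" using G(1) by linarith
  show ?thesis unfolding Omega_coeff_def nu p m
    by (rule alg[OF fact_nonzero G'])
qed

subsection \<open>Radial Fourier transforms\<close>

definition sphere_area :: "'a::euclidean_space itself \<Rightarrow> real" where
  "sphere_area _ = 2 * pi powr (DIM('a) / 2) / Gamma (DIM('a) / 2)"

lemma sphere_area_pos: "0 < sphere_area TYPE('a::euclidean_space)"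
proof -
  have "0 < Gamma (real DIM('a) / 2)" by (intro Gamma_real_pos) simp
  thus ?thesis by (simp add: sphere_area_def)
qed

lemma
  fixes F :: "real \<Rightarrow> real"
  assumes F [measurable]: "F \<in> borel_measurable borel"
  shows integrable_radial_iff: "integrable lborel (\<lambda>y::'a::euclidean_space. F (norm y)) \<longleftrightarrow>
      integrable lborel (\<lambda>t. indicat_real {0..} t * (F t * t ^ (DIM('a) - 1)))"
    and integral_radial: "(LINT y|lborel. F (norm (y::'a))) =
      sphere_area TYPE('a) * (LINT t|lborel. indicat_real {0..} t * (F t * t ^ (DIM('a) - 1)))"
proof -
  let ?s = "sphere_area TYPE('a)"
  have e: "(\<lambda>t. indicat_real {0..} t * (moment_const (0::'a) 0 * t ^ (DIM('a) + 2 * 0 - 1)) * F t)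
     = (\<lambda>t. ?s * (indicat_real {0..} t * (F t * t ^ (DIM('a) - 1))))"
    by (simp add: moment_const_0 sphere_area_def fun_eq_iff)
  show "integrable lborel (\<lambda>y::'a. F (norm y)) \<longleftrightarrow> integrable lborel (\<lambda>t. indicat_real {0..} t * (F t * t ^ (DIM('a) - 1)))"
    using integrable_radial_moment[OF F, of "0::'a" 0] sphere_area_pos[where 'a = 'a] unfolding e by simp
  show "(LINT y|lborel. F (norm (y::'a))) = ?s * (LINT t|lborel. indicat_real {0..} t * (F t * t ^ (DIM('a) - 1)))"
    using integral_radial_moment[OF F, of "0::'a" 0] unfolding e by simp
qed

lemma cos_eq_even_series: "cos t = even_series (Omega_coeff (- 1 / 2)) t"
  using Omega_eq_even_series[of "- 1 / 2" t] Omega_minus_half[of t] by simp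

lemma borel_measurable_Omega: "- 1 / 2 \<le> \<nu> \<Longrightarrow> Omega \<nu> \<in> borel_measurable borel"
  by (intro borel_measurable_continuous_onI continuous_at_imp_continuous_on ballI isCont_Omega)

abbreviation "DOmega (T :: 'a::euclidean_space itself) \<equiv> Omega ((real DIM('a) - 2) / 2)"

lemma DIM_index: "- 1 / 2 \<le> (real DIM('a::euclidean_space) - 2) / 2"
proof -
  have "1 \<le> real DIM('a)" using DIM_positive[where 'a = 'a] by linarith
  thus ?thesis by simp
qed

text \<open>Bounded support allows the cosine to be expanded under the integral. Removing this
  restriction needs a bound on \<open>DOmega\<close>, which is itself drawn from the present case;
  hence the two stages.\<close>

lemma
  fixes F :: "real \<Rightarrow> real" and x :: "'a::euclidean_space"
  assumes F [measurable]: "F \<in> borel_measurable borel"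
    and int: "integrable lborel (\<lambda>t. indicat_real {0..} t * (F t * t ^ (DIM('a) - 1)))"
    and B: "\<And>t. B < t \<Longrightarrow> F t = 0"
  shows integral_cos_radial_bounded: "(LINT y|lborel. cos (x \<bullet> y) * F (norm y)) =
      sphere_area TYPE('a) * (LINT t|lborel. indicat_real {0..} t * (DOmega TYPE('a) (norm x * t) * F t * t ^ (DIM('a) - 1)))"
    (is "?L = ?R")
proof -
  let ?s = "sphere_area TYPE('a)" and ?nu = "(real DIM('a) - 2) / 2"
  have int': "integrable lborel (\<lambda>y::'a. F (norm y))" using int by (simp add: integrable_radial_iff)
  have "(\<lambda>k. Omega_coeff (- 1 / 2) k * (LINT y|lborel. (x \<bullet> y) ^ (2 * k) * F (norm y))) sums (LINT y|lborel. even_series (Omega_coeff (- 1 / 2)) (x \<bullet> y) * F (norm y))"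
  proof (rule integral_even_series_sums[OF abs_Omega_coeff_le int'])
    show "\<bar>x \<bullet> y\<bar> \<le> norm x * B" if "F (norm y) \<noteq> 0" for y :: 'a
    proof -
      have "norm y \<le> B" using B[of "norm y"] that by force
      hence "norm x * norm y \<le> norm x * B" by (intro mult_left_mono) auto
      thus ?thesis using Cauchy_Schwarz_ineq2[of x y] by linarith
    qed
  qed auto
  moreover have "Omega_coeff (- 1 / 2) k * (LINT y|lborel. (x \<bullet> y) ^ (2 * k) * F (norm y))
     = ?s * (Omega_coeff ?nu k * (LINT t|lborel. (norm x * t) ^ (2 * k) * (indicat_real {0..} t * (F t * t ^ (DIM('a) - 1)))))" for k
  proof -
    let ?J = "(LINT t|lborel. indicat_real {0..} t * t ^ (DIM('a) + 2 * k - 1) * F t)"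
    have o: "Omega_coeff (- 1 / 2) k = (- 1) ^ k / fact (2 * k)"
      by (simp add: Omega_coeff_def fact_double power_mult)
    have "(LINT y|lborel. (x \<bullet> y) ^ (2 * k) * F (norm y)) = (LINT t|lborel. moment_const x k * (indicat_real {0..} t * t ^ (DIM('a) + 2 * k - 1) * F t))"
      unfolding integral_radial_moment[OF F] by (intro Bochner_Integration.integral_cong) auto
    hence 1: "(LINT y|lborel. (x \<bullet> y) ^ (2 * k) * F (norm y)) = moment_const x k * ?J" by simp
    have "(norm x * t) ^ (2 * k) * (indicat_real {0..} t * (F t * t ^ (DIM('a) - 1)))
       = norm x ^ (2 * k) * (indicat_real {0..} t * t ^ (DIM('a) + 2 * k - 1) * F t)" for t
    proof -
      have "DIM('a) + 2 * k - 1 = 2 * k + (DIM('a) - 1)" using DIM_positive[where 'a = 'a] by linarith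
      hence "t ^ (DIM('a) + 2 * k - 1) = t ^ (2 * k) * t ^ (DIM('a) - 1)" by (simp only: power_add)
      thus ?thesis by (simp add: power_mult_distrib)
    qed
    hence 2: "(LINT t|lborel. (norm x * t) ^ (2 * k) * (indicat_real {0..} t * (F t * t ^ (DIM('a) - 1)))) = norm x ^ (2 * k) * ?J"
      by (simp only: integral_mult_right_zero)
    have "Omega_coeff (- 1 / 2) k * (moment_const x k * ?J) = (- 1) ^ k / fact (2 * k) * moment_const x k * ?J"
      by (simp only: o mult.assoc)
    also have "\<dots> = ?s * (Omega_coeff ?nu k * norm x ^ (2 * k)) * ?J" unfolding moment_const_eq sphere_area_def ..
    finally show ?thesis unfolding 1 2 by simp
  qed
  ultimately have "(\<lambda>k. ?s * (Omega_coeff ?nu k * (LINT t|lborel. (norm x * t) ^ (2 * k) * (indicat_real {0..} t * (F t * t ^ (DIM('a) - 1)))))) sums ?L"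
    by (simp add: cos_eq_even_series)
  moreover have "(\<lambda>k. ?s * (Omega_coeff ?nu k * (LINT t|lborel. (norm x * t) ^ (2 * k) * (indicat_real {0..} t * (F t * t ^ (DIM('a) - 1))))))
     sums (?s * (LINT t|lborel. even_series (Omega_coeff ?nu) (norm x * t) * (indicat_real {0..} t * (F t * t ^ (DIM('a) - 1)))))"
  proof (intro sums_mult integral_even_series_sums[OF abs_Omega_coeff_le int])
    show "\<bar>norm x * t\<bar> \<le> norm x * B" if "indicat_real {0..} t * (F t * t ^ (DIM('a) - 1)) \<noteq> 0" for t
      using B[of t] that by (cases "B < t") (auto simp: indicator_def abs_mult intro!: mult_left_mono split: if_splits)
  qed (auto simp: DIM_index)
  ultimately have "?L = ?s * (LINT t|lborel. even_series (Omega_coeff ?nu) (norm x * t) * (indicat_real {0..} t * (F t * t ^ (DIM('a) - 1))))"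
    by (rule sums_unique2)
  also have "\<dots> = ?R" by (simp add: Omega_eq_even_series[OF DIM_index[where 'a = 'a]] mult_ac)
  finally show ?thesis .
qed

text \<open>Up to the factor \<open>sphere_area\<close>, the value of \<open>\<Omega>\<close> at \<open>t\<close> is the mean of the cosine over a thin shell of radius \<open>t\<close>.\<close>

lemma abs_DOmega_le:
  assumes t0: "0 \<le> t0"
  shows "\<bar>DOmega TYPE('a::euclidean_space) t0\<bar> \<le> 1"
proof (rule ccontr)
  let ?O = "DOmega TYPE('a)" and ?s = "sphere_area TYPE('a)" and ?m = "DIM('a) - 1"
  assume neg: "\<not> \<bar>?O t0\<bar> \<le> 1"
  \<comment> \<open>Multiplication by the sign treats values above 1 and below -1 together.\<close>
  define sg where "sg = sgn (?O t0)"
  have sg: "\<bar>sg\<bar> = 1" "1 < sg * ?O t0" using neg by (auto simp: sg_def sgn_if)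
  have "isCont (\<lambda>t. sg * ?O t) t0" by (intro continuous_intros isCont_Omega DIM_index)
  hence "eventually (\<lambda>t. 1 < sg * ?O t) (at t0)"
    using sg(2) by (auto simp: isCont_def intro: order_tendstoD)
  then obtain e where e: "0 < e" "\<And>t. t \<noteq> t0 \<Longrightarrow> dist t t0 < e \<Longrightarrow> 1 < sg * ?O t"
    unfolding eventually_at by blast
  have gt: "1 < sg * ?O t" if "t \<in> {t0..t0 + e / 2}" for t
    using sg(2) e(2)[of t] that e(1) by (cases "t = t0") (auto simp: dist_real_def)
  \<comment> \<open>The shell lies to the right of \<open>t0\<close>, so all radii are nonnegative
    even for \<open>t0 = 0\<close>; half of e keeps the closed interval inside the
    neighbourhood.\<close>
  define F where "F = indicat_real {t0..t0 + e / 2}"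
  obtain b :: 'a where b: "b \<in> Basis" using nonempty_Basis by blast
  have nb: "norm b = 1" using b by simp
  have [measurable]: "F \<in> borel_measurable borel" by (simp add: F_def)
  have cont: "continuous_on {t0..t0 + e / 2} (\<lambda>t. t ^ ?m)" by (intro continuous_intros)
  have cont2: "continuous_on {t0..t0 + e / 2} (\<lambda>t. (sg * ?O t - 1) * t ^ ?m)"
    by (intro continuous_intros continuous_at_imp_continuous_on ballI isCont_Omega DIM_index)
  have eqF: "indicat_real {0..} t * (F t * t ^ ?m) = indicat_real {t0..t0 + e / 2} t * t ^ ?m" for t
    using t0 by (auto simp: F_def indicator_def)
  have i1: "integrable lborel (\<lambda>t. indicat_real {0..} t * (F t * t ^ ?m))"
    unfolding eqF using borel_integrable_compact[OF _ cont] by simp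
  have i2: "integrable lborel (\<lambda>t. indicat_real {t0..t0 + e / 2} t * ((sg * ?O t - 1) * t ^ ?m))"
    using borel_integrable_compact[OF _ cont2] by simp
  have Fi: "integrable lborel (\<lambda>y::'a. F (norm y))" using i1 by (simp add: integrable_radial_iff)
  have F0: "F t = 0" if "t0 + e / 2 < t" for t using that by (simp add: F_def)
  have "sg * (LINT y|lborel. cos (b \<bullet> y) * F (norm y)) \<le> (LINT y|lborel. F (norm (y::'a)))"
  proof -
    have "\<bar>LINT y|lborel. cos (b \<bullet> y) * F (norm y)\<bar> \<le> (LINT y|lborel. \<bar>cos (b \<bullet> y) * F (norm y)\<bar>)"
      by (rule integral_abs_bound)
    also have "\<dots> \<le> (LINT y|lborel. F (norm (y::'a)))"
    proof (rule integral_mono'[OF Fi])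
      fix y :: 'a
      show "\<bar>cos (b \<bullet> y) * F (norm y)\<bar> \<le> F (norm y)" by (simp add: F_def abs_mult indicator_def)
    qed (simp add: F_def)
    finally have "\<bar>sg * (LINT y|lborel. cos (b \<bullet> y) * F (norm y))\<bar> \<le> (LINT y|lborel. F (norm (y::'a)))" using sg by (simp add: abs_mult)
    thus ?thesis by linarith
  qed
  hence "sg * (?s * (LINT t|lborel. indicat_real {0..} t * (?O (norm b * t) * F t * t ^ ?m))) \<le> ?s * (LINT t|lborel. indicat_real {0..} t * (F t * t ^ ?m))"
    by (simp only: integral_cos_radial_bounded[OF \<open>F \<in> borel_measurable borel\<close> i1 F0] integral_radial[OF \<open>F \<in> borel_measurable borel\<close>])
  hence "?s * (sg * (LINT t|lborel. indicat_real {0..} t * (?O (norm b * t) * F t * t ^ ?m))) \<le> ?s * (LINT t|lborel. indicat_real {0..} t * (F t * t ^ ?m))"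
    by (simp only: mult.left_commute)
  hence le: "(LINT t|lborel. sg * (indicat_real {0..} t * (?O (norm b * t) * F t * t ^ ?m))) \<le> (LINT t|lborel. indicat_real {0..} t * (F t * t ^ ?m))"
    using sphere_area_pos[where 'a = 'a] by simp
  have e3: "sg * (indicat_real {0..} t * (?O (norm b * t) * F t * t ^ ?m))
     = indicat_real {0..} t * (F t * t ^ ?m) + indicat_real {t0..t0 + e / 2} t * ((sg * ?O t - 1) * t ^ ?m)" for t
    unfolding eqF nb using t0 by (auto simp: F_def indicator_def algebra_simps)
  have nonpos: "(LINT t|lborel. indicat_real {t0..t0 + e / 2} t * ((sg * ?O t - 1) * t ^ ?m)) \<le> 0"
    using le unfolding e3 by (subst (asm) Bochner_Integration.integral_add[OF i1 i2]) simp
  have nn: "AE t in lborel. 0 \<le> indicat_real {t0..t0 + e / 2} t * ((sg * ?O t - 1) * t ^ ?m)"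
  proof (rule AE_I2)
    fix t
    show "0 \<le> indicat_real {t0..t0 + e / 2} t * ((sg * ?O t - 1) * t ^ ?m)"
    proof (cases "t \<in> {t0..t0 + e / 2}")
      case True
      hence "0 \<le> sg * ?O t - 1" "0 \<le> t ^ ?m" using gt[OF True] t0 by auto
      thus ?thesis using True by simp
    qed simp
  qed
  have "(LINT t|lborel. indicat_real {t0..t0 + e / 2} t * ((sg * ?O t - 1) * t ^ ?m)) = 0"
    using nonpos integral_nonneg_AE[OF nn] by linarith
  hence "AE t in lborel. indicat_real {t0..t0 + e / 2} t * ((sg * ?O t - 1) * t ^ ?m) = 0"
    using integral_nonneg_eq_0_iff_AE[OF i2 nn] by simp
  hence "AE t in lborel. t \<notin> {t0<..t0 + e / 2}"
  proof eventually_elim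
    fix t assume "indicat_real {t0..t0 + e / 2} t * ((sg * ?O t - 1) * t ^ ?m) = 0"
    thus "t \<notin> {t0<..t0 + e / 2}" using gt[of t] t0 by (auto simp: indicator_def)
  qed
  hence "emeasure lborel {t0<..t0 + e / 2} = 0" by (subst (asm) AE_iff_measurable[of "{t0<..t0 + e / 2}"]) auto
  thus False using e(1) by simp
qed

text \<open>The profile is truncated at radius n. As both the cosine and \<open>DOmega\<close> are
  bounded by 1, dominated convergence applies on either side.\<close>

lemma
  fixes F :: "real \<Rightarrow> real" and x :: "'a::euclidean_space"
  assumes F [measurable]: "F \<in> borel_measurable borel"
    and int: "integrable lborel (\<lambda>t. indicat_real {0..} t * (F t * t ^ (DIM('a) - 1)))"
  shows integrable_DOmega: "integrable lborel (\<lambda>t. indicat_real {0..} t * (DOmega TYPE('a) (norm x * t) * F t * t ^ (DIM('a) - 1)))"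
    and integral_cos_radial: "(LINT y|lborel. cos (x \<bullet> y) * F (norm y)) =
      sphere_area TYPE('a) * (LINT t|lborel. indicat_real {0..} t * (DOmega TYPE('a) (norm x * t) * F t * t ^ (DIM('a) - 1)))"
proof -
  let ?O = "DOmega TYPE('a)" and ?s = "sphere_area TYPE('a)" and ?m = "DIM('a) - 1"
  define G where "G = (\<lambda>n t. if t \<le> real n then F t else 0)"
  have [measurable]: "G n \<in> borel_measurable borel" for n unfolding G_def by measurable
  have [measurable]: "?O \<in> borel_measurable borel" by (rule borel_measurable_Omega[OF DIM_index])
  have int': "integrable lborel (\<lambda>y::'a. F (norm y))" using int by (simp add: integrable_radial_iff)
  have GF: "\<bar>G n t\<bar> \<le> \<bar>F t\<bar>" for n t by (simp add: G_def)
  have Olim: "(\<lambda>n. G n t) \<longlonglongrightarrow> F t" for t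
  proof (rule tendsto_eventually)
    obtain N where "t \<le> real N" using real_arch_simple by blast
    thus "\<forall>\<^sub>F n in sequentially. G n t = F t"
      unfolding G_def by (intro eventually_sequentiallyI[of N]) auto
  qed
  have w: "\<bar>indicat_real {0..} t * (?O (norm x * t) * f * t ^ ?m)\<bar> \<le> \<bar>indicat_real {0..} t * (g * t ^ ?m)\<bar>" if "\<bar>f\<bar> \<le> \<bar>g\<bar>" for f g t
  proof (cases "0 \<le> t")
    case True
    have "\<bar>?O (norm x * t)\<bar> * \<bar>f\<bar> \<le> 1 * \<bar>g\<bar>" using True that by (intro mult_mono abs_DOmega_le) auto
    thus ?thesis using True by (auto simp: abs_mult intro!: mult_right_mono)
  qed simp
  show "integrable lborel (\<lambda>t. indicat_real {0..} t * (?O (norm x * t) * F t * t ^ ?m))"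
    by (rule Bochner_Integration.integrable_bound[OF int]) (use w in auto)
  have Gi: "integrable lborel (\<lambda>t. indicat_real {0..} t * (G n t * t ^ ?m))" for n
    by (rule Bochner_Integration.integrable_bound[OF int]) (use GF in \<open>auto simp: abs_mult intro!: mult_left_mono mult_right_mono\<close>)
  have G0: "G n t = 0" if "real n < t" for n t using that by (simp add: G_def)
  have eq: "(LINT y|lborel. cos (x \<bullet> y) * G n (norm y)) = ?s * (LINT t|lborel. indicat_real {0..} t * (?O (norm x * t) * G n t * t ^ ?m))" for n
    by (rule integral_cos_radial_bounded[OF _ Gi G0]) auto
  have L: "(\<lambda>n. LINT y|lborel. cos (x \<bullet> y) * G n (norm y)) \<longlonglongrightarrow> (LINT y|lborel. cos (x \<bullet> y) * F (norm y))"
  proof (rule integral_dominated_convergence[where w = "\<lambda>y. \<bar>F (norm y)\<bar>"])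
    show "AE y in lborel. (\<lambda>n. cos (x \<bullet> y) * G n (norm y)) \<longlonglongrightarrow> cos (x \<bullet> y) * F (norm y)"
      by (intro AE_I2 tendsto_intros Olim)
    show "AE y in lborel. norm (cos (x \<bullet> y) * G n (norm y)) \<le> \<bar>F (norm y)\<bar>" for n
    proof (rule AE_I2)
      fix y
      have "\<bar>cos (x \<bullet> y)\<bar> * \<bar>G n (norm y)\<bar> \<le> 1 * \<bar>F (norm y)\<bar>" by (intro mult_mono GF) auto
      thus "norm (cos (x \<bullet> y) * G n (norm y)) \<le> \<bar>F (norm y)\<bar>" by (simp add: abs_mult)
    qed
  qed (use int' in auto)
  have R: "(\<lambda>n. LINT t|lborel. indicat_real {0..} t * (?O (norm x * t) * G n t * t ^ ?m)) \<longlonglongrightarrow> (LINT t|lborel. indicat_real {0..} t * (?O (norm x * t) * F t * t ^ ?m))"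
  proof (rule integral_dominated_convergence[where w = "\<lambda>t. \<bar>indicat_real {0..} t * (F t * t ^ ?m)\<bar>"])
    show "AE t in lborel. (\<lambda>n. indicat_real {0..} t * (?O (norm x * t) * G n t * t ^ ?m)) \<longlonglongrightarrow> indicat_real {0..} t * (?O (norm x * t) * F t * t ^ ?m)"
      by (intro AE_I2 tendsto_intros Olim)
    show "AE t in lborel. norm (indicat_real {0..} t * (?O (norm x * t) * G n t * t ^ ?m)) \<le> \<bar>indicat_real {0..} t * (F t * t ^ ?m)\<bar>" for n
      using w[OF GF] by (intro AE_I2) auto
  qed (use int in auto)
  show "(LINT y|lborel. cos (x \<bullet> y) * F (norm y)) = ?s * (LINT t|lborel. indicat_real {0..} t * (?O (norm x * t) * F t * t ^ ?m))"
    by (rule LIMSEQ_unique[OF L]) (unfold eq, intro tendsto_intros R)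
qed

section \<open>Fourier inversion by Gaussian smoothing\<close>

lemma
  fixes f :: "'a::euclidean_space \<Rightarrow> real"
  assumes [measurable]: "f \<in> borel_measurable borel" and c: "c \<noteq> 0"
  shows integral_lborel_affine: "(LINT y|lborel. f y) = \<bar>c\<bar> ^ DIM('a) * (LINT y|lborel. f (t + c *\<^sub>R y))"
    and integrable_lborel_affine: "integrable lborel f \<longleftrightarrow> integrable lborel (\<lambda>y. f (t + c *\<^sub>R y))"
proof -
  show "(LINT y|lborel. f y) = \<bar>c\<bar> ^ DIM('a) * (LINT y|lborel. f (t + c *\<^sub>R y))"
    by (subst lborel_affine[OF c, of t]) (simp add: integral_real_density integral_distr)
  show "integrable lborel f \<longleftrightarrow> integrable lborel (\<lambda>y. f (t + c *\<^sub>R y))"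
    by (subst lborel_affine[OF c, of t]) (use c in \<open>simp add: integrable_real_density integrable_distr_eq\<close>)
qed

definition Gauss :: "'a::euclidean_space \<Rightarrow> real" where
  "Gauss y = exp (- (norm y)\<^sup>2 / 2)"

lemma Gauss_simps [simp]: "0 < Gauss y" "0 \<le> Gauss y" "\<bar>Gauss y\<bar> = Gauss y" "Gauss y \<le> 1" "Gauss 0 = 1" "Gauss (- y) = Gauss y"
  by (simp_all add: Gauss_def)

lemma borel_measurable_Gauss [measurable]: "Gauss \<in> borel_measurable borel"
  unfolding Gauss_def[abs_def] by measurable

lemma tendsto_Gauss [tendsto_intros]: "(f \<longlongrightarrow> a) F \<Longrightarrow> ((\<lambda>x. Gauss (f x)) \<longlongrightarrow> Gauss a) F"
  unfolding Gauss_def by (intro tendsto_intros) auto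

lemma has_bochner_integral_moment_Gauss:
  "has_bochner_integral lborel (\<lambda>y. (x \<bullet> y) ^ (2 * k) * Gauss y) (Gauss_moment x k)"
  unfolding Gauss_def by (rule has_bochner_integral_Gauss_moment)

lemma integrable_Gauss: "integrable lborel (Gauss :: 'a::euclidean_space \<Rightarrow> real)"
  and integral_Gauss: "(LINT y|lborel. Gauss (y::'a)) = (2 * pi) powr (DIM('a) / 2)"
  using has_bochner_integral_moment_Gauss[of "0::'a" 0]
  by (simp_all add: has_bochner_integral_iff Gauss_moment_0)

text \<open>The weight has unbounded support, so the termwise integration used for bounded weights
  does not apply. The absolute values of the terms are those of the cosh series, whose integrals sum
  by \<open>Gauss_moment_sums\<close>.\<close>

lemma integral_cos_Gauss:
  fixes x :: "'a::euclidean_space"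
  shows "(LINT y|lborel. cos (x \<bullet> y) * Gauss y) = (2 * pi) powr (DIM('a) / 2) * Gauss x"
proof -
  let ?I = "(2 * pi) powr (DIM('a) / 2)"
  let ?f = "\<lambda>k y. (- 1) ^ k / fact (2 * k) * ((x \<bullet> y) ^ (2 * k) * Gauss y)"
  have int: "integrable lborel (?f k)" for k
    using has_bochner_integral_moment_Gauss[of x k] by (intro integrable_mult_right) (simp add: has_bochner_integral_iff)
  have n: "norm (?f k y) = (x \<bullet> y) ^ (2 * k) / fact (2 * k) * Gauss y" for k y
    by (simp add: abs_mult power_even_abs)
  have s1: "AE y in lborel. summable (\<lambda>k. norm (?f k y))"
    unfolding n by (intro AE_I2 summable_mult2 sums_summable[OF cosh_sums])
  have "(LINT y|lborel. norm (?f k y)) = Gauss_moment x k / fact (2 * k)" for k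
  proof -
    have "(\<lambda>y. norm (?f k y)) = (\<lambda>y. 1 / fact (2 * k) * ((x \<bullet> y) ^ (2 * k) * Gauss y))" unfolding n by simp
    thus ?thesis using has_bochner_integral_mult_right[OF has_bochner_integral_moment_Gauss[of x k], of "1 / fact (2 * k)"]
      by (simp only: has_bochner_integral_iff) simp
  qed
  hence s2: "summable (\<lambda>k. LINT y|lborel. norm (?f k y))"
    using Gauss_moment_sums[of x] by (simp add: sums_iff)
  have "(\<lambda>k. LINT y|lborel. ?f k y) sums (LINT y|lborel. (\<Sum>k. ?f k y))" by (rule sums_integral[OF int s1 s2])
  moreover have "(\<Sum>k. ?f k y) = cos (x \<bullet> y) * Gauss y" for y
  proof -
    have "(\<lambda>k. (- 1) ^ k / fact (2 * k) * (x \<bullet> y) ^ (2 * k) * Gauss y) sums (cos (x \<bullet> y) * Gauss y)"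
      by (rule sums_mult2[OF cos_paired])
    thus ?thesis by (simp only: mult.assoc sums_iff)
  qed
  moreover have "(LINT y|lborel. ?f k y) = ?I * ((- (norm x)\<^sup>2 / 2) ^ k /\<^sub>R fact k)" for k
  proof -
    have "(LINT y|lborel. ?f k y) = (- 1) ^ k / fact (2 * k) * Gauss_moment x k"
      using has_bochner_integral_mult_right[OF has_bochner_integral_moment_Gauss[of x k], of "(- 1) ^ k / fact (2 * k)"]
      by (simp only: has_bochner_integral_iff)
    also have "\<dots> = ?I * ((- 1) ^ k * (norm x) ^ (2 * k) / (2 ^ k * fact k))"
      unfolding Gauss_moment_eq by simp
    also have "(- 1) ^ k * (norm x) ^ (2 * k) / (2 ^ k * fact k) = (- (norm x)\<^sup>2 / 2) ^ k /\<^sub>R fact k"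
    proof -
      have e: "(- a / 2) ^ k = (- 1) ^ k * a ^ k / 2 ^ k" for a :: real
        unfolding power_divide by (subst power_minus) simp
      show ?thesis unfolding e power_mult[of "norm x"] real_scaleR_def by (simp add: field_simps)
    qed
    finally show ?thesis .
  qed
  ultimately have "(\<lambda>k. ?I * ((- (norm x)\<^sup>2 / 2) ^ k /\<^sub>R fact k)) sums (LINT y|lborel. cos (x \<bullet> y) * Gauss y)" by simp
  moreover have "(\<lambda>k. ?I * ((- (norm x)\<^sup>2 / 2) ^ k /\<^sub>R fact k)) sums (?I * Gauss x)"
    unfolding Gauss_def by (intro sums_mult exp_converges)
  ultimately show ?thesis by (rule sums_unique2)
qed

lemma integral_cos_Gauss_scaled:
  fixes x :: "'a::euclidean_space"
  assumes e: "0 < e"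
  shows "(LINT y|lborel. cos (x \<bullet> y) * Gauss (e *\<^sub>R y)) = (2 * pi) powr (DIM('a) / 2) / e ^ DIM('a) * Gauss (x /\<^sub>R e)"
proof -
  have "(LINT y|lborel. cos (x \<bullet> y) * Gauss (e *\<^sub>R y))
     = \<bar>1 / e\<bar> ^ DIM('a) * (LINT y|lborel. cos (x \<bullet> (0 + (1 / e) *\<^sub>R y)) * Gauss (e *\<^sub>R (0 + (1 / e) *\<^sub>R y)))"
    using e by (intro integral_lborel_affine) auto
  also have "(\<lambda>y. cos (x \<bullet> (0 + (1 / e) *\<^sub>R y)) * Gauss (e *\<^sub>R (0 + (1 / e) *\<^sub>R y))) = (\<lambda>y. cos ((x /\<^sub>R e) \<bullet> y) * Gauss y)"
    using e by (simp add: divide_inverse)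
  finally show ?thesis unfolding integral_cos_Gauss using e by (simp add: power_divide)
qed

lemma integrable_cos_mult:
  fixes f :: "'a::euclidean_space \<Rightarrow> real"
  assumes "integrable lborel f"
  shows "integrable lborel (\<lambda>y. cos (x \<bullet> y) * f y)"
  by (rule Bochner_Integration.integrable_bound[OF assms]) (use assms in \<open>auto simp: abs_mult mult_left_le_one_le\<close>)

lemma integrable_Gauss_scaled:
  "0 < e \<Longrightarrow> integrable lborel (\<lambda>y::'a::euclidean_space. Gauss (e *\<^sub>R y))"
  using integrable_lborel_affine[of "Gauss :: 'a \<Rightarrow> real" e 0] integrable_Gauss[where 'a = 'a] by simp

text \<open>The damping factor makes Fubini applicable. The product of the two cosines splits into
  the frequencies y - z and y + z, each integrating to a Gaussian of width e around y or -y;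
  evenness of f makes the two contributions equal.\<close>

lemma Fourier_smoothing:
  fixes f :: "'a::euclidean_space \<Rightarrow> real"
  assumes f: "integrable lborel f" and even: "\<And>y. f (- y) = f y" and e: "0 < e"
  shows "(LINT x|lborel. (LINT z|lborel. cos (x \<bullet> z) * f z) * (cos (y \<bullet> x) * Gauss (e *\<^sub>R x)))
    = (2 * pi) powr (DIM('a) / 2) * (LINT w|lborel. f (y + e *\<^sub>R w) * Gauss w)"
proof -
  let ?I = "(2 * pi) powr (DIM('a) / 2)"
  let ?E = "\<lambda>x::'a. Gauss (e *\<^sub>R x)"
  let ?h = "\<lambda>x z. cos (x \<bullet> z) * f z * (cos (y \<bullet> x) * ?E x)"
  have [measurable]: "f \<in> borel_measurable borel" using f by simp
  have Ei: "integrable lborel ?E" by (rule integrable_Gauss_scaled[OF e])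
  have pi: "integrable (lborel \<Otimes>\<^sub>M lborel) (\<lambda>(x, z). ?h x z)"
  proof (rule Bochner_Integration.integrable_bound)
    show "integrable (lborel \<Otimes>\<^sub>M lborel) (\<lambda>(x, z). ?E x * f z)"
      by (rule integrable_product_lborel[OF Ei f])
    show "AE xz in lborel \<Otimes>\<^sub>M lborel. norm (case xz of (x, z) \<Rightarrow> ?h x z) \<le> norm (case xz of (x, z) \<Rightarrow> ?E x * f z)"
    proof (rule AE_I2, clarify)
      fix x z :: 'a
      have "\<bar>cos (x \<bullet> z)\<bar> * \<bar>cos (y \<bullet> x)\<bar> \<le> 1 * 1" by (intro mult_mono) auto
      hence "(\<bar>cos (x \<bullet> z)\<bar> * \<bar>cos (y \<bullet> x)\<bar>) * \<bar>?E x * f z\<bar> \<le> 1 * \<bar>?E x * f z\<bar>" by (intro mult_right_mono) auto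
      thus "norm (?h x z) \<le> norm (?E x * f z)" by (simp add: abs_mult mult_ac)
    qed
  qed measurable
  have "(LINT x|lborel. (LINT z|lborel. cos (x \<bullet> z) * f z) * (cos (y \<bullet> x) * ?E x)) = (LINT x|lborel. LINT z|lborel. ?h x z)"
    by simp
  also have "\<dots> = (LINT z|lborel. LINT x|lborel. ?h x z)"
    by (rule lborel_pair.Fubini_integral[OF pi, symmetric])
  also have "\<dots> = (LINT z|lborel. f z * (?I / e ^ DIM('a) * (Gauss ((y - z) /\<^sub>R e) + Gauss ((y + z) /\<^sub>R e)) / 2))"
  proof (rule Bochner_Integration.integral_cong[OF refl])
    fix z
    have c: "?h x z = f z / 2 * (cos ((y - z) \<bullet> x) * ?E x + cos ((y + z) \<bullet> x) * ?E x)" for x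
    proof -
      have cc: "cos (x \<bullet> z) * cos (y \<bullet> x) = (cos ((y - z) \<bullet> x) + cos ((y + z) \<bullet> x)) / 2"
        by (simp add: inner_diff_left inner_add_left cos_diff cos_add inner_commute[of x z])
      have "?h x z = f z * ?E x * (cos (x \<bullet> z) * cos (y \<bullet> x))" by (simp only: mult_ac)
      also have "\<dots> = f z / 2 * (cos ((y - z) \<bullet> x) * ?E x + cos ((y + z) \<bullet> x) * ?E x)"
        unfolding cc by (simp add: algebra_simps)
      finally show ?thesis .
    qed
    have "(LINT x|lborel. ?h x z) = f z / 2 * ((LINT x|lborel. cos ((y - z) \<bullet> x) * ?E x) + (LINT x|lborel. cos ((y + z) \<bullet> x) * ?E x))"
      unfolding c integral_mult_right_zero
      by (subst Bochner_Integration.integral_add) (simp_all only: integrable_cos_mult[OF Ei])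
    also have "\<dots> = f z * (?I / e ^ DIM('a) * (Gauss ((y - z) /\<^sub>R e) + Gauss ((y + z) /\<^sub>R e)) / 2)"
    proof -
      have "F / 2 * (K * a + K * b) = F * (K * (a + b) / 2)" for F K a b :: real by (simp add: algebra_simps)
      thus ?thesis unfolding integral_cos_Gauss_scaled[OF e] .
    qed
    finally show "(LINT x|lborel. ?h x z) = f z * (?I / e ^ DIM('a) * (Gauss ((y - z) /\<^sub>R e) + Gauss ((y + z) /\<^sub>R e)) / 2)" .
  qed
  also have "\<dots> = ?I / e ^ DIM('a) / 2 * ((LINT z|lborel. f z * Gauss ((y - z) /\<^sub>R e)) + (LINT z|lborel. f z * Gauss ((y + z) /\<^sub>R e)))"
  proof -
    have fG: "integrable lborel (\<lambda>z. f z * Gauss (u z))" if [measurable]: "u \<in> borel_measurable borel" for u :: "'a \<Rightarrow> 'a"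
      by (rule Bochner_Integration.integrable_bound[OF f]) (auto simp: abs_mult mult_left_le)
    have "(\<lambda>z. f z * (?I / e ^ DIM('a) * (Gauss ((y - z) /\<^sub>R e) + Gauss ((y + z) /\<^sub>R e)) / 2))
      = (\<lambda>z. ?I / e ^ DIM('a) / 2 * (f z * Gauss ((y - z) /\<^sub>R e) + f z * Gauss ((y + z) /\<^sub>R e)))"
    proof -
      have "F * (K * (a + b) / 2) = K / 2 * (F * a + F * b)" for F K a b :: real by (simp add: algebra_simps)
      thus ?thesis by (rule ext)
    qed
    thus ?thesis using fG[of "\<lambda>z. (y - z) /\<^sub>R e"] fG[of "\<lambda>z. (y + z) /\<^sub>R e"]
      by (subst Bochner_Integration.integral_add[symmetric]) simp_all
  qed
  also have "(LINT z|lborel. f z * Gauss ((y - z) /\<^sub>R e)) = e ^ DIM('a) * (LINT w|lborel. f (y + e *\<^sub>R w) * Gauss w)"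
  proof -
    have "(LINT z|lborel. f z * Gauss ((y - z) /\<^sub>R e)) = \<bar>e\<bar> ^ DIM('a) * (LINT w|lborel. f (y + e *\<^sub>R w) * Gauss ((y - (y + e *\<^sub>R w)) /\<^sub>R e))"
      using e by (intro integral_lborel_affine) auto
    thus ?thesis using e by simp
  qed
  \<comment> \<open>Here z = - y - e w, and evenness carries the value back to y + e w.\<close>
  also have "(LINT z|lborel. f z * Gauss ((y + z) /\<^sub>R e)) = e ^ DIM('a) * (LINT w|lborel. f (y + e *\<^sub>R w) * Gauss w)"
  proof -
    have "(LINT z|lborel. f z * Gauss ((y + z) /\<^sub>R e)) = \<bar>- e\<bar> ^ DIM('a) * (LINT w|lborel. f (- y + (- e) *\<^sub>R w) * Gauss ((y + (- y + (- e) *\<^sub>R w)) /\<^sub>R e))"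
      using e by (intro integral_lborel_affine) auto
    moreover have "f (- y + (- e) *\<^sub>R w) = f (y + e *\<^sub>R w)" for w
      using even[of "y + e *\<^sub>R w"] by simp
    ultimately show ?thesis using e by simp
  qed
  finally show ?thesis using e by simp
qed

text \<open>Let the width tend to 0 in \<open>Fourier_smoothing\<close>: the side of the transform
  is dominated because the transform is integrable, the other because f is bounded, and continuity
  identifies the limit. One factor (2 pi)^(d/2) comes from the smoothing identity, the other from
  the Gaussian integral.\<close>

theorem Fourier_inversion_even:
  fixes f :: "'a::euclidean_space \<Rightarrow> real"
  assumes f: "integrable lborel f" and even: "\<And>y. f (- y) = f y"
    and cont: "continuous_on UNIV f" and bd: "\<And>y. \<bar>f y\<bar> \<le> C"
    and g: "integrable lborel (\<lambda>x. LINT z|lborel. cos (x \<bullet> z) * f z)"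
  shows "(LINT x|lborel. cos (y \<bullet> x) * (LINT z|lborel. cos (x \<bullet> z) * f z)) = (2 * pi) ^ DIM('a) * f y"
proof -
  let ?I = "(2 * pi) powr (DIM('a) / 2)"
  let ?g = "\<lambda>x. LINT z|lborel. cos (x \<bullet> z) * f z"
  let ?e = "\<lambda>n::nat. 1 / real (Suc n)"
  have [measurable]: "f \<in> borel_measurable borel" "?g \<in> borel_measurable borel" using f g by auto
  have e0: "?e \<longlonglongrightarrow> 0" by real_asymp
  have L: "(\<lambda>n. LINT x|lborel. ?g x * (cos (y \<bullet> x) * Gauss (?e n *\<^sub>R x))) \<longlonglongrightarrow> (LINT x|lborel. ?g x * cos (y \<bullet> x))"
  proof (rule integral_dominated_convergence[where w = "\<lambda>x. \<bar>?g x\<bar>"])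
    show "AE x in lborel. (\<lambda>n. ?g x * (cos (y \<bullet> x) * Gauss (?e n *\<^sub>R x))) \<longlonglongrightarrow> ?g x * cos (y \<bullet> x)"
    proof (rule AE_I2)
      fix x
      have "(\<lambda>n. ?g x * (cos (y \<bullet> x) * Gauss (?e n *\<^sub>R x))) \<longlonglongrightarrow> ?g x * (cos (y \<bullet> x) * Gauss (0 *\<^sub>R x))"
        by (intro tendsto_intros e0)
      thus "(\<lambda>n. ?g x * (cos (y \<bullet> x) * Gauss (?e n *\<^sub>R x))) \<longlonglongrightarrow> ?g x * cos (y \<bullet> x)" by simp
    qed
    show "AE x in lborel. norm (?g x * (cos (y \<bullet> x) * Gauss (?e n *\<^sub>R x))) \<le> \<bar>?g x\<bar>" for n
    proof (rule AE_I2)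
      fix x
      have "\<bar>cos (y \<bullet> x)\<bar> * Gauss (?e n *\<^sub>R x) \<le> 1 * 1" by (intro mult_mono) auto
      thus "norm (?g x * (cos (y \<bullet> x) * Gauss (?e n *\<^sub>R x))) \<le> \<bar>?g x\<bar>" by (simp add: abs_mult mult_left_le)
    qed
  qed (use g in auto)
  have R: "(\<lambda>n. LINT w|lborel. f (y + ?e n *\<^sub>R w) * Gauss w) \<longlonglongrightarrow> (LINT w|lborel. f y * Gauss (w::'a))"
  proof (rule integral_dominated_convergence[where w = "\<lambda>w. C * Gauss w"])
    show "AE w in lborel. (\<lambda>n. f (y + ?e n *\<^sub>R w) * Gauss w) \<longlonglongrightarrow> f y * Gauss w"
    proof (rule AE_I2)
      fix w
      have "(\<lambda>n. y + ?e n *\<^sub>R w) \<longlonglongrightarrow> y + 0 *\<^sub>R w" by (intro tendsto_intros e0)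
      hence "(\<lambda>n. f (y + ?e n *\<^sub>R w)) \<longlonglongrightarrow> f y"
        using continuous_on_tendsto_compose[OF cont] by simp
      thus "(\<lambda>n. f (y + ?e n *\<^sub>R w) * Gauss w) \<longlonglongrightarrow> f y * Gauss w" by (intro tendsto_intros)
    qed
    show "AE w in lborel. norm (f (y + ?e n *\<^sub>R w) * Gauss w) \<le> C * Gauss w" for n
      using bd by (intro AE_I2) (simp add: abs_mult)
  qed (use integrable_Gauss[where 'a = 'a] in auto)
  have "(\<lambda>n. ?I * (LINT w|lborel. f (y + ?e n *\<^sub>R w) * Gauss w)) \<longlonglongrightarrow> ?I * (LINT w|lborel. f y * Gauss (w::'a))"
    by (intro tendsto_intros R)
  moreover have "(LINT x|lborel. ?g x * (cos (y \<bullet> x) * Gauss (?e n *\<^sub>R x))) = ?I * (LINT w|lborel. f (y + ?e n *\<^sub>R w) * Gauss w)" for n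
    by (rule Fourier_smoothing[OF f even]) simp
  ultimately have "(LINT x|lborel. ?g x * cos (y \<bullet> x)) = ?I * (LINT w|lborel. f y * Gauss (w::'a))"
    using L by (simp only: LIMSEQ_unique)
  also have "\<dots> = ?I * ?I * f y" by (simp add: integral_Gauss)
  also have "?I * ?I = (2 * pi) powr real DIM('a)" by (simp add: powr_add[symmetric])
  also have "\<dots> = (2 * pi) ^ DIM('a)" by (simp add: powr_realpow)
  finally show ?thesis by (simp add: mult.commute)
qed

subsection \<open>Positive definiteness\<close>

text \<open>Differentiating along \<open>v = x a - x b\<close> and subtracting a multiple of the sum itself
  eliminates the index \<open>b\<close> without killing the coefficient at \<open>a\<close>.\<close>

lemma exponentials_independent:
  fixes x :: "'i \<Rightarrow> 'a::euclidean_space" and z :: "'i \<Rightarrow> complex"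
  assumes "finite S" "inj_on x S" "0 < r"
    and "\<And>y. norm y < r \<Longrightarrow> (\<Sum>j\<in>S. z j * exp (\<i> * of_real (x j \<bullet> y))) = 0"
    and "a \<in> S"
  shows "z a = 0"
  using assms
proof (induction "card S" arbitrary: S z a rule: less_induct)
  case less
  show ?case
  proof (cases "S = {a}")
    case True
    thus ?thesis using less.prems(4)[of 0] less.prems(3) by simp
  next
    case False
    then obtain b where b: "b \<in> S" "b \<noteq> a" using less.prems(5) by blast
    define v where "v = x a - x b"
    have v: "v \<noteq> 0" using b less.prems(2,5) by (auto simp: v_def inj_on_def)
    \<comment> \<open>The coefficients after differentiating and subtracting
      \<open>\<i> * of_real (x b \<bullet> v)\<close> times the sum. At b they vanish; at a the
      factor is i |v|^2, which is not 0.\<close>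
    define w where "w = (\<lambda>j. z j * (\<i> * of_real ((x j - x b) \<bullet> v)))"
    have "(\<Sum>j\<in>S - {b}. w j * exp (\<i> * of_real (x j \<bullet> y))) = 0" if y: "norm y < r" for y
    proof -
      let ?E = "\<lambda>j (t::real). z j * exp (\<i> * of_real (x j \<bullet> (y + t *\<^sub>R v)))"
      let ?D = "\<lambda>j. z j * (\<i> * of_real (x j \<bullet> v)) * exp (\<i> * of_real (x j \<bullet> y))"
      have d: "((\<lambda>t. \<Sum>j\<in>S. ?E j t) has_vector_derivative (\<Sum>j\<in>S. ?D j)) (at 0)"
      proof (rule has_vector_derivative_sum)
        fix j
        have "((\<lambda>t. \<i> * of_real (x j \<bullet> y + t * (x j \<bullet> v))) has_vector_derivative (\<i> * of_real (x j \<bullet> v))) (at 0)"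
          by (auto intro!: derivative_eq_intros simp: has_vector_derivative_def scaleR_conv_of_real algebra_simps)
        moreover have "(exp has_field_derivative exp (\<i> * of_real (x j \<bullet> y))) (at (\<i> * of_real (x j \<bullet> y + 0 * (x j \<bullet> v))))"
          by (auto intro!: derivative_eq_intros)
        ultimately have "((exp \<circ> (\<lambda>t. \<i> * of_real (x j \<bullet> y + t * (x j \<bullet> v)))) has_vector_derivative (\<i> * of_real (x j \<bullet> v) * exp (\<i> * of_real (x j \<bullet> y)))) (at 0)"
          by (rule field_vector_diff_chain_at)
        from has_vector_derivative_mult_right[OF this, of "z j"]
        show "(?E j has_vector_derivative ?D j) (at 0)"
          by (simp add: o_def inner_add_right mult.assoc)
      qed
      have "(\<lambda>t. y + t *\<^sub>R v) \<midarrow>0\<rightarrow> y + 0 *\<^sub>R v" by (intro tendsto_intros)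
      hence "((\<lambda>t. norm (y + t *\<^sub>R v)) \<longlongrightarrow> norm y) (at 0)" using tendsto_norm by force
      hence "\<forall>\<^sub>F t in at 0. norm (y + t *\<^sub>R v) < r" using y by (rule order_tendstoD)
      hence ev: "\<forall>\<^sub>F t in nhds 0. norm (y + t *\<^sub>R v) < r" using y by (simp add: eventually_nhds_conv_at)
      \<comment> \<open>As the ball is open, the sum vanishes for all small t and not just at t = 0,
        so its derivative is 0.\<close>
      have "((\<lambda>t. \<Sum>j\<in>S. ?E j t) has_vector_derivative 0) (at 0)"
      proof (subst has_vector_derivative_cong_ev)
        show "\<forall>\<^sub>F t in nhds 0. t \<in> UNIV \<longrightarrow> (\<Sum>j\<in>S. ?E j t) = 0"
          using ev by eventually_elim (use less.prems(4) in blast)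
        show "(\<Sum>j\<in>S. ?E j 0) = 0" using less.prems(4)[OF y] by simp
      qed (rule has_vector_derivative_const)
      with d have "(\<Sum>j\<in>S. ?D j) = 0" by (rule vector_derivative_unique_at)
      moreover have "(\<Sum>j\<in>S. \<i> * of_real (x b \<bullet> v) * (z j * exp (\<i> * of_real (x j \<bullet> y)))) = 0"
        unfolding sum_distrib_left[symmetric] using less.prems(4)[OF y] by simp
      ultimately have "(\<Sum>j\<in>S. ?D j - \<i> * of_real (x b \<bullet> v) * (z j * exp (\<i> * of_real (x j \<bullet> y)))) = 0"
        by (simp add: sum_subtractf)
      hence "(\<Sum>j\<in>S. w j * exp (\<i> * of_real (x j \<bullet> y))) = 0"
        by (simp add: w_def inner_diff_left algebra_simps)
      moreover have "w b = 0" by (simp add: w_def)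
      ultimately show ?thesis using less.prems(1) b by (simp add: sum.remove)
    qed
    hence "w a = 0"
      using less.prems b card_Diff1_less[OF less.prems(1) b(1)]
      by (intro less.hyps[of "S - {b}" w a]) (auto intro: inj_on_subset simp del: card_Diff_singleton)
    thus ?thesis using v by (simp add: w_def v_def)
  qed
qed

text \<open>The easy direction of Bochner's theorem. The quadratic form is c times the integral of a
  nonnegative H against F; if it is 0, then H vanishes wherever F is positive, in particular on a
  ball, and independence of exponentials on that ball gives strictness.\<close>

lemma radially_positive_definiteI:
  fixes \<phi> F :: "real \<Rightarrow> real"
  assumes int: "integrable lborel (\<lambda>y::real ^ 'n. F (norm y))"
    and nonneg: "\<And>t. 0 \<le> t \<Longrightarrow> 0 \<le> F t"
    and r: "0 < r" "\<And>t. 0 \<le> t \<Longrightarrow> t < r \<Longrightarrow> 0 < F t"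
    and c: "0 < c" and \<phi>: "\<And>x::real ^ 'n. \<phi> (norm x) = c * (LINT y|lborel. cos (x \<bullet> y) * F (norm y))"
  shows "radially_positive_definite TYPE('n::finite) \<phi>"
  unfolding radially_positive_definite_def positive_definite_def
proof (intro allI impI)
  fix N and x :: "nat \<Rightarrow> real ^ 'n" and z :: "nat \<Rightarrow> complex"
  assume inj: "inj_on x {..<N}"
  define C where "C = (\<lambda>y. \<Sum>j<N. of_real (cos (x j \<bullet> y)) * z j)"
  define S where "S = (\<lambda>y. \<Sum>j<N. of_real (sin (x j \<bullet> y)) * z j)"
  \<comment> \<open>With E(y) the sum of z_j exp(i x_j . y), H is the mean of |E(y)|^2 and
    |E(-y)|^2. It appears in place of |E(y)|^2 because the transform is a pure cosine
    transform.\<close>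
  define H where "H = (\<lambda>y. (cmod (C y))\<^sup>2 + (cmod (S y))\<^sup>2)"
  have H0: "0 \<le> H y" for y by (simp add: H_def)
  have cH: "continuous_on UNIV H" unfolding H_def C_def S_def by (intro continuous_intros)
  have Hsum: "(\<Sum>j<N. \<Sum>k<N. of_real (cos ((x j - x k) \<bullet> y)) * z j * cnj (z k)) = of_real (H y)" for y
  proof -
    have "of_real (H y) = C y * cnj (C y) + S y * cnj (S y)"
      by (simp only: H_def of_real_add complex_norm_square)
    also have "\<dots> = (\<Sum>j<N. \<Sum>k<N. of_real (cos (x j \<bullet> y)) * z j * (of_real (cos (x k \<bullet> y)) * cnj (z k)))
        + (\<Sum>j<N. \<Sum>k<N. of_real (sin (x j \<bullet> y)) * z j * (of_real (sin (x k \<bullet> y)) * cnj (z k)))"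
      by (simp add: C_def S_def sum_product)
    also have "\<dots> = (\<Sum>j<N. \<Sum>k<N. of_real (cos ((x j - x k) \<bullet> y)) * z j * cnj (z k))"
      unfolding sum.distrib[symmetric]
      by (intro sum.cong refl) (simp add: inner_diff_left cos_diff algebra_simps)
    finally show ?thesis by simp
  qed
  have cint: "integrable lborel (\<lambda>y. cos ((x j - x k) \<bullet> y) * F (norm y))" for j k
    by (rule integrable_cos_mult[OF int])
  have ci: "integrable lborel (\<lambda>y. complex_of_real (cos ((x j - x k) \<bullet> y) * F (norm y)) * (z j * cnj (z k)))" for j k
    by (intro integrable_mult_left integrable_of_real cint)
  have fs: "(\<Sum>j<N. \<Sum>k<N. complex_of_real (cos ((x j - x k) \<bullet> y) * F (norm y)) * (z j * cnj (z k))) = of_real (H y * F (norm y))" for y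
  proof -
    have "(\<Sum>j<N. \<Sum>k<N. complex_of_real (cos ((x j - x k) \<bullet> y) * F (norm y)) * (z j * cnj (z k)))
      = (\<Sum>j<N. \<Sum>k<N. of_real (cos ((x j - x k) \<bullet> y)) * z j * cnj (z k)) * of_real (F (norm y))"
      unfolding sum_distrib_right of_real_mult by (intro sum.cong refl) (simp only: mult_ac)
    thus ?thesis unfolding Hsum by simp
  qed
  have ciH: "integrable lborel (\<lambda>y. complex_of_real (H y * F (norm y)))"
    unfolding fs[symmetric] by (intro Bochner_Integration.integrable_sum ci)
  hence HF: "integrable lborel (\<lambda>y. H y * F (norm y))" by (simp only: complex_of_real_integrable_eq)
  have "(\<Sum>j<N. \<Sum>k<N. complex_of_real (\<phi> (norm (x j - x k))) * z j * cnj (z k))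
    = of_real c * (\<Sum>j<N. \<Sum>k<N. (LINT y|lborel. complex_of_real (cos ((x j - x k) \<bullet> y) * F (norm y)) * (z j * cnj (z k))))"
    unfolding \<phi> sum_distrib_left
  proof (intro sum.cong refl)
    fix j k
    show "complex_of_real (c * (LINT y|lborel. cos ((x j - x k) \<bullet> y) * F (norm y))) * z j * cnj (z k)
      = of_real c * (LINT y|lborel. complex_of_real (cos ((x j - x k) \<bullet> y) * F (norm y)) * (z j * cnj (z k)))"
      unfolding integral_mult_left_zero integral_complex_of_real by simp
  qed
  also have "\<dots> = of_real c * (LINT y|lborel. complex_of_real (H y * F (norm y)))"
    unfolding fs[symmetric] by (subst Bochner_Integration.integral_sum, intro Bochner_Integration.integrable_sum ci)
      (intro arg_cong2[where f = "(*)"] refl sum.cong Bochner_Integration.integral_sum[symmetric] ci)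
  also have "\<dots> = of_real (c * (LINT y|lborel. H y * F (norm y)))"
    unfolding integral_complex_of_real by simp
  finally have sum: "(\<Sum>j<N. \<Sum>k<N. complex_of_real (\<phi> (norm (x j - x k))) * z j * cnj (z k))
     = of_real (c * (LINT y|lborel. H y * F (norm y)))" .
  have nn: "0 \<le> H y * F (norm y)" for y using H0 nonneg by simp
  have "0 \<le> (LINT y|lborel. H y * F (norm y))" using nn by (intro Bochner_Integration.integral_nonneg)
  hence 1: "(\<Sum>j<N. \<Sum>k<N. complex_of_real (\<phi> (norm (x j - x k))) * z j * cnj (z k)) \<in> \<real>\<^sub>\<ge>\<^sub>0"
    unfolding sum using c by (simp only: nonneg_Reals_of_real_iff) simp
  have 2: "\<forall>j<N. z j = 0" if "(\<Sum>j<N. \<Sum>k<N. complex_of_real (\<phi> (norm (x j - x k))) * z j * cnj (z k)) = 0"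
  proof -
    have "(LINT y|lborel. H y * F (norm y)) = 0" using that c unfolding sum of_real_eq_0_iff by simp
    hence "AE y in lborel. H y * F (norm y) = 0"
      using integral_nonneg_eq_0_iff_AE[OF HF] nn by simp
    hence AE0: "AE y in lborel. y \<notin> {y. norm y < r \<and> 0 < H y}"
    proof eventually_elim
      fix y assume "H y * F (norm y) = 0"
      thus "y \<notin> {y. norm y < r \<and> 0 < H y}" using r(2)[of "norm y"] by auto
    qed
    \<comment> \<open>A null open set is empty, so vanishing almost everywhere improves to vanishing
      at every point of the ball.\<close>
    have op: "open {y. norm y < r \<and> 0 < H y}"
      by (intro open_Collect_conj open_Collect_less continuous_intros cH)
    have "emeasure lborel {y. norm y < r \<and> 0 < H y} = 0"
      using AE0 op by (subst (asm) AE_iff_measurable[of "{y. norm y < r \<and> 0 < H y}"]) auto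
    hence "negligible {y. norm y < r \<and> 0 < H y}"
      using op by (simp add: negligible_iff_emeasure0)
    hence "{y. norm y < r \<and> 0 < H y} = {}" using op open_not_negligible by blast
    hence H: "H y = 0" if "norm y < r" for y using that H0[of y] by (auto simp: less_le)
    have "(\<Sum>j<N. z j * exp (\<i> * of_real (x j \<bullet> y))) = 0" if "norm y < r" for y
    proof -
      have "C y = 0" "S y = 0" using H[OF that] by (auto simp: H_def add_nonneg_eq_0_iff)
      moreover have "(\<Sum>j<N. z j * exp (\<i> * of_real (x j \<bullet> y))) = C y + \<i> * S y"
        unfolding C_def S_def sum_distrib_left sum.distrib[symmetric]
        by (intro sum.cong refl) (simp add: cis_conv_exp[symmetric] complex_eq_iff)
      ultimately show ?thesis by simp
    qed
    thus ?thesis using exponentials_independent[of "{..<N}" x r z] inj r(1) by simp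
  qed
  show "(\<Sum>j<N. \<Sum>k<N. complex_of_real (\<phi> (norm (x j - x k))) * z j * cnj (z k)) \<in> \<real>\<^sub>\<ge>\<^sub>0 \<and>
    ((\<Sum>j<N. \<Sum>k<N. complex_of_real (\<phi> (norm (x j - x k))) * z j * cnj (z k)) = 0 \<longrightarrow> (\<forall>j<N. z j = 0))"
    using 1 2 by blast
qed

subsection \<open>Positivity\<close>

text \<open>With c = a + n - 1 one has (c choose i) = (a)_n / ((a)_(n-i) i!), and the sum becomes
  Vandermonde's convolution for the binomial coefficient of 2c over n.\<close>

lemma pochhammer_Vandermonde:
  fixes a :: real
  assumes a: "0 < a"
  shows "(\<Sum>i\<le>n. 1 / (fact i * fact (n - i) * pochhammer a i * pochhammer a (n - i)))
    = pochhammer (2 * a + real n - 1) n / (fact n * (pochhammer a n)\<^sup>2)"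
proof -
  define c where "c = a + real n - 1"
  have p: "0 < pochhammer a k" for k using a by (rule pochhammer_pos)
  have g: "c gchoose i = pochhammer a n / (pochhammer a (n - i) * fact i)" if "i \<le> n" for i
  proof -
    have "c gchoose i = pochhammer (c - real i + 1) i / fact i" by (rule gbinomial_pochhammer')
    also have "c - real i + 1 = a + real (n - i)" using that by (simp add: c_def of_nat_diff)
    also have "pochhammer (a + real (n - i)) i = pochhammer a n / pochhammer a (n - i)"
      using pochhammer_product[of "n - i" n a] that p[of "n - i"] by simp
    finally show ?thesis by simp
  qed
  have "(\<Sum>i\<le>n. 1 / (fact i * fact (n - i) * pochhammer a i * pochhammer a (n - i)))
     = (\<Sum>i\<le>n. (c gchoose i) * (c gchoose (n - i)) / (pochhammer a n)\<^sup>2)"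
  proof (intro sum.cong refl)
    fix i assume "i \<in> {..n}"
    hence i: "i \<le> n" by simp
    show "1 / (fact i * fact (n - i) * pochhammer a i * pochhammer a (n - i)) = (c gchoose i) * (c gchoose (n - i)) / (pochhammer a n)\<^sup>2"
      using g[OF i] g[of "n - i"] i p[of n] by (simp add: power2_eq_square)
  qed
  also have "\<dots> = (\<Sum>i\<le>n. (c gchoose i) * (c gchoose (n - i))) / (pochhammer a n)\<^sup>2"
    by (rule sum_divide_distrib[symmetric])
  also have "(\<Sum>i\<le>n. (c gchoose i) * (c gchoose (n - i))) = (c + c) gchoose n"
    using gbinomial_Vandermonde[of c c n] by (simp add: atLeast0AtMost)
  also have "\<dots> = pochhammer (2 * a + real n - 1) n / fact n"
    unfolding gbinomial_pochhammer' by (simp add: c_def algebra_simps)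
  finally show ?thesis by simp
qed

text \<open>The coefficients of 1F2(delta; 2 delta, delta + 1/2; -t^2/4). They differ from those of
  \<open>Q\<close> only in one lower parameter, delta + 1/2 instead of 2 delta + 1/2.\<close>

definition square_coeff :: "real \<Rightarrow> nat \<Rightarrow> real" where
  "square_coeff \<delta> k = (- 1) ^ k * pochhammer \<delta> k / (4 ^ k * fact k * pochhammer (2 * \<delta>) k * pochhammer (\<delta> + 1 / 2) k)"

lemma abs_square_coeff_le:
  assumes "0 < \<delta>"
  shows "\<bar>square_coeff \<delta> k\<bar> \<le> 1 / fact (2 * k)"
proof -
  have p: "0 < pochhammer \<delta> k" "pochhammer \<delta> k \<le> pochhammer (2 * \<delta>) k" "0 < pochhammer (2 * \<delta>) k"
    using assms by (auto intro!: pochhammer_pos pochhammer_mono)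
  have "square_coeff \<delta> k = (pochhammer \<delta> k / pochhammer (2 * \<delta>) k) * ((- 1) ^ k / (4 ^ k * fact k * pochhammer (\<delta> + 1 / 2) k))"
    by (simp add: square_coeff_def mult_ac)
  also have "\<bar>\<dots>\<bar> \<le> 1 * (1 / fact (2 * k))"
    unfolding abs_mult using p assms by (intro mult_mono abs_coeff_le pochhammer_mono) auto
  finally show ?thesis by simp
qed

text \<open>In the Cauchy product the inner sum is \<open>pochhammer_Vandermonde\<close> with a =
  delta + 1/2. It yields (2 delta + k)_k, which is (2 delta)_2k / (2 delta)_k and splits by
  duplication.\<close>

lemma Omega_square:
  assumes \<delta>: "0 < \<delta>"
  shows "even_series (square_coeff \<delta>) t = (Omega (\<delta> - 1 / 2) (t / 2))\<^sup>2"
proof -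
  let ?o = "Omega_coeff (\<delta> - 1 / 2)"
  have nu: "- 1 / 2 \<le> \<delta> - 1 / 2" using \<delta> by simp
  let ?f = "\<lambda>k. ?o k * (t / 2) ^ (2 * k)"
  have sm: "summable (\<lambda>k. norm (?f k))"
    using summable_even_series_abs[OF abs_Omega_coeff_le[OF nu], of "t / 2"] by simp
  have p: "0 < pochhammer \<delta> k" "0 < pochhammer (\<delta> + 1 / 2) k" "0 < pochhammer (2 * \<delta>) k" for k
    using \<delta> by (auto intro!: pochhammer_pos)
  have "(\<Sum>i\<le>k. ?f i * ?f (k - i)) = square_coeff \<delta> k * t ^ (2 * k)" for k
  proof -
    have "(\<Sum>i\<le>k. ?f i * ?f (k - i)) = (\<Sum>i\<le>k. (- 1) ^ k * t ^ (2 * k) / (4 ^ k * 4 ^ k) *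
        (1 / (fact i * fact (k - i) * pochhammer (\<delta> + 1 / 2) i * pochhammer (\<delta> + 1 / 2) (k - i))))"
    proof (intro sum.cong refl)
      fix i assume "i \<in> {..k}"
      hence i: "k = i + (k - i)" by simp
      have s: "q ^ k = q ^ i * q ^ (k - i)" for q :: real by (subst i) (rule power_add)
      have "(t / 2) ^ (2 * j) = (t\<^sup>2) ^ j / 4 ^ j" for j by (simp add: power_mult power_divide)
      moreover have "t ^ (2 * k) = (t\<^sup>2) ^ k" by (simp add: power_mult)
      moreover have "\<delta> - 1 / 2 + 1 = \<delta> + 1 / 2" by simp
      ultimately show "?f i * ?f (k - i) = (- 1) ^ k * t ^ (2 * k) / (4 ^ k * 4 ^ k) *
        (1 / (fact i * fact (k - i) * pochhammer (\<delta> + 1 / 2) i * pochhammer (\<delta> + 1 / 2) (k - i)))"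
        unfolding Omega_coeff_def by (simp only: s[of "- 1"] s[of "t\<^sup>2"] s[of 4]) (simp add: mult_ac)
    qed
    also have "\<dots> = (- 1) ^ k * t ^ (2 * k) / (4 ^ k * 4 ^ k) * (pochhammer (2 * (\<delta> + 1 / 2) + real k - 1) k / (fact k * (pochhammer (\<delta> + 1 / 2) k)\<^sup>2))"
      unfolding sum_distrib_left[symmetric] using \<delta> by (subst pochhammer_Vandermonde) auto
    also have "2 * (\<delta> + 1 / 2) + real k - 1 = 2 * \<delta> + real k" by simp
    also have "pochhammer (2 * \<delta> + real k) k = 4 ^ k * pochhammer \<delta> k * pochhammer (\<delta> + 1 / 2) k / pochhammer (2 * \<delta>) k"
    proof -
      have "pochhammer (2 * \<delta>) k * pochhammer (2 * \<delta> + real k) k = pochhammer (2 * \<delta>) (2 * k)"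
        using pochhammer_product[of k "2 * k" "2 * \<delta>"] by simp
      also have "\<dots> = 4 ^ k * pochhammer \<delta> k * pochhammer (\<delta> + 1 / 2) k"
        unfolding pochhammer_double by (simp add: power_mult)
      finally show ?thesis using p(3)[of k] by (simp add: field_simps)
    qed
    finally show ?thesis using p(2)[of k] by (simp add: square_coeff_def power2_eq_square mult_ac)
  qed
  hence "(\<lambda>k. square_coeff \<delta> k * t ^ (2 * k)) sums ((\<Sum>k. ?f k) * (\<Sum>k. ?f k))"
    using Cauchy_product_sums[OF sm sm] by simp
  moreover have "(\<Sum>k. ?f k) = Omega (\<delta> - 1 / 2) (t / 2)"
    unfolding Omega_eq_even_series[OF nu] even_series_def ..
  ultimately show ?thesis by (simp add: even_series_def sums_iff power2_eq_square)
qed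

text \<open>The even moments of the weight are Beta(delta + 1/2 + k, delta)/2, which exchange the
  lower parameter delta + 1/2 for 2 delta + 1/2.\<close>

lemma Q_square_integral:
  assumes \<delta>: "0 < \<delta>"
  shows "has_bochner_integral lborel
     (\<lambda>t. (Omega (\<delta> - 1 / 2) (r * t / 2))\<^sup>2 * (indicat_real {0..1} t * (t powr (2 * \<delta>) * (1 - t\<^sup>2) powr (\<delta> - 1))))
     (Beta (\<delta> + 1 / 2) \<delta> / 2 * Q \<delta> r)"
proof -
  define w where "w = (\<lambda>t. indicat_real {0..1} t * (t powr (2 * \<delta>) * (1 - t\<^sup>2) powr (\<delta> - 1)))"
  have "has_bochner_integral lborel (\<lambda>t. even_series (square_coeff \<delta>) (r * t) * w t)
     (Beta (\<delta> + 1 / 2) \<delta> / 2 * even_series (Q_coeff \<delta>) (r * 1))"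
  proof (rule even_series_moments)
    fix k
    have "has_bochner_integral lborel
      (\<lambda>t. indicat_real {0..1} t * (t powr (2 * (\<delta> + 1 / 2 + real k) - 1) * (1\<^sup>2 - t\<^sup>2) powr (\<delta> - 1)))
      (1 powr (2 * (\<delta> + 1 / 2 + real k) + 2 * \<delta> - 2) * Beta (\<delta> + 1 / 2 + real k) \<delta> / 2)"
      by (rule has_bochner_integral_Beta_square) (use \<delta> in auto)
    moreover have "indicat_real {0..1} t * (t powr (2 * (\<delta> + 1 / 2 + real k) - 1) * (1\<^sup>2 - t\<^sup>2) powr (\<delta> - 1)) = t ^ (2 * k) * w t" for t
    proof (cases "t = 0")
      case False
      have ex: "2 * (\<delta> + 1 / 2 + real k) - 1 = 2 * \<delta> + real (2 * k)" by simp
      have "t powr (2 * (\<delta> + 1 / 2 + real k) - 1) = t powr (2 * \<delta>) * t ^ (2 * k)" if "0 < t"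
        unfolding ex powr_add by (simp only: powr_realpow[OF that])
      thus ?thesis using False by (cases "0 < t") (simp_all add: w_def indicator_def)
    qed (simp add: w_def)
    ultimately show "has_bochner_integral lborel (\<lambda>t. t ^ (2 * k) * w t) (Beta (\<delta> + 1 / 2 + real k) \<delta> / 2)"
      by simp
    have p: "0 < pochhammer (\<delta> + 1 / 2) k" using \<delta> by (auto intro!: pochhammer_pos)
    have e: "\<delta> + 1 / 2 + \<delta> = 2 * \<delta> + 1 / 2" by simp
    have "Beta (\<delta> + 1 / 2 + real k) \<delta> = Beta (\<delta> + 1 / 2) \<delta> * pochhammer (\<delta> + 1 / 2) k / pochhammer (2 * \<delta> + 1 / 2) k"
      using Beta_shift[of "\<delta> + 1 / 2" \<delta> k] \<delta> unfolding e by simp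
    thus "square_coeff \<delta> k * (Beta (\<delta> + 1 / 2 + real k) \<delta> / 2) = Beta (\<delta> + 1 / 2) \<delta> / 2 * (Q_coeff \<delta> k * 1 ^ (2 * k))"
      using p by (simp add: square_coeff_def Q_coeff_def mult_ac)
    show "\<bar>square_coeff \<delta> k\<bar> \<le> 1 / fact (2 * k)" "\<bar>Q_coeff \<delta> k\<bar> \<le> 1 / fact (2 * k)"
      by (rule abs_square_coeff_le[OF \<delta>], rule abs_Q_coeff_le[OF \<delta>])
  next
    show "\<bar>t\<bar> \<le> 1" if "w t \<noteq> 0" for t using that by (auto simp: w_def indicator_def split: if_splits)
  qed
  thus ?thesis by (simp add: Omega_square[OF \<delta>] Q_eq_even_series w_def)
qed

text \<open>The integrand is a square times a nonnegative weight. It is strictly positive on some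
  interval (0, b), because \<open>Omega\<close> is continuous with value 1 at 0; hence the integral
  cannot vanish.\<close>

lemma Q_pos:
  assumes \<delta>: "0 < \<delta>"
  shows "0 < Q \<delta> r"
proof -
  let ?O = "Omega (\<delta> - 1 / 2)"
  let ?f = "\<lambda>t. (?O (r * t / 2))\<^sup>2 * (indicat_real {0..1} t * (t powr (2 * \<delta>) * (1 - t\<^sup>2) powr (\<delta> - 1)))"
  have nu: "- 1 / 2 \<le> \<delta> - 1 / 2" using \<delta> by simp
  have B: "0 < Beta (\<delta> + 1 / 2) \<delta>" using \<delta> by (intro Beta_pos) auto
  have int: "integrable lborel ?f" and val: "(LINT t|lborel. ?f t) = Beta (\<delta> + 1 / 2) \<delta> / 2 * Q \<delta> r"
    using Q_square_integral[OF \<delta>, of r] by (simp_all add: has_bochner_integral_iff)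
  have nn: "AE t in lborel. 0 \<le> ?f t" by (auto simp: indicator_def)
  have "(LINT t|lborel. ?f t) \<noteq> 0"
  proof
    assume "(LINT t|lborel. ?f t) = 0"
    hence ae: "AE t in lborel. ?f t = 0" using integral_nonneg_eq_0_iff_AE[OF int nn] by simp
    have "isCont (\<lambda>t. ?O (r * t / 2)) 0"
      by (rule isCont_o2[where f = "\<lambda>t. r * t / 2" and g = ?O, OF _ isCont_Omega[OF nu]]) (intro continuous_intros, simp)
    moreover have "?O (r * 0 / 2) = 1" using Omega_0[OF nu] by simp
    ultimately have "((\<lambda>t. ?O (r * t / 2)) \<longlongrightarrow> 1) (at 0)" by (simp add: isCont_def)
    hence "\<forall>\<^sub>F t in at 0. 0 < ?O (r * t / 2)" by (rule order_tendstoD) simp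
    then obtain e where e: "0 < e" "\<And>t. t \<noteq> 0 \<Longrightarrow> dist t 0 < e \<Longrightarrow> 0 < ?O (r * t / 2)"
      unfolding eventually_at by blast
    define b where "b = min e 1"
    have b: "0 < b" "b \<le> e" "b \<le> 1" using e by (auto simp: b_def)
    from ae have "AE t in lborel. t \<notin> {0<..<b}"
    proof eventually_elim
      fix t assume z: "?f t = 0"
      show "t \<notin> {0<..<b}"
      proof
        assume t: "t \<in> {0<..<b}"
        hence "0 < ?O (r * t / 2)" using e(2)[of t] b by (auto simp: dist_real_def)
        moreover have "t\<^sup>2 < 1" using t b by (simp add: power_less_one_iff abs_square_less_1)
        ultimately show False using z t b by (auto simp: indicator_def)
      qed
    qed
    hence "emeasure lborel {0<..<b} = 0" by (subst (asm) AE_iff_measurable[of "{0<..<b}"]) auto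
    thus False using b by simp
  qed
  moreover have "0 \<le> (LINT t|lborel. ?f t)" by (rule integral_nonneg_AE[OF nn])
  ultimately have "0 < Beta (\<delta> + 1 / 2) \<delta> / 2 * Q \<delta> r" unfolding val by linarith
  thus ?thesis using B by (simp add: zero_less_mult_iff)
qed

subsection \<open>Shifting a contour in a half strip\<close>

text \<open>Cauchy's theorem on a rectangle. The top side is only estimated, since it disappears
  when T grows.\<close>

lemma rectangle_integral_bound:
  fixes G :: "complex \<Rightarrow> complex"
  assumes a: "0 < a" and T: "0 < T" and hol: "G holomorphic_on cbox 0 (Complex a T)"
    and K: "\<And>x. 0 \<le> x \<Longrightarrow> x \<le> a \<Longrightarrow> cmod (G (Complex x T)) \<le> K"
  shows "cmod (integral {0..a} (\<lambda>t. G (of_real t)) + \<i> * integral {0..T} (\<lambda>y. G (Complex a y))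
      - \<i> * integral {0..T} (\<lambda>y. G (Complex 0 y))) \<le> K * a"
proof -
  let ?R = "cbox 0 (Complex a T)"
  let ?l1 = "linepath 0 (Complex a 0)" and ?l2 = "linepath (Complex a 0) (Complex a T)"
    and ?l3 = "linepath (Complex a T) (Complex 0 T)" and ?l4 = "linepath (Complex 0 T) 0"
  have cont: "continuous_on ?R G" by (rule holomorphic_on_imp_continuous_on[OF hol])
  have R: "z \<in> ?R \<longleftrightarrow> 0 \<le> Re z \<and> Re z \<le> a \<and> 0 \<le> Im z \<and> Im z \<le> T" for z
    by (auto simp: in_cbox_complex_iff)
  have pts: "0 \<in> ?R" "Complex a 0 \<in> ?R" "Complex a T \<in> ?R" "Complex 0 T \<in> ?R" using a T by (auto simp: R)
  have seg: "closed_segment u v \<subseteq> ?R" if "u \<in> ?R" "v \<in> ?R" for u v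
    using that by (intro closed_segment_subset convex_box)
  have ci: "G contour_integrable_on linepath u v" if "u \<in> ?R" "v \<in> ?R" for u v
    by (rule contour_integrable_continuous_linepath[OF continuous_on_subset[OF cont seg[OF that]]])
  have rp: "rectpath 0 (Complex a T) = ?l1 +++ ?l2 +++ ?l3 +++ ?l4"
    by (simp add: rectpath_def Let_def complex_eq_iff)
  have "(G has_contour_integral 0) (rectpath 0 (Complex a T))"
  proof (rule Cauchy_theorem_convex_simple[OF hol])
    show "path_image (rectpath 0 (Complex a T)) \<subseteq> ?R"
      by (rule path_image_rectpath_subset_cbox) (use a T in auto)
  qed (auto intro: convex_box)
  hence "contour_integral (?l1 +++ ?l2 +++ ?l3 +++ ?l4) G = 0"
    unfolding rp by (rule contour_integral_unique)
  moreover have "contour_integral (?l1 +++ ?l2 +++ ?l3 +++ ?l4) G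
     = contour_integral ?l1 G + (contour_integral ?l2 G + (contour_integral ?l3 G + contour_integral ?l4 G))"
    using ci pts by (simp add: valid_path_join contour_integrable_joinI)
  ultimately have sum: "contour_integral ?l1 G + (contour_integral ?l2 G + (contour_integral ?l3 G + contour_integral ?l4 G)) = 0"
    by simp
  have r: "Complex a 0 = of_real a" by (simp add: complex_eq_iff)
  have 1: "contour_integral ?l1 G = integral {0..a} (\<lambda>t. G (of_real t))"
    unfolding r using a by (subst contour_integral_linepath_Reals_eq) auto
  have 2: "contour_integral ?l2 G = \<i> * integral {0..T} (\<lambda>y. G (Complex a y))"
    using T by (intro contour_integral_linepath_same_Re) auto
  have "contour_integral ?l4 G = - contour_integral (linepath 0 (Complex 0 T)) G"
    by (intro contour_integral_reverse_linepath continuous_on_subset[OF cont seg] pts)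
  moreover have "contour_integral (linepath 0 (Complex 0 T)) G = \<i> * integral {0..T} (\<lambda>y. G (Complex 0 y))"
    using T by (intro contour_integral_linepath_same_Re) auto
  ultimately have 4: "contour_integral ?l4 G = - (\<i> * integral {0..T} (\<lambda>y. G (Complex 0 y)))" by simp
  have "cmod (contour_integral ?l3 G) \<le> K * cmod (Complex 0 T - Complex a T)"
  proof (rule contour_integral_bound_linepath[OF ci])
    show "0 \<le> K" using K[of 0] a order_trans[OF norm_ge_zero] by auto
    fix z assume "z \<in> closed_segment (Complex a T) (Complex 0 T)"
    hence "z \<in> closed_segment (Complex 0 T) (Complex a T)" by (simp add: closed_segment_commute)
    hence "Re z \<in> closed_segment 0 a" "Im z = T"
      using a closed_segment_same_Im[of "Complex 0 T" "Complex a T"] by auto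
    hence "z = Complex (Re z) T" "0 \<le> Re z" "Re z \<le> a" using a by (auto simp: complex_eq_iff closed_segment_eq_real_ivl)
    thus "cmod (G z) \<le> K" using K[of "Re z"] by metis
  qed (use pts in auto)
  also have "cmod (Complex 0 T - Complex a T) = a" using a by (simp add: cmod_def)
  finally have 3: "cmod (contour_integral ?l3 G) \<le> K * a" .
  have "integral {0..a} (\<lambda>t. G (of_real t)) + \<i> * integral {0..T} (\<lambda>y. G (Complex a y))
      - \<i> * integral {0..T} (\<lambda>y. G (Complex 0 y)) = - contour_integral ?l3 G"
    using sum unfolding 1 2 4 by (simp add: algebra_simps add_eq_0_iff)
  thus ?thesis using 3 by simp
qed

text \<open>The corner \<open>s\<close> may be a singularity of \<open>G\<close>; the rectangles below avoid it.\<close>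

lemma
  fixes G :: "complex \<Rightarrow> complex" and b :: "real \<Rightarrow> real"
  assumes s: "0 < s"
    and diff: "\<And>z. 0 \<le> Re z \<Longrightarrow> Re z \<le> s \<Longrightarrow> 0 \<le> Im z \<Longrightarrow> z \<noteq> of_real s \<Longrightarrow> G field_differentiable (at z)"
    and bd: "\<And>x y. 0 \<le> x \<Longrightarrow> x \<le> s \<Longrightarrow> 0 < y \<Longrightarrow> cmod (G (Complex x y)) \<le> b y"
    and b: "set_integrable lborel {0<..} b" and lim: "(b \<longlongrightarrow> 0) at_top"
    and G: "set_integrable lborel {0..s} (\<lambda>t. G (of_real t))"
  shows half_strip_integrable: "\<And>x. x = 0 \<or> x = s \<Longrightarrow> set_integrable lborel {0<..} (\<lambda>y. G (Complex x y))"
    and half_strip_shift: "(CLINT t:{0..s}|lborel. G (of_real t))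
      = \<i> * (CLINT y:{0<..}|lborel. G (Complex 0 y)) - \<i> * (CLINT y:{0<..}|lborel. G (Complex s y))"
proof -
  have cG: "isCont G z" if "0 \<le> Re z" "Re z \<le> s" "0 \<le> Im z" "z \<noteq> of_real s" for z
    by (rule field_differentiable_imp_continuous_at[OF diff[OF that]])
  have cI: "isCont (\<lambda>y. Complex x y) y" for x y by (simp add: Complex_eq)
  have cont_edge: "continuous_on {0<..} (\<lambda>y. G (Complex x y))" if "0 \<le> x" "x \<le> s" for x
    using that by (intro continuous_at_imp_continuous_on ballI isCont_o2[OF cI cG]) (auto simp: complex_eq_iff)
  have meas: "(\<lambda>y. indicator {0<..} y *\<^sub>R G (Complex x y)) \<in> borel_measurable borel" if "0 \<le> x" "x \<le> s" for x
    by (rule borel_measurable_continuous_on_indicator[OF _ cont_edge[OF that]]) simp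
  have dom: "norm (indicator {0<..} y *\<^sub>R G (Complex x y)) \<le> norm (indicat_real {0<..} y *\<^sub>R b y)" if "0 \<le> x" "x \<le> s" for x y
    using bd[OF that, of y] by (auto simp: indicator_def intro: order_trans[OF _ abs_ge_self])
  have edge_int: "integrable lborel (\<lambda>y. indicator {0<..} y *\<^sub>R G (Complex x y))" if "0 \<le> x" "x \<le> s" for x
    by (rule Bochner_Integration.integrable_bound[OF b[unfolded set_integrable_def]]) (use meas that dom in auto)
  show "set_integrable lborel {0<..} (\<lambda>y. G (Complex x y))" if "x = 0 \<or> x = s" for x
    unfolding set_integrable_def using that s by (intro edge_int) auto
  \<comment> \<open>Rectangles whose right side stays strictly left of s and converges to it. The
    denominator n + 2 makes the width positive already for n = 0.\<close>
  define a where "a = (\<lambda>n::nat. s - s / (real n + 2))"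
  define T where "T = (\<lambda>n::nat. real n + 1)"
  have a: "0 < a n" "a n < s" for n using s by (auto simp: a_def field_simps add_pos_nonneg)
  have a_lim: "a \<longlonglongrightarrow> s" unfolding a_def by real_asymp
  have T: "0 < T n" for n by (simp add: T_def)
  have T_lim: "filterlim T at_top sequentially" unfolding T_def by real_asymp
  have holo: "G holomorphic_on cbox 0 (Complex (a n) (T n))" for n
    unfolding holomorphic_on_def
  proof (rule ballI, rule field_differentiable_at_within, rule diff)
    fix z assume "z \<in> cbox 0 (Complex (a n) (T n))"
    hence "0 \<le> Re z" "Re z \<le> a n" "0 \<le> Im z" by (auto simp: in_cbox_complex_iff)
    thus "0 \<le> Re z" "Re z \<le> s" "0 \<le> Im z" "z \<noteq> of_real s" using a[of n] by auto
  qed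
  have cI1: "continuous_on {0..a n} (\<lambda>t. G (of_real t))" for n
    using a[of n] by (intro continuous_at_imp_continuous_on ballI isCont_o2[OF _ cG]) auto
  have cI2: "continuous_on {0..T n} (\<lambda>y. G (Complex x y))" if "x = 0 \<or> x = a n" for n x
    using that a[of n] s by (intro continuous_at_imp_continuous_on ballI isCont_o2[OF cI cG]) (auto simp: complex_eq_iff)
  have e1: "integral {0..a n} (\<lambda>t. G (of_real t)) = (CLINT t:{0..a n}|lborel. G (of_real t))" for n
    by (rule set_borel_integral_eq_integral(2)[symmetric, OF borel_integrable_atLeastAtMost'[OF cI1]])
  \<comment> \<open>The point y = 0 is dropped because the majorant \<open>b\<close> is given for y
    > 0 only and may be unbounded at 0.\<close>
  have e2: "integral {0..T n} (\<lambda>y. G (Complex x y)) = (CLINT y:{0<..T n}|lborel. G (Complex x y))" if "x = 0 \<or> x = a n" for n x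
  proof -
    have c: "continuous_on {0..T n} (\<lambda>y. G (Complex x y))" by (rule cI2[OF that])
    have i: "set_integrable lborel {0..T n} (\<lambda>y. G (Complex x y))" by (rule borel_integrable_atLeastAtMost'[OF c])
    have "(CLINT y:{0<..T n}|lborel. G (Complex x y)) = integral {0<..T n} (\<lambda>y. G (Complex x y))"
      by (rule set_borel_integral_eq_integral(2)) (rule set_integrable_subset[OF i], auto)
    also have "\<dots> = integral {0..T n} (\<lambda>y. G (Complex x y))"
      by (rule integral_subset_negligible) (auto intro: negligible_subset[of "{0}"])
    finally show ?thesis by simp
  qed
  let ?S = "\<lambda>n. (CLINT t:{0..a n}|lborel. G (of_real t)) + \<i> * (CLINT y:{0<..T n}|lborel. G (Complex (a n) y))
      - \<i> * (CLINT y:{0<..T n}|lborel. G (Complex 0 y))"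
  have nb: "\<forall>n. cmod (?S n) \<le> b (T n) * a n"
  proof
    fix n
    show "cmod (?S n) \<le> b (T n) * a n"
      using rectangle_integral_bound[OF a(1) T holo, of n "b (T n)"] bd a[of n] T[of n]
      unfolding e1 by (simp add: e2)
  qed
  \<comment> \<open>The top sides vanish in the limit. That \<open>b\<close> does not depend on x
    serves here and again in the convergence of the moving right sides.\<close>
  have "(\<lambda>n. b (T n) * a n) \<longlonglongrightarrow> 0 * s"
    by (intro tendsto_mult a_lim filterlim_compose[OF lim T_lim])
  hence S0: "?S \<longlonglongrightarrow> 0"
    unfolding mult_zero_left by (rule Lim_null_comparison[OF always_eventually[OF nb]])
  have null: "AE t in lborel. t \<noteq> s" by (rule AE_lborel_singleton)
  have L1: "(\<lambda>n. CLINT t:{0..a n}|lborel. G (of_real t)) \<longlonglongrightarrow> (CLINT t:{0..s}|lborel. G (of_real t))"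
    unfolding set_lebesgue_integral_def
  proof (rule integral_dominated_convergence[where w = "\<lambda>t. norm (indicator {0..s} t *\<^sub>R G (of_real t))"])
    show "AE t in lborel. (\<lambda>n. indicat_real {0..a n} t *\<^sub>R G (of_real t)) \<longlonglongrightarrow> indicat_real {0..s} t *\<^sub>R G (of_real t)"
      using null
    proof eventually_elim
      fix t assume t: "t \<noteq> s"
      show "(\<lambda>n. indicat_real {0..a n} t *\<^sub>R G (of_real t)) \<longlonglongrightarrow> indicat_real {0..s} t *\<^sub>R G (of_real t)"
      proof (cases "t < s")
        case True
        have "\<forall>\<^sub>F n in sequentially. t < a n" using order_tendstoD(1)[OF a_lim True] .
        hence "\<forall>\<^sub>F n in sequentially. indicat_real {0..a n} t *\<^sub>R G (of_real t) = indicat_real {0..s} t *\<^sub>R G (of_real t)"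
          by eventually_elim (use True in \<open>auto simp: indicator_def\<close>)
        thus ?thesis by (rule tendsto_eventually)
      next
        case False
        hence "indicat_real {0..a n} t = indicat_real {0..s} t" for n using a[of n] t by (auto simp: indicator_def)
        thus ?thesis by simp
      qed
    qed
    show "AE t in lborel. norm (indicat_real {0..a n} t *\<^sub>R G (of_real t)) \<le> norm (indicator {0..s} t *\<^sub>R G (of_real t))" for n
      using a[of n] by (intro AE_I2) (auto simp: indicator_def)
    show "(\<lambda>t. indicat_real {0..a n} t *\<^sub>R G (of_real t)) \<in> borel_measurable lborel" for n
      using borel_measurable_continuous_on_indicator[OF _ cI1[of n]] by simp
    show "integrable lborel (\<lambda>t. norm (indicator {0..s} t *\<^sub>R G (of_real t)))"
      by (rule integrable_norm[OF G[unfolded set_integrable_def]])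
    show "(\<lambda>t. indicat_real {0..s} t *\<^sub>R G (of_real t)) \<in> borel_measurable lborel"
      by (rule borel_measurable_integrable[OF G[unfolded set_integrable_def]])
  qed
  have L2: "(\<lambda>n. CLINT y:{0<..T n}|lborel. G (Complex (x n) y)) \<longlonglongrightarrow> (CLINT y:{0<..}|lborel. G (Complex u y))"
    if x: "\<And>n. 0 \<le> x n" "\<And>n. x n \<le> s" "x \<longlonglongrightarrow> u" "0 \<le> u" "u \<le> s" for x u
    unfolding set_lebesgue_integral_def
  proof (rule integral_dominated_convergence[where w = "\<lambda>y. norm (indicat_real {0<..} y *\<^sub>R b y)"])
    have ind: "indicat_real {0<..T n} y *\<^sub>R G (Complex v y) = indicat_real {..T n} y *\<^sub>R (indicator {0<..} y *\<^sub>R G (Complex v y))" for n y v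
      by (auto simp: indicator_def)
    show "(\<lambda>y. indicat_real {0<..T n} y *\<^sub>R G (Complex (x n) y)) \<in> borel_measurable lborel" for n
    proof -
      have "(\<lambda>y. indicat_real {..T n} y *\<^sub>R (indicator {0<..} y *\<^sub>R G (Complex (x n) y))) \<in> borel_measurable borel"
        by (rule borel_measurable_scaleR[OF _ meas[OF x(1,2)]]) simp
      thus ?thesis unfolding ind by (simp only: measurable_lborel2)
    qed
    show "AE y in lborel. norm (indicat_real {0<..T n} y *\<^sub>R G (Complex (x n) y)) \<le> norm (indicat_real {0<..} y *\<^sub>R b y)" for n
      using dom[OF x(1,2), of n n] by (intro AE_I2 order_trans[OF _ dom[OF x(1,2)]]) (auto simp: indicator_def)
    show "AE y in lborel. (\<lambda>n. indicat_real {0<..T n} y *\<^sub>R G (Complex (x n) y)) \<longlonglongrightarrow> indicat_real {0<..} y *\<^sub>R G (Complex u y)"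
    proof (rule AE_I2)
      fix y :: real
      show "(\<lambda>n. indicat_real {0<..T n} y *\<^sub>R G (Complex (x n) y)) \<longlonglongrightarrow> indicat_real {0<..} y *\<^sub>R G (Complex u y)"
      proof (cases "0 < y")
        case True
        have "(\<lambda>n. Complex (x n) y) \<longlonglongrightarrow> Complex u y" by (intro tendsto_Complex x(3) tendsto_const)
        moreover have "isCont G (Complex u y)" using x True by (intro cG) (auto simp: complex_eq_iff)
        ultimately have G1: "(\<lambda>n. G (Complex (x n) y)) \<longlonglongrightarrow> G (Complex u y)" by (rule isCont_tendsto_compose[rotated])
        have "\<forall>\<^sub>F n in sequentially. y < T n" using T_lim by (simp add: filterlim_at_top_dense)
        hence "\<forall>\<^sub>F n in sequentially. G (Complex (x n) y) = indicat_real {0<..T n} y *\<^sub>R G (Complex (x n) y)"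
          by eventually_elim (use True in \<open>auto simp: indicator_def\<close>)
        from Lim_transform_eventually[OF G1 this] show ?thesis using True by simp
      qed (simp add: indicator_def)
    qed
    show "integrable lborel (\<lambda>y. norm (indicat_real {0<..} y *\<^sub>R b y))"
      by (rule integrable_norm[OF b[unfolded set_integrable_def]])
    show "(\<lambda>y. indicat_real {0<..} y *\<^sub>R G (Complex u y)) \<in> borel_measurable lborel"
      using meas[OF x(4,5)] by (simp only: measurable_lborel2)
  qed
  have "?S \<longlonglongrightarrow> (CLINT t:{0..s}|lborel. G (of_real t)) + \<i> * (CLINT y:{0<..}|lborel. G (Complex s y))
      - \<i> * (CLINT y:{0<..}|lborel. G (Complex 0 y))"
  proof (intro tendsto_diff tendsto_add tendsto_mult_left L1)
    show "(\<lambda>n. CLINT y:{0<..T n}|lborel. G (Complex (a n) y)) \<longlonglongrightarrow> (CLINT y:{0<..}|lborel. G (Complex s y))"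
      by (rule L2[OF less_imp_le[OF a(1)] less_imp_le[OF a(2)] a_lim]) (use s in auto)
    show "(\<lambda>n. CLINT y:{0<..T n}|lborel. G (Complex 0 y)) \<longlonglongrightarrow> (CLINT y:{0<..}|lborel. G (Complex 0 y))"
      by (rule L2) (use s in auto)
  qed
  from LIMSEQ_unique[OF this S0]
  show "(CLINT t:{0..s}|lborel. G (of_real t)) = \<i> * (CLINT y:{0<..}|lborel. G (Complex 0 y)) - \<i> * (CLINT y:{0<..}|lborel. G (Complex s y))"
    by (simp add: algebra_simps add_eq_0_iff)
qed

subsection \<open>Asymptotics\<close>

lemma has_bochner_integral_Gamma_Ioi:
  fixes a r :: real
  assumes "0 < a" "0 < r"
  shows "has_bochner_integral lborel (\<lambda>t. indicat_real {0<..} t * (t powr (a - 1) * exp (- (r * t)))) (Gamma a / r powr a)"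
proof -
  have "(\<lambda>t. indicat_real {0<..} t * (t powr (a - 1) * exp (- (r * t)))) = (\<lambda>t. indicat_real {0..} t * (t powr (a - 1) * exp (- (r * t))))"
    by (auto simp: indicator_def fun_eq_iff)
  thus ?thesis using has_bochner_integral_Gamma[OF assms] by simp
qed

text \<open>Turns polynomial growth into a small exponential. The rate 1/4 is low enough that the
  few factors of this kind met below still leave decay when multiplied by exp(-r x) with r >=
  1.\<close>

lemma powr_le_exp:
  fixes p :: real
  obtains C where "0 < C" "\<And>x. 0 \<le> x \<Longrightarrow> (x + 2) powr p \<le> C * exp (x / 4)"
proof (cases "p \<le> 0")
  case True
  have "(x + 2) powr p \<le> 2 powr p * exp (x / 4)" if "0 \<le> x" for x
  proof -
    have "(x + 2) powr p \<le> 2 powr p" using True that by (intro powr_mono2') auto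
    also have "\<dots> = 2 powr p * 1" by simp
    also have "\<dots> \<le> 2 powr p * exp (x / 4)" using that by (intro mult_left_mono) auto
    finally show ?thesis .
  qed
  thus ?thesis by (intro that[of "2 powr p"]) auto
next
  case False
  hence p: "0 < p" by simp
  have "(x + 2) powr p \<le> exp (1 / 2 - p + p * ln (4 * p)) * exp (x / 4)" if "0 \<le> x" for x
  proof -
    \<comment> \<open>The scaling by \<open>4 * p\<close> is chosen so that, after multiplication by
      p, the slope in x is exactly 1/4.\<close>
    have "ln ((x + 2) / (4 * p)) \<le> (x + 2) / (4 * p) - 1" using that p by (intro ln_le_minus_one) auto
    hence "p * (ln (x + 2) - ln (4 * p)) \<le> p * ((x + 2) / (4 * p) - 1)"
      using that p by (intro mult_left_mono) (auto simp: ln_div)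
    also have "\<dots> = (x + 2) / 4 - p" using p by (simp add: field_simps)
    finally have "p * ln (x + 2) \<le> (1 / 2 - p + p * ln (4 * p)) + x / 4" by (simp add: algebra_simps)
    hence "exp (p * ln (x + 2)) \<le> exp ((1 / 2 - p + p * ln (4 * p)) + x / 4)" by simp
    thus ?thesis using that by (simp add: powr_def exp_add)
  qed
  thus ?thesis by (intro that[of "exp (1 / 2 - p + p * ln (4 * p))"]) auto
qed

text \<open>The linear term of (1 - i x)^q is -i q x, purely imaginary, so the real part deviates
  from 1 only quadratically. This is the reason for the error r^(-2 delta - 2) where r^(-2 delta -
  1) would be expected.\<close>

lemma Re_powr_one_minus:
  fixes q :: real
  assumes q: "0 < q"
  obtains C where "0 < C" "\<And>x. 0 \<le> x \<Longrightarrow> \<bar>Re ((1 - \<i> * of_real x) powr of_real q) - 1\<bar> \<le> C * (x\<^sup>2 * exp (x / 4))"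
proof -
  obtain C where C: "0 < C" "\<And>x. 0 \<le> x \<Longrightarrow> (x + 2) powr q \<le> C * exp (x / 4)" by (rule powr_le_exp) blast
  have "\<bar>Re ((1 - \<i> * of_real x) powr of_real q) - 1\<bar> \<le> ((q / 2 + q\<^sup>2 / 2) * C) * (x\<^sup>2 * exp (x / 4))" if x: "0 \<le> x" for x
  proof -
    let ?w = "1 - \<i> * complex_of_real x"
    define m where "m = cmod ?w powr q"
    define th where "th = q * Im (Ln ?w)"
    have w: "?w \<noteq> 0" by (simp add: complex_eq_iff)
    have "?w powr of_real q = exp (of_real q * Ln ?w)" using w by (simp add: powr_def)
    hence Re: "Re (?w powr of_real q) = m * cos th"
      using w by (simp add: Re_exp m_def th_def powr_def)
    have nw: "(cmod ?w)\<^sup>2 = 1 + x\<^sup>2" by (simp add: cmod_power2)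
    have n1: "1 \<le> cmod ?w" using nw by (metis add_increasing2 le_add_same_cancel1 norm_ge_zero one_power2 power2_le_imp_le zero_le_power2)
    have m1: "1 \<le> m" unfolding m_def using n1 q by (simp add: ge_one_powr_ge_zero)
    have "ln (cmod ?w) \<le> x\<^sup>2 / 2"
    proof -
      have "2 * ln (cmod ?w) = ln ((cmod ?w)\<^sup>2)" using n1 by (simp add: ln_realpow)
      also have "\<dots> \<le> x\<^sup>2" unfolding nw by (rule ln_add_one_self_le_self) simp
      finally show ?thesis by simp
    qed
    hence u: "q * ln (cmod ?w) \<le> q * (x\<^sup>2 / 2)" using q by (intro mult_left_mono) auto
    have "1 - q * ln (cmod ?w) \<le> exp (- (q * ln (cmod ?w)))" using exp_ge_add_one_self[of "- (q * ln (cmod ?w))"] by simp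
    also have "exp (- (q * ln (cmod ?w))) = 1 / m" using n1 by (auto simp: m_def powr_def exp_minus divide_inverse)
    finally have "1 - 1 / m \<le> q * (x\<^sup>2 / 2)" using u by linarith
    hence "m * (1 - 1 / m) \<le> m * (q * (x\<^sup>2 / 2))" using m1 by (intro mult_left_mono) auto
    moreover have "m * (1 - 1 / m) = m - 1" using m1 by (simp add: field_simps)
    ultimately have b1: "m - 1 \<le> m * (q * (x\<^sup>2 / 2))" by simp
    have "\<bar>Im (Ln ?w)\<bar> \<le> x"
    proof -
      have "Im (Ln ?w) = Arg ?w" using w by (simp add: Arg_eq_Im_Ln)
      also have "\<dots> = arctan (Im ?w / Re ?w)" by (rule arg_conv_arctan) simp
      finally show ?thesis using abs_arctan_le[of "- x"] x by simp
    qed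
    hence "\<bar>th\<bar> \<le> q * x" using q by (simp add: th_def abs_mult)
    hence "th\<^sup>2 \<le> (q * x)\<^sup>2" by (rule abs_le_square_iff[THEN iffD1, OF order_trans]) simp
    moreover have "1 - cos th \<le> th\<^sup>2 / 2"
    proof -
      have "1 - cos th = 2 * (sin (th / 2))\<^sup>2" using cos_double_sin[of "th / 2"] by simp
      also have "(sin (th / 2))\<^sup>2 \<le> (th / 2)\<^sup>2" using abs_sin_x_le_abs_x[of "th / 2"] unfolding abs_le_square_iff .
      finally show ?thesis by (simp add: power2_eq_square)
    qed
    ultimately have "1 - cos th \<le> q\<^sup>2 * x\<^sup>2 / 2" by (simp add: power_mult_distrib)
    hence b2: "m * (1 - cos th) \<le> m * (q\<^sup>2 * x\<^sup>2 / 2)" using m1 by (intro mult_left_mono) auto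
    have b2': "0 \<le> m * (1 - cos th)" using m1 by simp
    \<comment> \<open>In polar form the modulus exceeds 1 by O(x^2), as |w|^2 = 1 + x^2, and the
      angle is O(x), so 1 - cos is O(x^2) too.\<close>
    have "\<bar>m * cos th - 1\<bar> \<le> (m - 1) + m * (1 - cos th)"
    proof -
      have "m * cos th - 1 = (m - 1) - m * (1 - cos th)" by (simp add: algebra_simps)
      thus ?thesis using b2' m1 by linarith
    qed
    also have "\<dots> \<le> m * (q * (x\<^sup>2 / 2)) + m * (q\<^sup>2 * x\<^sup>2 / 2)" using b1 b2 by simp
    also have "\<dots> = (q / 2 + q\<^sup>2 / 2) * x\<^sup>2 * m" by (simp add: algebra_simps)
    also have "\<dots> \<le> (q / 2 + q\<^sup>2 / 2) * x\<^sup>2 * (C * exp (x / 4))"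
    proof (rule mult_left_mono)
      have "cmod ?w \<le> 1 + cmod (\<i> * of_real x)" by (rule order_trans[OF norm_triangle_ineq4]) simp
      also have "\<dots> \<le> x + 2" using x by (simp add: norm_mult)
      finally have "m \<le> (x + 2) powr q" unfolding m_def using q by (intro powr_mono2) auto
      thus "m \<le> C * exp (x / 4)" using C(2)[OF x] by simp
    qed (use q in simp)
    finally show ?thesis unfolding Re by (simp only: mult_ac)
  qed
  thus ?thesis using C q by (intro that[of "(q / 2 + q\<^sup>2 / 2) * C"]) (auto simp: add_pos_pos)
qed

text \<open>The substitution w = x + y gives y (y + 2 x) = w^2 - x^2, so the two powers merge into
  (w^2 - x^2)^(delta - 1) and the exponentials into exp(-r w). The integral over 0 < x < w is a Beta
  value times w^(2 delta - 1), and a Gamma integral in w remains.\<close>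

lemma has_bochner_integral_main_term:
  fixes \<delta> r :: real
  assumes \<delta>: "1 / 2 < \<delta>" and r: "0 < r"
  shows "has_bochner_integral lborel
     (\<lambda>y. indicat_real {0<..} y * (y powr (\<delta> - 1) * exp (- (r * y)) *
        (LINT x|lborel. indicat_real {0<..} x * (exp (- (r * x)) * (y + 2 * x) powr (\<delta> - 1)))))
     (Beta (1 / 2) \<delta> / 2 * (Gamma (2 * \<delta>) / r powr (2 * \<delta>)))"
    and integrable_main_inner: "0 < y \<Longrightarrow> integrable lborel (\<lambda>x. indicat_real {0<..} x * (exp (- (r * x)) * (y + 2 * x) powr (\<delta> - 1)))"
proof -
  define f where "f = (\<lambda>y x. indicat_real {0<..} x * (exp (- (r * x)) * (y + 2 * x) powr (\<delta> - 1)))"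
  have f0: "0 \<le> f y x" for y x by (simp add: f_def)
  have f_int: "integrable lborel (f y)" if y: "0 < y" for y
  proof (rule Bochner_Integration.integrable_bound)
    show "integrable lborel (\<lambda>x. y powr (\<delta> - 1) * (indicat_real {0<..} x * (x powr (1 - 1) * exp (- (r * x))))
        + 3 powr (\<delta> - 1) * (y powr (\<delta> - 1) * (indicat_real {0<..} x * (x powr (1 - 1) * exp (- (r * x))))
        + (indicat_real {0<..} x * (x powr (\<delta> - 1) * exp (- (r * x))))))"
      using has_bochner_integral_Gamma_Ioi[of 1 r] has_bochner_integral_Gamma_Ioi[of \<delta> r] r \<delta>
      by (intro Bochner_Integration.integrable_add integrable_mult_right) (auto simp: has_bochner_integral_iff)
    show "AE x in lborel. norm (f y x) \<le> norm (y powr (\<delta> - 1) * (indicat_real {0<..} x * (x powr (1 - 1) * exp (- (r * x))))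
        + 3 powr (\<delta> - 1) * (y powr (\<delta> - 1) * (indicat_real {0<..} x * (x powr (1 - 1) * exp (- (r * x))))
        + (indicat_real {0<..} x * (x powr (\<delta> - 1) * exp (- (r * x))))))"
    proof (rule AE_I2)
      fix x
      show "norm (f y x) \<le> norm (y powr (\<delta> - 1) * (indicat_real {0<..} x * (x powr (1 - 1) * exp (- (r * x))))
        + 3 powr (\<delta> - 1) * (y powr (\<delta> - 1) * (indicat_real {0<..} x * (x powr (1 - 1) * exp (- (r * x))))
        + (indicat_real {0<..} x * (x powr (\<delta> - 1) * exp (- (r * x))))))"
      proof (cases "0 < x")
        case True
        have "exp (- (r * x)) * (y + 2 * x) powr (\<delta> - 1) \<le> exp (- (r * x)) * ((1 + 3 powr (\<delta> - 1)) * y powr (\<delta> - 1) + 3 powr (\<delta> - 1) * x powr (\<delta> - 1))"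
          using powr_add_double_le[OF True y] by (intro mult_left_mono) auto
        thus ?thesis using True by (simp add: f_def algebra_simps)
      qed (simp add: f_def)
    qed
  qed (simp add: f_def)
  thus "0 < y \<Longrightarrow> integrable lborel (\<lambda>x. indicat_real {0<..} x * (exp (- (r * x)) * (y + 2 * x) powr (\<delta> - 1)))"
    by (simp add: f_def)
  let ?k = "\<lambda>y x. if 0 < y \<and> 0 < x then ennreal (y powr (\<delta> - 1) * exp (- (r * y)) * (exp (- (r * x)) * (y + 2 * x) powr (\<delta> - 1))) else 0"
  let ?h = "\<lambda>w x. if 0 < x \<and> x < w then ennreal (exp (- (r * w)) * (w\<^sup>2 - x\<^sup>2) powr (\<delta> - 1)) else 0"
  let ?V = "Beta (1 / 2) \<delta> / 2 * (Gamma (2 * \<delta>) / r powr (2 * \<delta>))"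
  have null: "AE x in lborel. x \<noteq> (0::real)" by (rule AE_lborel_singleton)
  have B: "0 < Beta (1 / 2) \<delta>" "0 < Gamma (2 * \<delta>)" using \<delta> by (auto intro!: Beta_pos Gamma_real_pos)
  have "has_bochner_integral lborel (\<lambda>y. indicat_real {0<..} y * (y powr (\<delta> - 1) * exp (- (r * y)) * (LINT x|lborel. f y x))) ?V"
  proof (rule has_bochner_integral_nn_integral)
    show "(\<lambda>y. indicat_real {0<..} y * (y powr (\<delta> - 1) * exp (- (r * y)) * (LINT x|lborel. f y x))) \<in> borel_measurable lborel"
      unfolding f_def by measurable
    show "AE y in lborel. 0 \<le> indicat_real {0<..} y * (y powr (\<delta> - 1) * exp (- (r * y)) * (LINT x|lborel. f y x))"
      by (intro AE_I2 mult_nonneg_nonneg Bochner_Integration.integral_nonneg f0) auto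
    show "0 \<le> ?V" using B by simp
    have "(\<integral>\<^sup>+ y. ennreal (indicat_real {0<..} y * (y powr (\<delta> - 1) * exp (- (r * y)) * (LINT x|lborel. f y x))) \<partial>lborel)
       = (\<integral>\<^sup>+ y. \<integral>\<^sup>+ x. ?k y x \<partial>lborel \<partial>lborel)"
    proof (rule nn_integral_cong)
      fix y :: real
      show "ennreal (indicat_real {0<..} y * (y powr (\<delta> - 1) * exp (- (r * y)) * (LINT x|lborel. f y x))) = (\<integral>\<^sup>+ x. ?k y x \<partial>lborel)"
      proof (cases "0 < y")
        case True
        have "has_bochner_integral lborel (\<lambda>x. y powr (\<delta> - 1) * exp (- (r * y)) * f y x) (y powr (\<delta> - 1) * exp (- (r * y)) * (LINT x|lborel. f y x))"
          using f_int[OF True] by (intro has_bochner_integral_mult_right has_bochner_integral_integrable)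
        from nn_integral_of_has_bochner_integral[OF this] f0
        have "(\<integral>\<^sup>+ x. ennreal (y powr (\<delta> - 1) * exp (- (r * y)) * f y x) \<partial>lborel) = ennreal (y powr (\<delta> - 1) * exp (- (r * y)) * (LINT x|lborel. f y x))"
          by simp
        moreover have "(\<lambda>x. ennreal (y powr (\<delta> - 1) * exp (- (r * y)) * f y x)) = ?k y" using True by (auto simp: f_def fun_eq_iff indicator_def)
        ultimately show ?thesis using True by simp
      next
        case False
        hence k: "?k y = (\<lambda>x. 0)" by auto
        show ?thesis unfolding k using False by simp
      qed
    qed
    also have "\<dots> = (\<integral>\<^sup>+ x. \<integral>\<^sup>+ y. ?k y x \<partial>lborel \<partial>lborel)"
      by (rule lborel_pair.Fubini'[symmetric]) measurable
    also have "\<dots> = (\<integral>\<^sup>+ x. \<integral>\<^sup>+ w. ?h w x \<partial>lborel \<partial>lborel)"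
    proof (rule nn_integral_cong)
      fix x :: real
      have "(\<integral>\<^sup>+ y. ?k y x \<partial>lborel) = ennreal \<bar>1\<bar> * (\<integral>\<^sup>+ w. ?k (- x + 1 * w) x \<partial>lborel)"
        by (rule nn_integral_real_affine) auto
      also have "(\<lambda>w. ?k (- x + 1 * w) x) = (\<lambda>w. ?h w x)"
      proof (rule ext)
        fix w
        have "(w - x) powr (\<delta> - 1) * exp (- (r * (w - x))) * (exp (- (r * x)) * (w - x + 2 * x) powr (\<delta> - 1)) = exp (- (r * w)) * (w\<^sup>2 - x\<^sup>2) powr (\<delta> - 1)"
          if "x < w" "0 < x"
        proof -
          have "w\<^sup>2 - x\<^sup>2 = (w - x) * (w - x + 2 * x)" by (simp add: power2_eq_square algebra_simps)
          hence "(w\<^sup>2 - x\<^sup>2) powr (\<delta> - 1) = (w - x) powr (\<delta> - 1) * (w - x + 2 * x) powr (\<delta> - 1)"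
            using that by (simp only: powr_mult)
          moreover have "exp (- (r * w)) = exp (- (r * (w - x))) * exp (- (r * x))" by (simp add: exp_add[symmetric] algebra_simps)
          ultimately show ?thesis by simp
        qed
        thus "?k (- x + 1 * w) x = ?h w x" by (auto simp: add.commute[of "- x"] add_uminus_conv_diff)
      qed
      finally show "(\<integral>\<^sup>+ y. ?k y x \<partial>lborel) = (\<integral>\<^sup>+ w. ?h w x \<partial>lborel)" by simp
    qed
    also have "\<dots> = (\<integral>\<^sup>+ w. \<integral>\<^sup>+ x. ?h w x \<partial>lborel \<partial>lborel)"
      by (rule lborel_pair.Fubini'[symmetric]) measurable
    also have "\<dots> = (\<integral>\<^sup>+ w. ennreal (Beta (1 / 2) \<delta> / 2 * (indicat_real {0<..} w * (w powr (2 * \<delta> - 1) * exp (- (r * w))))) \<partial>lborel)"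
    proof (rule nn_integral_cong)
      fix w :: real
      show "(\<integral>\<^sup>+ x. ?h w x \<partial>lborel) = ennreal (Beta (1 / 2) \<delta> / 2 * (indicat_real {0<..} w * (w powr (2 * \<delta> - 1) * exp (- (r * w)))))"
      proof (cases "0 < w")
        case True
        have h: "has_bochner_integral lborel (\<lambda>x. exp (- (r * w)) * (indicat_real {0..w} x * (x powr (2 * (1 / 2) - 1) * (w\<^sup>2 - x\<^sup>2) powr (\<delta> - 1))))
           (exp (- (r * w)) * (w powr (2 * (1 / 2) + 2 * \<delta> - 2) * Beta (1 / 2) \<delta> / 2))"
          using True \<delta> by (intro has_bochner_integral_mult_right has_bochner_integral_Beta_square) auto
        have "(\<integral>\<^sup>+ x. ?h w x \<partial>lborel) = (\<integral>\<^sup>+ x. ennreal (exp (- (r * w)) * (indicat_real {0..w} x * (x powr (2 * (1 / 2) - 1) * (w\<^sup>2 - x\<^sup>2) powr (\<delta> - 1)))) \<partial>lborel)"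
        proof (rule nn_integral_cong)
          fix x
          \<comment> \<open>At the end points x = 0 and x = w both sides are 0, because
            \<open>0 powr c\<close> is 0 for every c.\<close>
          show "?h w x = ennreal (exp (- (r * w)) * (indicat_real {0..w} x * (x powr (2 * (1 / 2) - 1) * (w\<^sup>2 - x\<^sup>2) powr (\<delta> - 1))))"
            by (cases "x = w") (auto simp: indicator_def)
        qed
        also have "\<dots> = ennreal (exp (- (r * w)) * (w powr (2 * (1 / 2) + 2 * \<delta> - 2) * Beta (1 / 2) \<delta> / 2))"
          by (rule nn_integral_of_has_bochner_integral[OF h]) auto
        finally show ?thesis using True by (simp add: mult_ac)
      next
        case False
        hence k: "?h w = (\<lambda>x. 0)" by auto
        show ?thesis unfolding k using False by simp
      qed
    qed
    also have "\<dots> = ennreal ?V"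
    proof (rule nn_integral_of_has_bochner_integral)
      show "has_bochner_integral lborel (\<lambda>w. Beta (1 / 2) \<delta> / 2 * (indicat_real {0<..} w * (w powr (2 * \<delta> - 1) * exp (- (r * w))))) ?V"
        using r \<delta> by (intro has_bochner_integral_mult_right has_bochner_integral_Gamma_Ioi) auto
    qed (use B in auto)
    finally show "(\<integral>\<^sup>+ y. ennreal (indicat_real {0<..} y * (y powr (\<delta> - 1) * exp (- (r * y)) * (LINT x|lborel. f y x))) \<partial>lborel) = ennreal ?V" .
  qed
  thus "has_bochner_integral lborel
     (\<lambda>y. indicat_real {0<..} y * (y powr (\<delta> - 1) * exp (- (r * y)) *
        (LINT x|lborel. indicat_real {0<..} x * (exp (- (r * x)) * (y + 2 * x) powr (\<delta> - 1))))) ?V"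
    by (simp only: f_def)
qed

lemma powr_mult_exp_tendsto_0: "((\<lambda>y::real. y powr p * exp (- y)) \<longlongrightarrow> 0) at_top"
  by real_asymp

lemma field_differentiable_powr_const:
  assumes "f field_differentiable at z" "f z \<notin> \<real>\<^sub>\<le>\<^sub>0"
  shows "(\<lambda>z. f z powr c) field_differentiable at (z :: complex)"
proof -
  obtain f' where "(f has_field_derivative f') (at z)" using assms(1) by (auto simp: field_differentiable_def)
  from DERIV_chain2[OF has_field_derivative_powr[OF assms(2)] this] show ?thesis
    by (auto simp: field_differentiable_def)
qed

lemma field_differentiable_exp_linear: "(\<lambda>z. exp (c * z)) field_differentiable at (z :: complex)"
  unfolding field_differentiable_def by (rule exI) (auto intro!: derivative_eq_intros)

lemma continuous_on_powr_const:
  fixes f :: "'a::topological_space \<Rightarrow> complex"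
  assumes "continuous_on A f" "\<And>x. x \<in> A \<Longrightarrow> f x \<notin> \<real>\<^sub>\<le>\<^sub>0"
  shows "continuous_on A (\<lambda>x. f x powr c)"
proof (rule continuous_on_compose2[of "- \<real>\<^sub>\<le>\<^sub>0" "\<lambda>z. z powr c"])
  show "continuous_on (- \<real>\<^sub>\<le>\<^sub>0) (\<lambda>z::complex. z powr c)"
    by (intro continuous_at_imp_continuous_on ballI field_differentiable_imp_continuous_at)
       (auto simp: field_differentiable_def intro: has_field_derivative_powr)
qed (use assms in auto)

lemma cmod_powr_le:
  assumes "0 < l" "l \<le> cmod w" "cmod w \<le> h"
  shows "cmod (w powr of_real p) \<le> l powr p + h powr p"
proof -
  have "cmod (w powr of_real p) = cmod w powr p" by (subst norm_powr_real_powr') auto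
  thus ?thesis using powr_le_sum[OF assms] by simp
qed

section \<open>The two contour shifts\<close>

context
  fixes \<delta> r :: real
  assumes \<delta>: "1 / 2 < \<delta>" and r: "1 \<le> r"
begin

text \<open>On the right edge z = s + i y one has s^2 - z^2 = y (y - 2 i s), while on the imaginary
  axis the integrand is real. Taking the real part of i times the edge integrals discards the latter
  and turns the former into an imaginary part.\<close>

lemma first_shift:
  assumes s: "0 < s" "s \<le> 1"
  shows "(LINT t|lborel. indicat_real {0..s} t * (cos (r * t) * (s\<^sup>2 - t\<^sup>2) powr (\<delta> - 1)))
    = Im (cis (r * s) * (CLINT y:{0<..}|lborel. of_real (y powr (\<delta> - 1) * exp (- (r * y))) * (of_real y - 2 * \<i> * of_real s) powr of_real (\<delta> - 1)))"
proof -
  define p where "p = \<delta> - 1"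
  have p: "- 1 < p" "- 1 < 2 * p" using \<delta> by (auto simp: p_def)
  define G where "G = (\<lambda>z. exp (\<i> * of_real r * z) * ((of_real s)\<^sup>2 - z\<^sup>2) powr of_real p)"
  obtain C where C: "0 < C" "\<And>x. 0 \<le> x \<Longrightarrow> (x + 2) powr (2 * p) \<le> C * exp (x / 4)" by (rule powr_le_exp) blast
  \<comment> \<open>On the strip |s^2 - z^2| lies between s y and (y + 2)^2; both bounds enter
    because the sign of p is open. The singularity y^p at 0 is integrable.\<close>
  define b where "b = (\<lambda>y. s powr p * (y powr p * exp (- y)) + C * exp (- (3 / 4 * y)))"
  have G_real: "G (of_real t) = cis (r * t) * of_real ((s\<^sup>2 - t\<^sup>2) powr p)" if "0 \<le> t" "t \<le> s" for t
  proof -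
    have "0 \<le> s\<^sup>2 - t\<^sup>2" using that by (simp add: power_mono)
    hence e: "complex_of_real (s\<^sup>2 - t\<^sup>2) powr of_real p = of_real ((s\<^sup>2 - t\<^sup>2) powr p)" by (rule powr_of_real)
    have "(of_real s)\<^sup>2 - (of_real t)\<^sup>2 = complex_of_real (s\<^sup>2 - t\<^sup>2)" by simp
    hence "G (of_real t) = exp (\<i> * of_real r * of_real t) * of_real ((s\<^sup>2 - t\<^sup>2) powr p)" unfolding G_def by (simp only: e)
    thus ?thesis by (simp add: cis_conv_exp mult.assoc)
  qed
  \<comment> \<open>Poisson's integral at frequency 0 provides the integrability of the weight
    itself.\<close>
  have seg: "has_bochner_integral lborel (\<lambda>t. indicat_real {0..s} t * (cos (0 * t) * (s\<^sup>2 - t\<^sup>2) powr (\<delta> - 1))) (s powr (2 * \<delta> - 1) * Beta (1 / 2) \<delta> / 2 * Omega (\<delta> - 1 / 2) (0 * s))"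
    using s \<delta> by (intro Poisson_Omega) auto
  have G_seg: "integrable lborel (\<lambda>t. indicat_real {0..s} t *\<^sub>R (cis (r * t) * of_real ((s\<^sup>2 - t\<^sup>2) powr p)))"
  proof (rule Bochner_Integration.integrable_bound)
    show "integrable lborel (\<lambda>t. indicat_real {0..s} t * (cos (0 * t) * (s\<^sup>2 - t\<^sup>2) powr (\<delta> - 1)))"
      using seg by (simp add: has_bochner_integral_iff)
    show "(\<lambda>t. indicat_real {0..s} t *\<^sub>R (cis (r * t) * of_real ((s\<^sup>2 - t\<^sup>2) powr p))) \<in> borel_measurable lborel"
      unfolding cis_conv_exp by measurable
  qed (auto simp: norm_mult p_def)
  have eqG: "(\<lambda>t. indicat_real {0..s} t *\<^sub>R G (of_real t)) = (\<lambda>t. indicat_real {0..s} t *\<^sub>R (cis (r * t) * of_real ((s\<^sup>2 - t\<^sup>2) powr p)))"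
    by (auto simp: fun_eq_iff indicator_def G_real)
  have shift: "(CLINT t:{0..s}|lborel. G (of_real t)) = \<i> * (CLINT y:{0<..}|lborel. G (Complex 0 y)) - \<i> * (CLINT y:{0<..}|lborel. G (Complex s y))"
  proof (rule half_strip_shift[where b = b])
    show "0 < s" by fact
    fix z assume z: "0 \<le> Re z" "Re z \<le> s" "0 \<le> Im z" "z \<noteq> of_real s"
    have "(of_real s)\<^sup>2 - z\<^sup>2 \<notin> \<real>\<^sub>\<le>\<^sub>0"
    proof
      assume "(of_real s)\<^sup>2 - z\<^sup>2 \<in> \<real>\<^sub>\<le>\<^sub>0"
      hence 1: "s\<^sup>2 + (Im z)\<^sup>2 \<le> (Re z)\<^sup>2" and 2: "Re z * Im z = 0"
        by (auto simp: complex_nonpos_Reals_iff Re_power2 Im_power2 power2_eq_square algebra_simps)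
      have "(Re z)\<^sup>2 \<le> s\<^sup>2" using z by (intro power_mono) auto
      with 1 have "(Im z)\<^sup>2 \<le> 0" by linarith
      hence im: "Im z = 0" by simp
      have "s \<le> Re z" using 1 z s im by (intro power2_le_imp_le[of s "Re z"]) auto
      thus False using z im by (auto simp: complex_eq_iff)
    qed
    thus "G field_differentiable at z"
      unfolding G_def
      by (intro field_differentiable_mult field_differentiable_exp_linear field_differentiable_powr_const derivative_intros)
  next
    fix x y :: real assume xy: "0 \<le> x" "x \<le> s" "0 < y"
    let ?z = "Complex x y"
    have f: "(of_real s)\<^sup>2 - ?z\<^sup>2 = (of_real s - ?z) * (of_real s + ?z)" by (simp add: power2_eq_square algebra_simps)
    have 1: "y \<le> cmod (of_real s - ?z)" using abs_Im_le_cmod[of "of_real s - ?z"] xy by simp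
    have 2: "s \<le> cmod (of_real s + ?z)" using complex_Re_le_cmod[of "of_real s + ?z"] xy by simp
    have z: "cmod ?z \<le> x + y" using cmod_le[of ?z] xy by simp
    have 3: "cmod (of_real s - ?z) \<le> y + 2"
    proof -
      have "of_real s - ?z = Complex (s - x) (- y)" by (simp add: complex_eq_iff)
      thus ?thesis using cmod_le[of "Complex (s - x) (- y)"] xy s by simp
    qed
    have 4: "cmod (of_real s + ?z) \<le> y + 2"
    proof -
      have "of_real s + ?z = Complex (s + x) y" by (simp add: complex_eq_iff)
      thus ?thesis using cmod_le[of "Complex (s + x) y"] xy s by simp
    qed
    have "cmod (((of_real s)\<^sup>2 - ?z\<^sup>2) powr of_real p) \<le> (s * y) powr p + ((y + 2)\<^sup>2) powr p"
    proof (rule cmod_powr_le)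
      show "s * y \<le> cmod ((of_real s)\<^sup>2 - ?z\<^sup>2)" unfolding f norm_mult
        using mult_mono[OF 1 2] xy s by (simp add: mult.commute)
      show "cmod ((of_real s)\<^sup>2 - ?z\<^sup>2) \<le> (y + 2)\<^sup>2" unfolding f norm_mult power2_eq_square[of "y + 2"]
        using xy by (intro mult_mono 3 4) auto
    qed (use xy s in auto)
    also have "(s * y) powr p = s powr p * y powr p" using xy s by (simp add: powr_mult)
    also have "((y + 2)\<^sup>2) powr p = (y + 2) powr (2 * p)"
      using xy powr_powr[of "y + 2" 2 p] by simp
    also have "(y + 2) powr (2 * p) \<le> C * exp (y / 4)" using C(2)[of y] xy by simp
    finally have pb: "cmod (((of_real s)\<^sup>2 - ?z\<^sup>2) powr of_real p) \<le> s powr p * y powr p + C * exp (y / 4)" by simp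
    have "cmod (exp (\<i> * of_real r * ?z)) = exp (- (r * y))" by (simp add: norm_exp_eq_Re)
    also have "\<dots> \<le> exp (- y)" using xy r by simp
    finally have "cmod (G ?z) \<le> exp (- y) * (s powr p * y powr p + C * exp (y / 4))"
      unfolding G_def norm_mult using pb by (intro mult_mono) auto
    also have "\<dots> = b y"
    proof -
      have "exp (- y) * exp (y / 4) = exp (- (3 / 4 * y))" by (simp add: exp_add[symmetric])
      thus ?thesis by (simp add: b_def algebra_simps)
    qed
    finally show "cmod (G ?z) \<le> b y" .
  next
    have "integrable lborel (\<lambda>y. s powr p * (indicat_real {0<..} y * (y powr (p + 1 - 1) * exp (- (1 * y))))
        + C * (indicat_real {0<..} y * (y powr (1 - 1) * exp (- (3 / 4 * y)))))"
      using has_bochner_integral_Gamma_Ioi[of "p + 1" 1] has_bochner_integral_Gamma_Ioi[of 1 "3 / 4"] p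
      by (intro Bochner_Integration.integrable_add integrable_mult_right) (auto simp: has_bochner_integral_iff)
    moreover have "(\<lambda>y. s powr p * (indicat_real {0<..} y * (y powr (p + 1 - 1) * exp (- (1 * y))))
        + C * (indicat_real {0<..} y * (y powr (1 - 1) * exp (- (3 / 4 * y))))) = (\<lambda>y. indicat_real {0<..} y *\<^sub>R b y)"
      by (auto simp: fun_eq_iff b_def indicator_def)
    ultimately show "set_integrable lborel {0<..} b" unfolding set_integrable_def by simp
    have "((\<lambda>y. exp (- (3 / 4 * y :: real))) \<longlongrightarrow> 0) at_top" by real_asymp
    hence "(b \<longlongrightarrow> s powr p * 0 + C * 0) at_top" unfolding b_def by (intro tendsto_intros powr_mult_exp_tendsto_0)
    thus "(b \<longlongrightarrow> 0) at_top" by simp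
    show "set_integrable lborel {0..s} (\<lambda>t. G (of_real t))"
      unfolding set_integrable_def eqG by (rule G_seg)
  qed
  have left: "(CLINT y:{0<..}|lborel. G (Complex 0 y)) = of_real (LINT y:{0<..}|lborel. exp (- (r * y)) * (s\<^sup>2 + y\<^sup>2) powr p)"
  proof -
    have "G (Complex 0 y) = of_real (exp (- (r * y)) * (s\<^sup>2 + y\<^sup>2) powr p)" for y
    proof -
      have "Complex 0 y = \<i> * of_real y" by (simp add: complex_eq_iff)
      moreover have "(of_real s)\<^sup>2 - (\<i> * of_real y)\<^sup>2 = complex_of_real (s\<^sup>2 + y\<^sup>2)" by (simp add: power_mult_distrib)
      moreover have "complex_of_real (s\<^sup>2 + y\<^sup>2) powr of_real p = of_real ((s\<^sup>2 + y\<^sup>2) powr p)" by (rule powr_of_real) auto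
      moreover have "\<i> * of_real r * (\<i> * of_real y) = of_real (- (r * y))" by (simp add: complex_eq_iff)
      ultimately show ?thesis unfolding G_def by (simp only: exp_of_real of_real_mult)
    qed
    thus ?thesis by (simp only: set_integral_complex_of_real)
  qed
  have right: "(CLINT y:{0<..}|lborel. G (Complex s y))
      = cis (r * s) * (CLINT y:{0<..}|lborel. of_real (y powr (\<delta> - 1) * exp (- (r * y))) * (of_real y - 2 * \<i> * of_real s) powr of_real (\<delta> - 1))"
  proof -
    have "G (Complex s y) = cis (r * s) * (of_real (y powr (\<delta> - 1) * exp (- (r * y))) * (of_real y - 2 * \<i> * of_real s) powr of_real (\<delta> - 1))" if y: "0 < y" for y
    proof -
      have "(of_real s)\<^sup>2 - (Complex s y)\<^sup>2 = of_real y * (of_real y - 2 * \<i> * of_real s)"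
        by (simp add: complex_eq_iff power2_eq_square algebra_simps)
      \<comment> \<open>The principal power splits over this product because one factor is a
        positive real.\<close>
      moreover have "(of_real y * (of_real y - 2 * \<i> * of_real s)) powr of_real p = complex_of_real y powr of_real p * (of_real y - 2 * \<i> * of_real s) powr of_real p"
        using y by (intro powr_times_real_left) auto
      moreover have "complex_of_real y powr of_real p = of_real (y powr p)" using y by (simp add: powr_of_real)
      moreover have "\<i> * of_real r * Complex s y = \<i> * of_real (r * s) + of_real (- (r * y))" by (simp add: complex_eq_iff)
      ultimately have "G (Complex s y) = (cis (r * s) * of_real (exp (- (r * y)))) * (of_real (y powr p) * (of_real y - 2 * \<i> * of_real s) powr of_real p)"
        unfolding G_def cis_conv_exp by (simp only: exp_add exp_of_real)
      thus ?thesis by (simp add: p_def mult_ac)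
    qed
    hence "(CLINT y:{0<..}|lborel. G (Complex s y)) = (CLINT y:{0<..}|lborel. cis (r * s) * (of_real (y powr (\<delta> - 1) * exp (- (r * y))) * (of_real y - 2 * \<i> * of_real s) powr of_real (\<delta> - 1)))"
      by (intro set_lebesgue_integral_cong) auto
    thus ?thesis by (simp only: set_integral_mult_right)
  qed
  have "Re (CLINT t:{0..s}|lborel. G (of_real t)) = (LINT t|lborel. indicat_real {0..s} t * (cos (r * t) * (s\<^sup>2 - t\<^sup>2) powr (\<delta> - 1)))"
    unfolding set_lebesgue_integral_def eqG using integral_Re[OF G_seg] by (simp add: p_def)
  thus ?thesis unfolding shift left right by simp
qed

text \<open>On s = i x the factor y - 2 i s becomes the positive real y + 2 x, the kernel of
  \<open>has_bochner_integral_main_term\<close>. On s = 1 + i x the factor (1 - s)^(2 delta - 1) has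
  modulus x^(2 delta - 1), and this smallness at x = 0 makes that edge negligible.\<close>

lemma second_shift:
  assumes y: "0 < y"
  shows "(CLINT s:{0..1}|lborel. of_real ((1 - s) powr (2 * \<delta> - 1)) * (cis (r * s) * (of_real y - 2 * \<i> * of_real s) powr of_real (\<delta> - 1)))
      = \<i> * (CLINT x:{0<..}|lborel. of_real (exp (- (r * x)) * (y + 2 * x) powr (\<delta> - 1)) * (1 - \<i> * of_real x) powr of_real (2 * \<delta> - 1))
      - \<i> * (cis r * (CLINT x:{0<..}|lborel. of_real (exp (- (r * x))) * ((- \<i> * of_real x) powr of_real (2 * \<delta> - 1) * (of_real (y + 2 * x) - 2 * \<i>) powr of_real (\<delta> - 1))))"
    and "set_integrable lborel {0<..} (\<lambda>x. of_real (exp (- (r * x)) * (y + 2 * x) powr (\<delta> - 1)) * (1 - \<i> * of_real x) powr of_real (2 * \<delta> - 1) :: complex)"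
    and "set_integrable lborel {0<..} (\<lambda>x. cis r * (of_real (exp (- (r * x))) * ((- \<i> * of_real x) powr of_real (2 * \<delta> - 1) * (of_real (y + 2 * x) - 2 * \<i>) powr of_real (\<delta> - 1))))"
proof -
  define p where "p = \<delta> - 1"
  define q where "q = 2 * \<delta> - 1"
  have q: "0 < q" using \<delta> by (simp add: q_def)
  define G where "G = (\<lambda>z. exp (\<i> * of_real r * z) * ((1 - z) powr of_real q * (of_real y - 2 * \<i> * z) powr of_real p))"
  obtain C where C: "0 < C" "\<And>x. 0 \<le> x \<Longrightarrow> (x + 2) powr p \<le> C * exp (x / 4)" by (rule powr_le_exp) blast
  obtain D where D: "0 < D" "\<And>x. 0 \<le> x \<Longrightarrow> (x + 2) powr q \<le> D * exp (x / 4)" by (rule powr_le_exp) blast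
  define K where "K = D * (y powr p + C * exp (y / 4))"
  have K: "0 < K" using C D by (auto simp: K_def intro!: mult_pos_pos add_nonneg_pos)
  define b where "b = (\<lambda>t. K * exp (- (1 / 4 * t)))"
  have a1: "0 < (1::real)" by simp
  have a2: "G field_differentiable at z" if z: "0 \<le> Re z" "Re z \<le> 1" "0 \<le> Im z" "z \<noteq> of_real 1" for z
  proof -
    \<comment> \<open>Both bases avoid the cut of the power: z differs from 1 with Re z <= 1 and Im
      z >= 0, and the real part y + 2 Im z of the second base is positive.\<close>
    have "1 - z \<notin> \<real>\<^sub>\<le>\<^sub>0" "of_real y - 2 * \<i> * z \<notin> \<real>\<^sub>\<le>\<^sub>0"
      using z y by (auto simp: complex_nonpos_Reals_iff complex_eq_iff)
    thus ?thesis unfolding G_def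
      by (intro field_differentiable_mult field_differentiable_exp_linear field_differentiable_powr_const derivative_intros)
  qed
  have a3: "cmod (G (Complex u t)) \<le> b t" if ut: "0 \<le> u" "u \<le> 1" "0 < t" for u t
  proof -
    let ?z = "Complex u t"
    have "cmod (1 - ?z) \<le> t + 2"
    proof -
      have "1 - ?z = Complex (1 - u) (- t)" by (simp add: complex_eq_iff)
      thus ?thesis using cmod_le[of "Complex (1 - u) (- t)"] ut by simp
    qed
    hence "cmod (1 - ?z) powr q \<le> (t + 2) powr q" using q by (intro powr_mono2) auto
    also have "\<dots> \<le> D * exp (t / 4)" using D(2) ut by simp
    finally have 1: "cmod ((1 - ?z) powr of_real q) \<le> D * exp (t / 4)" by (subst norm_powr_real_powr') auto
    have "cmod ((of_real y - 2 * \<i> * ?z) powr of_real p) \<le> y powr p + (y + 2 * t + 2) powr p"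
    proof (rule cmod_powr_le)
      have e: "of_real y - 2 * \<i> * ?z = Complex (y + 2 * t) (- 2 * u)" by (simp add: complex_eq_iff)
      show "y \<le> cmod (of_real y - 2 * \<i> * ?z)" unfolding e using complex_Re_le_cmod[of "Complex (y + 2 * t) (- 2 * u)"] ut by simp
      show "cmod (of_real y - 2 * \<i> * ?z) \<le> y + 2 * t + 2" unfolding e using cmod_le[of "Complex (y + 2 * t) (- 2 * u)"] ut y by simp
    qed (use y in auto)
    also have "(y + 2 * t + 2) powr p \<le> C * exp ((y + 2 * t) / 4)" using C(2)[of "y + 2 * t"] y ut by simp
    also have "C * exp ((y + 2 * t) / 4) = C * exp (y / 4) * exp (t / 2)" by (simp add: exp_add[symmetric] add_divide_distrib)
    also have "y powr p + C * exp (y / 4) * exp (t / 2) \<le> y powr p * exp (t / 2) + C * exp (y / 4) * exp (t / 2)"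
      using ut mult_left_mono[of 1 "exp (t / 2)" "y powr p"] by simp
    finally have 2: "cmod ((of_real y - 2 * \<i> * ?z) powr of_real p) \<le> (y powr p + C * exp (y / 4)) * exp (t / 2)"
      by (simp add: algebra_simps)
    have "cmod (exp (\<i> * of_real r * ?z)) = exp (- (r * t))" by (simp add: norm_exp_eq_Re)
    also have "\<dots> \<le> exp (- t)" using ut r by simp
    finally have "cmod (G ?z) \<le> exp (- t) * ((D * exp (t / 4)) * ((y powr p + C * exp (y / 4)) * exp (t / 2)))"
      unfolding G_def norm_mult using 1 2 D C by (intro mult_mono) auto
    also have "\<dots> = K * (exp (- t) * exp (t / 4) * exp (t / 2))" by (simp add: K_def)
    also have "exp (- t) * exp (t / 4) * exp (t / 2) = exp (- (1 / 4 * t))" by (simp add: exp_add[symmetric])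
    finally show ?thesis by (simp add: b_def)
  qed
  have a4: "set_integrable lborel {0<..} b"
  proof -
    have int: "integrable lborel (\<lambda>t. K * (indicat_real {0<..} t * (t powr (1 - 1) * exp (- (1 / 4 * t)))))"
      using has_bochner_integral_Gamma_Ioi[of 1 "1 / 4"] by (intro integrable_mult_right) (auto simp: has_bochner_integral_iff)
    have eq: "(\<lambda>t. K * (indicat_real {0<..} t * (t powr (1 - 1) * exp (- (1 / 4 * t))))) = (\<lambda>t. indicat_real {0<..} t *\<^sub>R b t)"
      by (auto simp: fun_eq_iff b_def indicator_def)
    show ?thesis unfolding set_integrable_def using int unfolding eq .
  qed
  have a5: "(b \<longlongrightarrow> 0) at_top"
  proof -
    have "((\<lambda>t. exp (- (1 / 4 * t :: real))) \<longlongrightarrow> 0) at_top" by real_asymp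
    hence "(b \<longlongrightarrow> K * 0) at_top" unfolding b_def by (intro tendsto_intros)
    thus ?thesis by simp
  qed
  have G_real: "G (of_real t) = of_real ((1 - t) powr q) * (cis (r * t) * (of_real y - 2 * \<i> * of_real t) powr of_real p)" if "0 \<le> t" "t \<le> 1" for t
  proof -
    have "complex_of_real (1 - t) powr of_real q = of_real ((1 - t) powr q)" using that by (intro powr_of_real) auto
    thus ?thesis by (simp add: G_def cis_conv_exp mult_ac)
  qed
  have contR: "continuous_on {0..1} (\<lambda>t. of_real ((1 - t) powr q) * (cis (r * t) * (of_real y - 2 * \<i> * of_real t) powr of_real p))"
  proof (intro continuous_on_mult)
    show "continuous_on {0..1} (\<lambda>t. complex_of_real ((1 - t) powr q))"
      using q by (intro continuous_on_of_real continuous_on_powr' continuous_intros) auto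
    show "continuous_on {0..1} (\<lambda>t. cis (r * t))" by (intro continuous_intros)
    show "continuous_on {0..1} (\<lambda>t. (of_real y - 2 * \<i> * complex_of_real t) powr of_real p)"
      using y by (intro continuous_on_powr_const continuous_intros) (auto simp: complex_nonpos_Reals_iff)
  qed
  have a6: "set_integrable lborel {0..1} (\<lambda>t. G (of_real t))"
    using borel_integrable_atLeastAtMost'[OF contR]
    by (rule set_integrable_cong[THEN iffD1, rotated -1]) (auto simp: G_real)
  have left: "G (Complex 0 x) = of_real (exp (- (r * x)) * (y + 2 * x) powr p) * (1 - \<i> * of_real x) powr of_real q" if x: "0 < x" for x
  proof -
    have e: "Complex 0 x = \<i> * of_real x" by (simp add: complex_eq_iff)
    have "of_real y - 2 * \<i> * (\<i> * of_real x) = complex_of_real (y + 2 * x)" by (simp add: complex_eq_iff)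
    moreover have "complex_of_real (y + 2 * x) powr of_real p = of_real ((y + 2 * x) powr p)" using x y by (intro powr_of_real) auto
    moreover have "\<i> * of_real r * (\<i> * of_real x) = of_real (- (r * x))" by (simp add: complex_eq_iff)
    ultimately show ?thesis unfolding G_def e by (simp only: exp_of_real of_real_mult mult_ac)
  qed
  have right: "G (Complex 1 x) = cis r * (of_real (exp (- (r * x))) * ((- \<i> * of_real x) powr of_real q * (of_real (y + 2 * x) - 2 * \<i>) powr of_real p))" for x
  proof -
    have "1 - Complex 1 x = - \<i> * of_real x" by (simp add: complex_eq_iff)
    moreover have "of_real y - 2 * \<i> * Complex 1 x = of_real (y + 2 * x) - 2 * \<i>" by (simp add: complex_eq_iff)
    moreover have "\<i> * of_real r * Complex 1 x = \<i> * of_real r + of_real (- (r * x))" by (simp add: complex_eq_iff)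
    ultimately show ?thesis unfolding G_def cis_conv_exp by (simp only: exp_add exp_of_real mult.assoc)
  qed
  have hs: "(CLINT t:{0..1}|lborel. G (of_real t)) = \<i> * (CLINT y:{0<..}|lborel. G (Complex 0 y)) - \<i> * (CLINT y:{0<..}|lborel. G (Complex 1 y))"
    by (rule half_strip_shift[where b = b]) (assumption | rule a1 a2 a3 a4 a5 a6)+
  have hi: "set_integrable lborel {0<..} (\<lambda>y. G (Complex u y))" if "u = 0 \<or> u = 1" for u
    by (rule half_strip_integrable[where b = b, OF _ _ _ _ _ _ that]) (assumption | rule a1 a2 a3 a4 a5 a6)+
  have R: "(CLINT t:{0..1}|lborel. G (of_real t)) = (CLINT s:{0..1}|lborel. of_real ((1 - s) powr q) * (cis (r * s) * (of_real y - 2 * \<i> * of_real s) powr of_real p))"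
    by (intro set_lebesgue_integral_cong) (auto simp: G_real)
  have L: "(CLINT x:{0<..}|lborel. G (Complex 0 x)) = (CLINT x:{0<..}|lborel. of_real (exp (- (r * x)) * (y + 2 * x) powr p) * (1 - \<i> * of_real x) powr of_real q)"
    by (intro set_lebesgue_integral_cong) (auto simp: left)
  show "(CLINT s:{0..1}|lborel. of_real ((1 - s) powr (2 * \<delta> - 1)) * (cis (r * s) * (of_real y - 2 * \<i> * of_real s) powr of_real (\<delta> - 1)))
      = \<i> * (CLINT x:{0<..}|lborel. of_real (exp (- (r * x)) * (y + 2 * x) powr (\<delta> - 1)) * (1 - \<i> * of_real x) powr of_real (2 * \<delta> - 1))
      - \<i> * (cis r * (CLINT x:{0<..}|lborel. of_real (exp (- (r * x))) * ((- \<i> * of_real x) powr of_real (2 * \<delta> - 1) * (of_real (y + 2 * x) - 2 * \<i>) powr of_real (\<delta> - 1))))"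
    using hs unfolding R L right set_integral_mult_right p_def q_def .
  show "set_integrable lborel {0<..} (\<lambda>x. of_real (exp (- (r * x)) * (y + 2 * x) powr (\<delta> - 1)) * (1 - \<i> * of_real x) powr of_real (2 * \<delta> - 1) :: complex)"
    unfolding p_def[symmetric] q_def[symmetric] using hi[of 0]
    by (subst set_integrable_cong[OF refl refl left[symmetric]]) auto
  show "set_integrable lborel {0<..} (\<lambda>x. cis r * (of_real (exp (- (r * x))) * ((- \<i> * of_real x) powr of_real (2 * \<delta> - 1) * (of_real (y + 2 * x) - 2 * \<i>) powr of_real (\<delta> - 1))))"
    using hi[of 1] unfolding right p_def q_def by simp
qed

end

section \<open>The remainder estimate\<close>

context
  fixes \<delta> :: real
  assumes \<delta>: "1 / 2 < \<delta>"
begin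

text \<open>The integral over s that remains after the first shift when the integration over the
  height y is taken last.\<close>

definition Q_inner :: "real \<Rightarrow> real \<Rightarrow> complex" where
  "Q_inner r y = (CLINT s:{0..1}|lborel. of_real ((1 - s) powr (2 * \<delta> - 1)) * (cis (r * s) * (of_real y - 2 * \<i> * of_real s) powr of_real (\<delta> - 1)))"

text \<open>\<open>first_shift\<close> is inserted into the first representation of \<open>Q\<close>
  and the order of integration is exchanged. The majorant contains y^(2 delta - 2), one factor
  y^(delta - 1) from the weight and one from y - 2 i s as s tends to 0; this is integrable because
  delta > 1/2.\<close>

lemma Q_double_integral:
  assumes r: "1 \<le> r"
  shows "has_bochner_integral lborel (\<lambda>y. indicat_real {0<..} y * (y powr (\<delta> - 1) * exp (- (r * y)) * Im (Q_inner r y)))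
     (Beta (1 / 2) \<delta> / 2 * Beta (2 * \<delta>) (2 * \<delta>) * Q \<delta> r)"
proof -
  let ?p = "\<delta> - 1" and ?q = "2 * \<delta> - 1"
  let ?A = "{0..1} \<times> {0<..} :: (real \<times> real) set"
  let ?h = "\<lambda>s y. of_real ((1 - s) powr ?q * (y powr ?p * exp (- (r * y)))) * (cis (r * s) * (of_real y - 2 * \<i> * of_real s) powr of_real ?p)"
  let ?H = "\<lambda>(s, y). indicat_real ?A (s, y) *\<^sub>R ?h s y"
  let ?I = "\<lambda>s. LINT t|lborel. indicat_real {0..s} t * (cos (r * t) * (s\<^sup>2 - t\<^sup>2) powr ?p)"
  let ?W = "\<lambda>s. CLINT y:{0<..}|lborel. of_real (y powr ?p * exp (- (r * y))) * (of_real y - 2 * \<i> * of_real s) powr of_real ?p"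
  obtain C where C: "0 < C" "\<And>x. 0 \<le> x \<Longrightarrow> (x + 2) powr ?p \<le> C * exp (x / 4)" by (rule powr_le_exp) blast
  let ?g = "\<lambda>y. indicat_real {0<..} y * (y powr (2 * \<delta> - 1 - 1) * exp (- (r * y))) + C * (indicat_real {0<..} y * (y powr (\<delta> - 1) * exp (- ((r - 1 / 4) * y))))"
  have contH: "continuous_on ?A (\<lambda>x. ?h (fst x) (snd x))"
  proof (intro continuous_on_mult continuous_on_of_real)
    show "continuous_on ?A (\<lambda>x. (1 - fst x) powr ?q)"
      using \<delta> by (intro continuous_on_powr' continuous_intros) auto
    show "continuous_on ?A (\<lambda>x. snd x powr ?p)" by (intro continuous_intros) auto
    show "continuous_on ?A (\<lambda>x. exp (- (r * snd x)))" "continuous_on ?A (\<lambda>x. cis (r * fst x))" by (intro continuous_intros)+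
    show "continuous_on ?A (\<lambda>x. (complex_of_real (snd x) - 2 * \<i> * complex_of_real (fst x)) powr of_real ?p)"
      by (intro continuous_on_powr_const continuous_intros) (auto simp: complex_nonpos_Reals_iff)
  qed
  have A: "?A \<in> sets borel" by (intro borel_Times) auto
  have Hi: "integrable (lborel \<Otimes>\<^sub>M lborel) ?H"
  proof (rule Bochner_Integration.integrable_bound)
    show "integrable (lborel \<Otimes>\<^sub>M lborel) (\<lambda>(s::real, y). indicat_real {0..1} s * ?g y)"
    proof (rule integrable_product_lborel)
      show "integrable lborel (indicat_real {0..1::real})" by (rule integrable_real_indicator) auto
      show "integrable lborel ?g"
        using has_bochner_integral_Gamma_Ioi[of "2 * \<delta> - 1" r] has_bochner_integral_Gamma_Ioi[of \<delta> "r - 1 / 4"] r \<delta>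
        by (intro Bochner_Integration.integrable_add integrable_mult_right) (auto simp: has_bochner_integral_iff)
    qed
    have "(\<lambda>x. indicat_real ?A x *\<^sub>R ?h (fst x) (snd x)) \<in> borel_measurable borel"
      by (rule borel_measurable_continuous_on_indicator[OF A contH])
    thus "?H \<in> borel_measurable (lborel \<Otimes>\<^sub>M lborel)" by (simp add: lborel_prod case_prod_beta')
    show "AE x in lborel \<Otimes>\<^sub>M lborel. norm (?H x) \<le> norm (case x of (s, y) \<Rightarrow> indicat_real {0..1} s * ?g y)"
    proof (rule AE_I2, clarify)
      fix s y :: real
      show "norm (indicat_real ?A (s, y) *\<^sub>R ?h s y) \<le> norm (indicat_real {0..1} s * ?g y)"
      proof (cases "(s, y) \<in> ?A")
        case True
        hence sy: "0 \<le> s" "s \<le> 1" "0 < y" by auto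
        have e: "of_real y - 2 * \<i> * of_real s = Complex y (- 2 * s)" by (simp add: complex_eq_iff)
        have "cmod ((of_real y - 2 * \<i> * of_real s) powr of_real ?p) \<le> y powr ?p + (y + 2) powr ?p"
          unfolding e using sy complex_Re_le_cmod[of "Complex y (- 2 * s)"] cmod_le[of "Complex y (- 2 * s)"]
          by (intro cmod_powr_le) auto
        also have "(y + 2) powr ?p \<le> C * exp (y / 4)" using C(2)[of y] sy by simp
        finally have 1: "cmod ((of_real y - 2 * \<i> * of_real s) powr of_real ?p) \<le> y powr ?p + C * exp (y / 4)" by simp
        have 2: "(1 - s) powr ?q \<le> 1" using sy \<delta> by (intro powr_le1) auto
        have "norm (?h s y) = ((1 - s) powr ?q * cmod ((of_real y - 2 * \<i> * of_real s) powr of_real ?p)) * (y powr ?p * exp (- (r * y)))"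
          unfolding norm_mult norm_of_real norm_cis by (simp add: abs_mult)
        also have "\<dots> \<le> (1 * (y powr ?p + C * exp (y / 4))) * (y powr ?p * exp (- (r * y)))"
          using 1 2 C by (intro mult_right_mono mult_mono) auto
        also have "\<dots> = ?g y"
        proof -
          have "y powr (2 * \<delta> - 1 - 1) = y powr ?p * y powr ?p" by (simp add: powr_add[symmetric])
          moreover have "exp (- ((r - 1 / 4) * y)) = exp (y / 4) * exp (- (r * y))" by (simp add: exp_add[symmetric] algebra_simps)
          ultimately show ?thesis using sy by (simp add: algebra_simps)
        qed
        finally have "norm (?h s y) \<le> ?g y" .
        thus ?thesis using True sy by (simp add: indicator_def order_trans[OF _ abs_ge_self])
      qed simp
    qed
  qed
  have Ws: "(LINT y|lborel. ?H (s, y)) = indicat_real {0..1} s *\<^sub>R (of_real ((1 - s) powr ?q) * (cis (r * s) * ?W s))" for s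
  proof (cases "s \<in> {0..1}")
    case True
    have "(\<lambda>y. ?H (s, y)) = (\<lambda>y. (of_real ((1 - s) powr ?q) * cis (r * s)) * (indicat_real {0<..} y *\<^sub>R (of_real (y powr ?p * exp (- (r * y))) * (of_real y - 2 * \<i> * of_real s) powr of_real ?p)))"
      using True by (auto simp: fun_eq_iff indicator_def)
    thus ?thesis using True by (simp only: integral_mult_right_zero set_lebesgue_integral_def) simp
  next
    case False
    hence "(\<lambda>y. ?H (s, y)) = (\<lambda>y. 0)" by (auto simp: fun_eq_iff indicator_def)
    thus ?thesis using False by (simp only:) simp
  qed
  have Jy: "(LINT s|lborel. ?H (s, y)) = indicat_real {0<..} y *\<^sub>R (of_real (y powr ?p * exp (- (r * y))) * Q_inner r y)" for y
  proof (cases "0 < y")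
    case True
    have "(\<lambda>s. ?H (s, y)) = (\<lambda>s. of_real (y powr ?p * exp (- (r * y))) * (indicat_real {0..1} s *\<^sub>R (of_real ((1 - s) powr ?q) * (cis (r * s) * (of_real y - 2 * \<i> * of_real s) powr of_real ?p))))"
      using True by (auto simp: fun_eq_iff indicator_def)
    thus ?thesis using True by (simp only: integral_mult_right_zero Q_inner_def set_lebesgue_integral_def) simp
  next
    case False
    hence "(\<lambda>s. ?H (s, y)) = (\<lambda>s. 0)" by (auto simp: fun_eq_iff indicator_def)
    thus ?thesis using False by (simp only:) simp
  qed
  have iy: "integrable lborel (\<lambda>y. LINT s|lborel. ?H (s, y))"
    using lborel_pair.integrable_snd[of "\<lambda>s y. ?H (s, y)"] Hi by simp
  have is': "integrable lborel (\<lambda>s. LINT y|lborel. ?H (s, y))"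
    using lborel_pair.integrable_fst[of "\<lambda>s y. ?H (s, y)"] Hi by simp
  have fub: "(LINT y|lborel. LINT s|lborel. ?H (s, y)) = (LINT s|lborel. LINT y|lborel. ?H (s, y))"
    using lborel_pair.Fubini_integral[of "\<lambda>s y. ?H (s, y)"] Hi by simp
  have Im_y: "Im (LINT s|lborel. ?H (s, y)) = indicat_real {0<..} y * (y powr ?p * exp (- (r * y)) * Im (Q_inner r y))" for y
    unfolding Jy by simp
  have "integrable lborel (\<lambda>y. Im (LINT s|lborel. ?H (s, y)))" by (rule integrable_Im[OF iy])
  hence int: "integrable lborel (\<lambda>y. indicat_real {0<..} y * (y powr ?p * exp (- (r * y)) * Im (Q_inner r y)))" by (simp only: Im_y)
  have "(LINT y|lborel. indicat_real {0<..} y * (y powr ?p * exp (- (r * y)) * Im (Q_inner r y))) = Im (LINT y|lborel. LINT s|lborel. ?H (s, y))"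
    unfolding Im_y[symmetric] by (rule integral_Im[OF iy])
  also have "\<dots> = Im (LINT s|lborel. LINT y|lborel. ?H (s, y))" by (simp only: fub)
  also have "\<dots> = (LINT s|lborel. Im (LINT y|lborel. ?H (s, y)))" by (rule integral_Im[OF is', symmetric])
  also have "\<dots> = (LINT s|lborel. Beta (1 / 2) \<delta> / 2 * (indicat_real {0..1} s * (Omega (\<delta> - 1 / 2) (r * s) * (1 - s) powr ?q * s powr ?q)))"
  proof (rule integral_cong_AE)
    have "AE s in lborel. s \<noteq> (0::real)" by (rule AE_lborel_singleton)
    thus "AE s in lborel. Im (LINT y|lborel. ?H (s, y)) = Beta (1 / 2) \<delta> / 2 * (indicat_real {0..1} s * (Omega (\<delta> - 1 / 2) (r * s) * (1 - s) powr ?q * s powr ?q))"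
    proof eventually_elim
      fix s :: real assume s0: "s \<noteq> 0"
      show "Im (LINT y|lborel. ?H (s, y)) = Beta (1 / 2) \<delta> / 2 * (indicat_real {0..1} s * (Omega (\<delta> - 1 / 2) (r * s) * (1 - s) powr ?q * s powr ?q))"
      proof (cases "s \<in> {0..1}")
        case True
        hence s: "0 < s" "s \<le> 1" using s0 by auto
        have "?I s = s powr ?q * Beta (1 / 2) \<delta> / 2 * Omega (\<delta> - 1 / 2) (r * s)"
          using Poisson_Omega[of s \<delta> r] s \<delta> by (simp add: has_bochner_integral_iff)
        hence "Im (cis (r * s) * ?W s) = s powr ?q * Beta (1 / 2) \<delta> / 2 * Omega (\<delta> - 1 / 2) (r * s)"
          using first_shift[OF \<delta> r s] by (simp only:)
        moreover have "Im (indicat_real {0..1} s *\<^sub>R (of_real ((1 - s) powr ?q) * (cis (r * s) * ?W s))) = (1 - s) powr ?q * Im (cis (r * s) * ?W s)"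
        proof -
          have "Im (indicat_real {0..1} s *\<^sub>R (of_real a * w)) = a * Im w" for a w using True by simp
          thus ?thesis .
        qed
        ultimately show ?thesis unfolding Ws using True by simp
      next
        case False
        thus ?thesis unfolding Ws by simp
      qed
    qed
    show "(\<lambda>s. Im (LINT y|lborel. ?H (s, y))) \<in> borel_measurable lborel"
      by (rule borel_measurable_integrable[OF integrable_Im[OF is']])
    have "0 < \<delta>" using \<delta> by simp
    from borel_measurable_has_bochner_integral[OF has_bochner_integral_mult_right[OF Q_first_integral[OF this, of r]]]
    show "(\<lambda>s. Beta (1 / 2) \<delta> / 2 * (indicat_real {0..1} s * (Omega (\<delta> - 1 / 2) (r * s) * (1 - s) powr ?q * s powr ?q))) \<in> borel_measurable lborel" .
  qed
  also have "\<dots> = Beta (1 / 2) \<delta> / 2 * (Beta (2 * \<delta>) (2 * \<delta>) * Q \<delta> r)"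
    using Q_first_integral[of \<delta> r] \<delta> by (simp add: has_bochner_integral_iff)
  finally show ?thesis using int by (simp add: has_bochner_integral_iff)
qed

lemma has_bochner_integral_Gamma_const:
  assumes "0 < a" "1 \<le> r"
  shows "has_bochner_integral lborel (\<lambda>t. indicat_real {0<..} t * (c * (t powr (a - 1) * exp (- (r / 2 * t))))) (c * (Gamma a / (r / 2) powr a))"
proof -
  have "has_bochner_integral lborel (\<lambda>t. c * (indicat_real {0<..} t * (t powr (a - 1) * exp (- (r / 2 * t))))) (c * (Gamma a / (r / 2) powr a))"
    using assms by (intro has_bochner_integral_mult_right has_bochner_integral_Gamma_Ioi) auto
  thus ?thesis by (simp only: mult.left_commute)
qed

text \<open>Counting orders: replacing the real part of (1 - i x)^q by 1 costs x^2, giving r^(-3)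
  y^(delta - 1) and r^(-delta - 2) after integration in x; integrating against y^(delta - 1) makes
  both r^(-2 delta - 2). The edge at s = 1 gives r^(-2 delta), then a further r^(-delta). The
  argument r/2 appears because half of the exponential decay is spent on the factors exp(x/4),
  exp(x/2) and exp(y/4).\<close>

lemma Q_remainder:
  obtains K where "\<And>r. 1 \<le> r \<Longrightarrow>
    \<bar>Beta (1 / 2) \<delta> / 2 * Beta (2 * \<delta>) (2 * \<delta>) * Q \<delta> r - Beta (1 / 2) \<delta> / 2 * (Gamma (2 * \<delta>) / r powr (2 * \<delta>))\<bar>
      \<le> K * ((r / 2) powr (- (2 * \<delta> + 2)) + (r / 2) powr (- (3 * \<delta>)))"
proof -
  define p where "p = \<delta> - 1"
  define q where "q = 2 * \<delta> - 1"
  have q: "0 < q" using \<delta> by (simp add: q_def)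
  obtain C1 where C1: "0 < C1" "\<And>x. 0 \<le> x \<Longrightarrow> \<bar>Re ((1 - \<i> * of_real x) powr of_real q) - 1\<bar> \<le> C1 * (x\<^sup>2 * exp (x / 4))"
    by (rule Re_powr_one_minus[OF q]) blast
  obtain C2 where C2: "0 < C2" "\<And>x. 0 \<le> x \<Longrightarrow> (x + 2) powr p \<le> C2 * exp (x / 4)" by (rule powr_le_exp) blast
  define K1 where "K1 = C1 * (1 + 3 powr p) * Gamma 3 * Gamma (2 * \<delta> - 1) + C1 * 3 powr p * Gamma (\<delta> + 2) * Gamma \<delta>"
  define K2 where "K2 = 2 * C2 * Gamma (2 * \<delta>) * Gamma \<delta>"
  have Gp: "0 < Gamma (3::real)" "0 < Gamma (2 * \<delta> - 1)" "0 < Gamma (\<delta> + 2)" "0 < Gamma \<delta>" "0 < Gamma (2 * \<delta>)"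
    using \<delta> by (auto intro!: Gamma_real_pos)
  have Kp: "0 \<le> K1" "0 \<le> K2" using Gp C1(1) C2(1) by (auto simp: K1_def K2_def intro!: add_nonneg_nonneg mult_nonneg_nonneg)
  have main: "\<bar>Beta (1 / 2) \<delta> / 2 * Beta (2 * \<delta>) (2 * \<delta>) * Q \<delta> r - Beta (1 / 2) \<delta> / 2 * (Gamma (2 * \<delta>) / r powr (2 * \<delta>))\<bar>
      \<le> K1 * (r / 2) powr (- (2 * \<delta> + 2)) + K2 * (r / 2) powr (- (3 * \<delta>))" if r: "1 \<le> r" for r
  proof -
    let ?A0 = "\<lambda>y. LINT x|lborel. indicat_real {0<..} x * (exp (- (r * x)) * (y + 2 * x) powr p)"
    define e1 where "e1 = C1 * (1 + 3 powr p) * (Gamma 3 / (r / 2) powr 3)"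
    define e2 where "e2 = C1 * 3 powr p * (Gamma (\<delta> + 2) / (r / 2) powr (\<delta> + 2))"
    define e3 where "e3 = 2 * C2 * (Gamma (2 * \<delta>) / (r / 2) powr (2 * \<delta>))"
    have e: "0 \<le> e1" "0 \<le> e2" "0 \<le> e3" unfolding e1_def e2_def e3_def using Gp C1(1) C2(1) r by auto
    have inner: "\<bar>Im (Q_inner r y) - ?A0 y\<bar> \<le> e1 * y powr p + e2 + e3 * exp (y / 4)" if y: "0 < y" for y
    proof -
      let ?u = "\<lambda>x. exp (- (r * x)) * (y + 2 * x) powr p"
      let ?U = "CLINT x:{0<..}|lborel. of_real (?u x) * (1 - \<i> * of_real x) powr of_real q"
      let ?v = "\<lambda>x. cis r * (of_real (exp (- (r * x))) * ((- \<i> * of_real x) powr of_real q * (of_real (y + 2 * x) - 2 * \<i>) powr of_real p))"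
      let ?V = "CLINT x:{0<..}|lborel. ?v x"
      note sh = second_shift[OF \<delta> r y, folded p_def q_def]
      have J: "Q_inner r y = \<i> * ?U - \<i> * ?V"
        unfolding Q_inner_def p_def[symmetric] q_def[symmetric] sh(1) set_integral_mult_right ..
      hence Im: "Im (Q_inner r y) = Re ?U - Re ?V" by simp
      have A0i: "integrable lborel (\<lambda>x. indicat_real {0<..} x * ?u x)"
        using integrable_main_inner[OF \<delta> _ y, of r] r by (simp add: p_def)
      have Ui: "integrable lborel (\<lambda>x. indicat_real {0<..} x *\<^sub>R (of_real (?u x) * (1 - \<i> * of_real x) powr of_real q :: complex))"
        using sh(2) by (simp only: set_integrable_def)
      have Vi: "integrable lborel (\<lambda>x. indicat_real {0<..} x *\<^sub>R ?v x)"
        using sh(3) by (simp only: set_integrable_def)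
      have ReU: "Re ?U = (LINT x|lborel. indicat_real {0<..} x * (?u x * Re ((1 - \<i> * of_real x) powr of_real q)))"
        unfolding set_lebesgue_integral_def integral_Re[OF Ui, symmetric] by simp
      have ReUi: "integrable lborel (\<lambda>x. indicat_real {0<..} x * (?u x * Re ((1 - \<i> * of_real x) powr of_real q)))"
        using integrable_Re[OF Ui] by simp
      have dif: "Re ?U - ?A0 y = (LINT x|lborel. indicat_real {0<..} x * (?u x * Re ((1 - \<i> * of_real x) powr of_real q)) - indicat_real {0<..} x * ?u x)"
        unfolding ReU by (rule Bochner_Integration.integral_diff[OF ReUi A0i, symmetric])
      let ?g1 = "\<lambda>x. indicat_real {0<..} x * (C1 * (1 + 3 powr p) * y powr p * (x powr (3 - 1) * exp (- (r / 2 * x))))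
         + indicat_real {0<..} x * (C1 * 3 powr p * (x powr (\<delta> + 2 - 1) * exp (- (r / 2 * x))))"
      have g1: "has_bochner_integral lborel ?g1 (C1 * (1 + 3 powr p) * y powr p * (Gamma 3 / (r / 2) powr 3) + C1 * 3 powr p * (Gamma (\<delta> + 2) / (r / 2) powr (\<delta> + 2)))"
        using r \<delta> by (intro has_bochner_integral_add has_bochner_integral_Gamma_const) auto
      have b1: "norm (indicat_real {0<..} x * (?u x * Re ((1 - \<i> * of_real x) powr of_real q)) - indicat_real {0<..} x * ?u x) \<le> ?g1 x" for x
      proof (cases "0 < x")
        case True
        have "norm (indicat_real {0<..} x * (?u x * Re ((1 - \<i> * of_real x) powr of_real q)) - indicat_real {0<..} x * ?u x)
          = (y + 2 * x) powr p * (exp (- (r * x)) * \<bar>Re ((1 - \<i> * of_real x) powr of_real q) - 1\<bar>)"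
        proof -
          have "U * R - U = U * (R - 1)" for U R :: real by (simp add: algebra_simps)
          thus ?thesis using True by (simp add: abs_mult)
        qed
        also have "\<dots> \<le> ((1 + 3 powr p) * y powr p + 3 powr p * x powr p) * (exp (- (r * x)) * (C1 * (x\<^sup>2 * exp (x / 4))))"
          using C1(2)[of x] True y powr_add_double_le[OF True y, of p] by (intro mult_mono) auto
        also have "exp (- (r * x)) * (C1 * (x\<^sup>2 * exp (x / 4))) = C1 * (x\<^sup>2 * exp (x / 4 - r * x))"
        proof -
          have "exp (x / 4 - r * x) = exp (x / 4) * exp (- (r * x))" by (simp add: exp_add[symmetric])
          thus ?thesis by simp
        qed
        also have "((1 + 3 powr p) * y powr p + 3 powr p * x powr p) * (C1 * (x\<^sup>2 * exp (x / 4 - r * x)))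
           \<le> ((1 + 3 powr p) * y powr p + 3 powr p * x powr p) * (C1 * (x\<^sup>2 * exp (- (r / 2 * x))))"
        proof -
          have "x \<le> r * x" using True r by simp
          hence "x / 4 - r * x \<le> - (r / 2 * x)" using True by linarith
          thus ?thesis using C1(1) by (intro mult_left_mono) auto
        qed
        also have "\<dots> = ?g1 x"
        proof -
          have "x powr (3 - 1) = x\<^sup>2" using True by simp
          moreover have "x powr (\<delta> + 2 - 1) = x powr p * x\<^sup>2"
          proof -
            have "\<delta> + 2 - 1 = p + 2" by (simp add: p_def)
            thus ?thesis using True by (simp only: powr_add) simp
          qed
          ultimately show ?thesis using True by (simp add: algebra_simps)
        qed
        finally show ?thesis .
      qed simp
      have "\<bar>Re ?U - ?A0 y\<bar> \<le> (LINT x|lborel. ?g1 x)"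
        unfolding dif real_norm_def[symmetric]
        by (rule Bochner_Integration.integral_norm_bound_integral[OF Bochner_Integration.integrable_diff[OF ReUi A0i] integrable.intros[OF g1] b1])
      also have "\<dots> = e1 * y powr p + e2"
        unfolding has_bochner_integral_integral_eq[OF g1] by (simp add: e1_def e2_def)
      finally have B1: "\<bar>Re ?U - ?A0 y\<bar> \<le> e1 * y powr p + e2" .
      let ?g2 = "\<lambda>x. indicat_real {0<..} x * (2 * C2 * exp (y / 4) * (x powr (2 * \<delta> - 1) * exp (- (r / 2 * x))))"
      have g2: "has_bochner_integral lborel ?g2 (2 * C2 * exp (y / 4) * (Gamma (2 * \<delta>) / (r / 2) powr (2 * \<delta>)))"
        using r \<delta> by (intro has_bochner_integral_Gamma_const) auto
      have b2: "norm (indicat_real {0<..} x *\<^sub>R ?v x) \<le> ?g2 x" for x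
      proof (cases "0 < x")
        case True
        have ew: "of_real (y + 2 * x) - 2 * \<i> = Complex (y + 2 * x) (- 2)" by (simp add: complex_eq_iff)
        have "cmod ((of_real (y + 2 * x) - 2 * \<i>) powr of_real p) \<le> 2 powr p + (y + 2 * x + 2) powr p"
          unfolding ew using abs_Im_le_cmod[of "Complex (y + 2 * x) (- 2)"] cmod_le[of "Complex (y + 2 * x) (- 2)"] True y
          by (intro cmod_powr_le) auto
        also have "2 powr p \<le> C2 * exp ((y + 2 * x) / 4)"
        proof -
          have "2 powr p \<le> C2 * exp 0" using C2(2)[of 0] by simp
          also have "\<dots> \<le> C2 * exp ((y + 2 * x) / 4)" using C2(1) True y by (intro mult_left_mono) auto
          finally show ?thesis .
        qed
        also have "(y + 2 * x + 2) powr p \<le> C2 * exp ((y + 2 * x) / 4)" using C2(2)[of "y + 2 * x"] True y by simp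
        finally have w: "cmod ((of_real (y + 2 * x) - 2 * \<i>) powr of_real p) \<le> 2 * C2 * exp ((y + 2 * x) / 4)" by simp
        have "cmod ((- \<i> * of_real x) powr of_real q) = x powr q"
          by (subst norm_powr_real_powr') (use True in \<open>auto simp: norm_mult\<close>)
        hence "norm (indicat_real {0<..} x *\<^sub>R ?v x) = exp (- (r * x)) * (x powr q * cmod ((of_real (y + 2 * x) - 2 * \<i>) powr of_real p))"
          using True by (simp add: norm_mult)
        also have "\<dots> \<le> exp (- (r * x)) * (x powr q * (2 * C2 * exp ((y + 2 * x) / 4)))"
          using w by (intro mult_left_mono) auto
        also have "\<dots> = 2 * C2 * exp (y / 4) * (x powr q * exp (x / 2 - r * x))"
        proof -
          have "exp ((y + 2 * x) / 4) = exp (y / 4) * exp (x / 2)" by (simp add: exp_add[symmetric] add_divide_distrib)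
          moreover have "exp (x / 2 - r * x) = exp (x / 2) * exp (- (r * x))" by (simp add: exp_add[symmetric])
          ultimately show ?thesis by (simp add: mult_ac)
        qed
        also have "\<dots> \<le> 2 * C2 * exp (y / 4) * (x powr q * exp (- (r / 2 * x)))"
        proof -
          have "x \<le> r * x" using True r by simp
          hence "x / 2 - r * x \<le> - (r / 2 * x)" by linarith
          thus ?thesis using C2(1) by (intro mult_left_mono) auto
        qed
        also have "\<dots> = ?g2 x" using True by (simp add: q_def)
        finally show ?thesis .
      qed simp
      have "\<bar>Re ?V\<bar> \<le> cmod ?V" by (rule abs_Re_le_cmod)
      also have "\<dots> \<le> (LINT x|lborel. ?g2 x)"
        unfolding set_lebesgue_integral_def
        by (rule Bochner_Integration.integral_norm_bound_integral[OF Vi integrable.intros[OF g2] b2])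
      also have "\<dots> = e3 * exp (y / 4)"
        unfolding has_bochner_integral_integral_eq[OF g2] by (simp add: e3_def)
      finally have "\<bar>Re ?V\<bar> \<le> e3 * exp (y / 4)" .
      thus ?thesis using B1 unfolding Im by linarith
    qed
    have d0: "0 < r" using r by simp
    let ?P = "\<lambda>y. y powr p * exp (- (r * y))"
    have QI: "has_bochner_integral lborel (\<lambda>y. indicat_real {0<..} y * (?P y * Im (Q_inner r y)) - indicat_real {0<..} y * (?P y * ?A0 y))
       (Beta (1 / 2) \<delta> / 2 * Beta (2 * \<delta>) (2 * \<delta>) * Q \<delta> r - Beta (1 / 2) \<delta> / 2 * (Gamma (2 * \<delta>) / r powr (2 * \<delta>)))"
      unfolding p_def by (intro has_bochner_integral_diff Q_double_integral[OF r] has_bochner_integral_main_term[OF \<delta> d0])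
    let ?g = "\<lambda>y. indicat_real {0<..} y * (e1 * (y powr (2 * \<delta> - 1 - 1) * exp (- (r / 2 * y))))
        + indicat_real {0<..} y * ((e2 + e3) * (y powr (\<delta> - 1) * exp (- (r / 2 * y))))"
    have g: "has_bochner_integral lborel ?g (e1 * (Gamma (2 * \<delta> - 1) / (r / 2) powr (2 * \<delta> - 1)) + (e2 + e3) * (Gamma \<delta> / (r / 2) powr \<delta>))"
      using r \<delta> by (intro has_bochner_integral_add has_bochner_integral_Gamma_const) auto
    have b: "norm (indicat_real {0<..} y * (?P y * Im (Q_inner r y)) - indicat_real {0<..} y * (?P y * ?A0 y)) \<le> ?g y" for y
    proof (cases "0 < y")
      case True
      have yr: "y \<le> r * y" using True r by simp
      have "norm (indicat_real {0<..} y * (?P y * Im (Q_inner r y)) - indicat_real {0<..} y * (?P y * ?A0 y)) = ?P y * \<bar>Im (Q_inner r y) - ?A0 y\<bar>"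
      proof -
        have "P * a - P * b = P * (a - b)" for P a b :: real by (simp add: algebra_simps)
        thus ?thesis using True by (simp add: abs_mult)
      qed
      also have "\<dots> \<le> ?P y * (e1 * y powr p + e2 + e3 * exp (y / 4))" using inner[OF True] by (intro mult_left_mono) auto
      also have "\<dots> = e1 * (y powr (2 * \<delta> - 1 - 1) * exp (- (r * y))) + y powr p * (e2 * exp (- (r * y)) + e3 * exp (y / 4 - r * y))"
      proof -
        have "y powr (2 * \<delta> - 1 - 1) = y powr p * y powr p" by (simp add: p_def powr_add[symmetric])
        moreover have "exp (y / 4 - r * y) = exp (y / 4) * exp (- (r * y))" by (simp add: exp_add[symmetric])
        ultimately show ?thesis by (simp add: algebra_simps)
      qed
      also have "\<dots> \<le> e1 * (y powr (2 * \<delta> - 1 - 1) * exp (- (r / 2 * y))) + y powr p * (e2 * exp (- (r / 2 * y)) + e3 * exp (- (r / 2 * y)))"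
      proof -
        have "- (r * y) \<le> - (r / 2 * y)" "y / 4 - r * y \<le> - (r / 2 * y)" using yr True by linarith+
        thus ?thesis using e by (intro add_mono mult_left_mono) auto
      qed
      also have "\<dots> = ?g y" using True by (simp add: p_def algebra_simps)
      finally show ?thesis .
    qed simp
    have "\<bar>Beta (1 / 2) \<delta> / 2 * Beta (2 * \<delta>) (2 * \<delta>) * Q \<delta> r - Beta (1 / 2) \<delta> / 2 * (Gamma (2 * \<delta>) / r powr (2 * \<delta>))\<bar> \<le> (LINT y|lborel. ?g y)"
      unfolding has_bochner_integral_integral_eq[OF QI, symmetric] real_norm_def[symmetric]
      by (rule Bochner_Integration.integral_norm_bound_integral[OF integrable.intros[OF QI] integrable.intros[OF g] b])
    also have "\<dots> = e1 * (Gamma (2 * \<delta> - 1) / (r / 2) powr (2 * \<delta> - 1)) + (e2 + e3) * (Gamma \<delta> / (r / 2) powr \<delta>)"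
      by (rule has_bochner_integral_integral_eq[OF g])
    also have "\<dots> = K1 * (r / 2) powr (- (2 * \<delta> + 2)) + K2 * (r / 2) powr (- (3 * \<delta>))"
    proof -
      define R where "R = r / 2"
      have R: "0 < R" using r by (simp add: R_def)
      have s: "A / R powr a * (B / R powr b) = A * B * R powr (- (a + b))" for A B a b
      proof -
        have "R powr (- (a + b)) = 1 / (R powr a * R powr b)" by (simp only: powr_minus_divide powr_add)
        thus ?thesis by simp
      qed
      have 1: "3 + (2 * \<delta> - 1) = 2 * \<delta> + 2" "\<delta> + 2 + \<delta> = 2 * \<delta> + 2" "2 * \<delta> + \<delta> = 3 * \<delta>" by simp_all
      have "e1 * (Gamma (2 * \<delta> - 1) / R powr (2 * \<delta> - 1)) = C1 * (1 + 3 powr p) * (Gamma 3 * Gamma (2 * \<delta> - 1) * R powr (- (2 * \<delta> + 2)))"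
        using s[of "Gamma 3" 3 "Gamma (2 * \<delta> - 1)" "2 * \<delta> - 1"] unfolding e1_def R_def[symmetric] 1 by (simp only: mult.assoc)
      moreover have "e2 * (Gamma \<delta> / R powr \<delta>) = C1 * 3 powr p * (Gamma (\<delta> + 2) * Gamma \<delta> * R powr (- (2 * \<delta> + 2)))"
        using s[of "Gamma (\<delta> + 2)" "\<delta> + 2" "Gamma \<delta>" \<delta>] unfolding e2_def R_def[symmetric] 1 by (simp only: mult.assoc)
      moreover have "e3 * (Gamma \<delta> / R powr \<delta>) = 2 * C2 * (Gamma (2 * \<delta>) * Gamma \<delta> * R powr (- (3 * \<delta>)))"
        using s[of "Gamma (2 * \<delta>)" "2 * \<delta>" "Gamma \<delta>" \<delta>] unfolding e3_def R_def[symmetric] 1 by (simp only: mult.assoc)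
      ultimately show ?thesis unfolding R_def[symmetric] distrib_right[of e2 e3] K1_def K2_def
        by (simp only:) (simp add: algebra_simps)
    qed
    finally show ?thesis .
  qed
  show ?thesis
  proof (rule that[of "K1 + K2"])
    fix r :: real assume r: "1 \<le> r"
    have "K1 * (r / 2) powr (- (2 * \<delta> + 2)) + K2 * (r / 2) powr (- (3 * \<delta>))
      \<le> (K1 + K2) * (r / 2) powr (- (2 * \<delta> + 2)) + (K1 + K2) * (r / 2) powr (- (3 * \<delta>))"
      using Kp by (intro add_mono mult_right_mono) auto
    thus "\<bar>Beta (1 / 2) \<delta> / 2 * Beta (2 * \<delta>) (2 * \<delta>) * Q \<delta> r - Beta (1 / 2) \<delta> / 2 * (Gamma (2 * \<delta>) / r powr (2 * \<delta>))\<bar>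
      \<le> (K1 + K2) * ((r / 2) powr (- (2 * \<delta> + 2)) + (r / 2) powr (- (3 * \<delta>)))"
      using main[OF r] by (simp add: distrib_left)
  qed
qed

end

subsection \<open>Decay and Fourier inversion of \<open>Q\<close>\<close>

lemma Q_0: "Q \<delta> 0 = 1"
  unfolding Q_eq_even_series even_series_0 by (simp add: Q_coeff_def)

lemma isCont_Q:
  assumes "0 < \<delta>"
  shows "isCont (Q \<delta>) r"
proof -
  have "Q \<delta> = even_series (Q_coeff \<delta>)" by (rule ext) (rule Q_eq_even_series)
  thus ?thesis using isCont_even_series[OF abs_Q_coeff_le[OF assms]] by simp
qed

lemma Q_asymptotic:
  assumes \<delta>: "1 / 2 < \<delta>"
  shows "(\<lambda>r. Q \<delta> r - Gamma (4 * \<delta>) / Gamma (2 * \<delta>) * r powr (- 2 * \<delta>))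
        \<in> O[at_top](\<lambda>r. r powr (- min (2 * \<delta> + 2) (3 * \<delta>)))"
proof -
  define m where "m = min (2 * \<delta> + 2) (3 * \<delta>)"
  define \<kappa> where "\<kappa> = Beta (1 / 2) \<delta> / 2 * Beta (2 * \<delta>) (2 * \<delta>)"
  have B: "0 < Beta (1 / 2) \<delta>" "0 < Beta (2 * \<delta>) (2 * \<delta>)" "0 < Gamma (2 * \<delta>)" "0 < Gamma (4 * \<delta>)"
    using \<delta> by (auto intro!: Beta_pos Gamma_real_pos)
  hence \<kappa>: "0 < \<kappa>" by (simp add: \<kappa>_def)
  obtain K where K: "\<And>r. 1 \<le> r \<Longrightarrow>
    \<bar>\<kappa> * Q \<delta> r - Beta (1 / 2) \<delta> / 2 * (Gamma (2 * \<delta>) / r powr (2 * \<delta>))\<bar>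
      \<le> K * ((r / 2) powr (- (2 * \<delta> + 2)) + (r / 2) powr (- (3 * \<delta>)))"
    unfolding \<kappa>_def by (rule Q_remainder[OF \<delta>]) blast
  define M where "M = \<bar>K\<bar> * (2 powr (2 * \<delta> + 2) + 2 powr (3 * \<delta>)) / \<kappa>"
  have "norm (Q \<delta> r - Gamma (4 * \<delta>) / Gamma (2 * \<delta>) * r powr (- 2 * \<delta>)) \<le> M * norm (r powr (- m))" if r: "1 \<le> r" for r
  proof -
    have sc: "(r / 2) powr (- a) \<le> 2 powr a * r powr (- m)" if "m \<le> a" for a
    proof -
      have "(r / 2) powr (- a) = r powr (- a) / 2 powr (- a)" using r by (simp add: powr_divide)
      also have "\<dots> = 2 powr a * r powr (- a)" by (simp add: powr_minus_divide)
      also have "\<dots> \<le> 2 powr a * r powr (- m)" using r that by (intro mult_left_mono powr_mono) auto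
      finally show ?thesis .
    qed
    \<comment> \<open>Dividing by \<kappa> leaves Gamma(2 delta) / Beta(2 delta, 2 delta), which is
      the constant Gamma(4 delta) / Gamma(2 delta) of the main term.\<close>
    have "Beta (1 / 2) \<delta> / 2 * (Gamma (2 * \<delta>) / r powr (2 * \<delta>)) = \<kappa> * (Gamma (4 * \<delta>) / Gamma (2 * \<delta>) * r powr (- 2 * \<delta>))"
    proof -
      have "Beta (2 * \<delta>) (2 * \<delta>) = Gamma (2 * \<delta>) * Gamma (2 * \<delta>) / Gamma (4 * \<delta>)" by (simp add: Beta_def)
      moreover have "r powr (- 2 * \<delta>) = 1 / r powr (2 * \<delta>)" by (simp add: powr_minus_divide)
      ultimately show ?thesis unfolding \<kappa>_def using B by simp
    qed
    hence "\<bar>\<kappa> * (Q \<delta> r - Gamma (4 * \<delta>) / Gamma (2 * \<delta>) * r powr (- 2 * \<delta>))\<bar>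
      \<le> K * ((r / 2) powr (- (2 * \<delta> + 2)) + (r / 2) powr (- (3 * \<delta>)))"
      using K[OF r] by (simp only: right_diff_distrib)
    also have "\<dots> \<le> \<bar>K\<bar> * ((r / 2) powr (- (2 * \<delta> + 2)) + (r / 2) powr (- (3 * \<delta>)))"
      by (intro mult_right_mono) auto
    also have "\<dots> \<le> \<bar>K\<bar> * (2 powr (2 * \<delta> + 2) * r powr (- m) + 2 powr (3 * \<delta>) * r powr (- m))"
      by (intro mult_left_mono add_mono sc) (auto simp: m_def)
    also have "\<dots> = \<kappa> * (M * r powr (- m))"
    proof -
      have "\<kappa> * M = \<bar>K\<bar> * (2 powr (2 * \<delta> + 2) + 2 powr (3 * \<delta>))" using \<kappa> by (simp add: M_def)
      thus ?thesis unfolding mult.assoc[symmetric, of \<kappa>] by (simp only:) (simp add: distrib_left distrib_right)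
    qed
    finally have "\<kappa> * \<bar>Q \<delta> r - Gamma (4 * \<delta>) / Gamma (2 * \<delta>) * r powr (- 2 * \<delta>)\<bar> \<le> \<kappa> * (M * r powr (- m))"
      using \<kappa> by (simp only: abs_mult abs_of_pos)
    thus ?thesis using \<kappa> by simp
  qed
  hence "\<forall>\<^sub>F r in at_top. norm (Q \<delta> r - Gamma (4 * \<delta>) / Gamma (2 * \<delta>) * r powr (- 2 * \<delta>)) \<le> M * norm (r powr (- m))"
    by (intro eventually_at_top_linorderI[of 1]) auto
  thus ?thesis unfolding m_def by (rule bigoI)
qed

text \<open>The quotient of \<open>Q\<close> by the power is continuous and positive, and it tends
  to a positive limit because both error exponents exceed 2 delta. On a compact interval it attains
  positive extrema; beyond it the limit controls it.\<close>

lemma Q_comparable: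
  assumes \<delta>: "1 / 2 < \<delta>"
  shows "comparable_on {0..} (Q \<delta>) (\<lambda>r. (1 + r) powr (- 2 * \<delta>))"
proof -
  define L where "L = Gamma (4 * \<delta>) / Gamma (2 * \<delta>)"
  have L: "0 < L" unfolding L_def using \<delta> by (intro divide_pos_pos Gamma_real_pos) auto
  define f where "f = (\<lambda>r. Q \<delta> r * (1 + r) powr (2 * \<delta>))"
  have cf: "continuous_on {0..R} f" for R
    unfolding f_def using \<delta> by (intro continuous_intros continuous_at_imp_continuous_on ballI isCont_Q) auto
  have f_pos: "0 < f r" if "0 \<le> r" for r using Q_pos[of \<delta> r] \<delta> that by (simp add: f_def)
  have Qf: "Q \<delta> r = f r * (1 + r) powr (- 2 * \<delta>)" if "0 \<le> r" for r
    using that by (simp add: f_def powr_minus field_simps)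
  have "(f \<longlongrightarrow> L) at_top"
  proof -
    have "min (2 * \<delta> + 2) (3 * \<delta>) > 2 * \<delta>" using \<delta> by auto
    hence "(\<lambda>r. r powr (- min (2 * \<delta> + 2) (3 * \<delta>))) \<in> o[at_top](\<lambda>r. r powr (- 2 * \<delta>))"
      by (intro powr_smallo_iff[THEN iffD2]) (auto simp: filterlim_ident)
    from landau_o.big_small_trans[OF Q_asymptotic[OF \<delta>] this]
    have "((\<lambda>r. (Q \<delta> r - L * r powr (- 2 * \<delta>)) / r powr (- 2 * \<delta>)) \<longlongrightarrow> 0) at_top"
      unfolding L_def by (rule smalloD_tendsto)
    hence "((\<lambda>r. (Q \<delta> r - L * r powr (- 2 * \<delta>)) / r powr (- 2 * \<delta>) + L) \<longlongrightarrow> 0 + L) at_top" by (intro tendsto_intros)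
    moreover have "((\<lambda>r. (1 + 1 / r :: real) powr (2 * \<delta>)) \<longlongrightarrow> 1) at_top"
    proof -
      have "((\<lambda>r. 1 + 1 / r :: real) \<longlongrightarrow> 1) at_top" by real_asymp
      hence "((\<lambda>r. (1 + 1 / r :: real) powr (2 * \<delta>)) \<longlongrightarrow> 1 powr (2 * \<delta>)) at_top" by (intro tendsto_intros) auto
      thus ?thesis by simp
    qed
    ultimately have "((\<lambda>r. ((Q \<delta> r - L * r powr (- 2 * \<delta>)) / r powr (- 2 * \<delta>) + L) * (1 + 1 / r) powr (2 * \<delta>)) \<longlongrightarrow> (0 + L) * 1) at_top"
      by (rule tendsto_mult)
    moreover have "\<forall>\<^sub>F r in at_top. ((Q \<delta> r - L * r powr (- 2 * \<delta>)) / r powr (- 2 * \<delta>) + L) * (1 + 1 / r) powr (2 * \<delta>) = f r"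
    proof (rule eventually_at_top_linorderI[of 1])
      fix r :: real assume r: "1 \<le> r"
      have "(Q \<delta> r - L * r powr (- 2 * \<delta>)) / r powr (- 2 * \<delta>) + L = Q \<delta> r * r powr (2 * \<delta>)"
        using r by (simp add: powr_minus field_simps)
      moreover have "r powr (2 * \<delta>) * (1 + 1 / r) powr (2 * \<delta>) = (1 + r) powr (2 * \<delta>)"
      proof -
        have "r * (1 + 1 / r) = 1 + r" using r by (simp add: field_simps)
        thus ?thesis using r by (simp add: powr_mult[symmetric])
      qed
      ultimately show "((Q \<delta> r - L * r powr (- 2 * \<delta>)) / r powr (- 2 * \<delta>) + L) * (1 + 1 / r) powr (2 * \<delta>) = f r"
        by (simp add: f_def mult.assoc)
    qed
    ultimately show ?thesis using Lim_transform_eventually by fastforce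
  qed
  from order_tendstoD(1)[OF this, of "L / 2"] order_tendstoD(2)[OF this, of "2 * L"]
  have "\<forall>\<^sub>F r in at_top. L / 2 < f r" "\<forall>\<^sub>F r in at_top. f r < 2 * L" using L by simp_all
  hence "\<forall>\<^sub>F r in at_top. L / 2 < f r \<and> f r < 2 * L" by eventually_elim auto
  then obtain R0 where R0: "\<And>r. R0 \<le> r \<Longrightarrow> L / 2 < f r \<and> f r < 2 * L" unfolding eventually_at_top_linorder by blast
  \<comment> \<open>The maximum with 0 keeps \<open>{0..R}\<close> nonempty, so that the extrema on
    it exist.\<close>
  define R where "R = max 0 R0"
  have R: "0 \<le> R" "\<And>r. R \<le> r \<Longrightarrow> L / 2 < f r \<and> f r < 2 * L" using R0 by (auto simp: R_def)
  obtain a where a: "a \<in> {0..R}" "\<And>r. r \<in> {0..R} \<Longrightarrow> f a \<le> f r"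
    using continuous_attains_inf[OF compact_Icc _ cf[of R]] R by auto
  obtain b where b: "b \<in> {0..R}" "\<And>r. r \<in> {0..R} \<Longrightarrow> f r \<le> f b"
    using continuous_attains_sup[OF compact_Icc _ cf[of R]] R by auto
  have lo: "min (f a) (L / 2) \<le> f r" and hi: "f r \<le> max (f b) (2 * L)" if "0 \<le> r" for r
    using a(2)[of r] b(2)[of r] R(2)[of r] that by (cases "r \<le> R"; force)+
  have "0 < min (f a) (L / 2)" "0 < max (f b) (2 * L)" using a(1) f_pos[of a] L by auto
  moreover have "min (f a) (L / 2) * (1 + r) powr (- 2 * \<delta>) \<le> Q \<delta> r \<and> Q \<delta> r \<le> max (f b) (2 * L) * (1 + r) powr (- 2 * \<delta>)" if "r \<in> {0..}" for r
    using lo[of r] hi[of r] that by (simp only: Qf atLeast_iff) (auto intro: mult_right_mono)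
  ultimately show ?thesis unfolding comparable_on_def by blast
qed

text \<open>Comparison with (1 + r)^(d - 1 - 2 delta); its exponent is below -1 exactly when d < 2
  delta.\<close>

lemma Q_integrable_radial:
  assumes \<delta>: "1 / 2 < \<delta>" and d: "real d < 2 * \<delta>" "1 \<le> d"
  shows "integrable lborel (\<lambda>r. indicat_real {0..} r * (Q \<delta> r * r ^ (d - 1)))"
proof -
  define e where "e = real d - 1 - 2 * \<delta>"
  have e: "e < - 1" using d by (simp add: e_def)
  obtain c where c: "0 < c" "\<And>r. 0 \<le> r \<Longrightarrow> Q \<delta> r \<le> c * (1 + r) powr (- 2 * \<delta>)"
    using Q_comparable[OF \<delta>] unfolding comparable_on_def by auto
  have "((\<lambda>x. x powr e) has_integral - (1 powr (e + 1)) / (e + 1)) {1..}"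
    by (rule has_integral_powr_to_inf) (use e in auto)
  hence "has_bochner_integral lborel (\<lambda>x. indicat_real {1..} x * x powr e) (- (1 powr (e + 1)) / (e + 1))"
    by (intro has_bochner_integral_of_has_integral) auto
  hence "integrable lborel (\<lambda>x. indicat_real {1..} x * x powr e)" by (simp add: has_bochner_integral_iff)
  from lborel_integrable_real_affine[OF this, of 1 1]
  have i: "integrable lborel (\<lambda>x. indicat_real {1..} (1 + 1 * x) * (1 + 1 * x) powr e)" by simp
  show ?thesis
  proof (rule Bochner_Integration.integrable_bound[OF integrable_mult_right[OF i, of c]])
    have "continuous_on {0..} (\<lambda>r. Q \<delta> r * r ^ (d - 1))"
      using \<delta> by (intro continuous_intros continuous_at_imp_continuous_on ballI isCont_Q) auto
    from borel_measurable_continuous_on_indicator[OF _ this]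
    show "(\<lambda>r. indicat_real {0..} r * (Q \<delta> r * r ^ (d - 1))) \<in> borel_measurable lborel" by simp
    show "AE r in lborel. norm (indicat_real {0..} r * (Q \<delta> r * r ^ (d - 1))) \<le> norm (c * (indicat_real {1..} (1 + 1 * r) * (1 + 1 * r) powr e))"
    proof (rule AE_I2)
      fix r :: real
      show "norm (indicat_real {0..} r * (Q \<delta> r * r ^ (d - 1))) \<le> norm (c * (indicat_real {1..} (1 + 1 * r) * (1 + 1 * r) powr e))"
      proof (cases "0 \<le> r")
        case True
        have "0 < Q \<delta> r" using \<delta> by (intro Q_pos) simp
        hence "norm (indicat_real {0..} r * (Q \<delta> r * r ^ (d - 1))) = Q \<delta> r * r ^ (d - 1)" using True by (simp add: abs_mult)
        also have "\<dots> \<le> c * (1 + r) powr (- 2 * \<delta>) * (1 + r) ^ (d - 1)"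
          using True c by (intro mult_mono power_mono) auto
        also have "(1 + r) ^ (d - 1) = (1 + r) powr real (d - 1)" using True by (subst powr_realpow) auto
        also have "c * (1 + r) powr (- 2 * \<delta>) * (1 + r) powr real (d - 1) = c * (1 + r) powr (- 2 * \<delta> + real (d - 1))"
          by (simp only: powr_add mult.assoc)
        also have "- 2 * \<delta> + real (d - 1) = e" using d by (simp add: e_def of_nat_diff)
        finally show ?thesis using True c(1) by (simp add: abs_mult)
      qed simp
    qed
  qed
qed

theorem theorem7p1:
  fixes d :: nat and \<delta> :: real
  assumes "d = CARD('n::finite)" and "\<delta> > real d / 2"
  shows
    "(radially_positive_definite TYPE('n) (Q \<delta>) \<and>
      (\<forall>r\<ge>0.
         set_integrable lborel {0..}
           (\<lambda>t. Omega (\<delta> - 1 / 2) (r * t) * max 0 (1 - t) powr (2 * \<delta> - 1) * t powr (2 * \<delta> - 1)) \<and>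
         Q \<delta> r = 1 / Beta (2 * \<delta>) (2 * \<delta>) *
           (LINT t:{0..}|lborel.
             Omega (\<delta> - 1 / 2) (r * t) * max 0 (1 - t) powr (2 * \<delta> - 1) * t powr (2 * \<delta> - 1)) \<and>
         set_integrable lborel {0..}
           (\<lambda>t. Omega ((real d - 2) / 2) (r * t) * Psi d \<delta> t * t ^ (d - 1)) \<and>
         Q \<delta> r = tau d \<delta> *
           (LINT t:{0..}|lborel. Omega ((real d - 2) / 2) (r * t) * Psi d \<delta> t * t ^ (d - 1)))) \<and>
     ((\<forall>r\<ge>0. 0 < Q \<delta> r \<and> Q \<delta> r \<le> 1) \<and>
      (\<lambda>r. Q \<delta> r - Gamma (4 * \<delta>) / Gamma (2 * \<delta>) * r powr (- 2 * \<delta>))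
        \<in> O[at_top](\<lambda>r. r powr (- min (2 * \<delta> + 2) (3 * \<delta>))) \<and>
      comparable_on {0..} (Q \<delta>) (\<lambda>r. (1 + r) powr (- 2 * \<delta>))) \<and>
     (continuous_on {0..} (Q \<delta>) \<and>
      set_integrable lborel {0..} (\<lambda>r. Q \<delta> r * r ^ (d - 1)) \<and>
      (\<forall>t\<ge>0.
         set_integrable lborel {0..}
           (\<lambda>r. Omega ((real d - 2) / 2) (r * t) * Q \<delta> r * r ^ (d - 1)) \<and>
         Psi d \<delta> t =
           1 / (2 powr (real d - 2) * (Gamma (real d / 2)) ^ 2 * tau d \<delta>) *
           (LINT r:{0..}|lborel. Omega ((real d - 2) / 2) (r * t) * Q \<delta> r * r ^ (d - 1))) \<and>
      radially_positive_definite TYPE('n) (Psi d \<delta>))"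
proof -
  let ?E = "TYPE(real ^ 'n)"
  have dim: "DIM(real ^ 'n) = d" using assms(1) by simp
  have d: "1 \<le> d" using assms(1) by (simp add: Suc_le_eq card_gt_0_iff)
  have \<delta>: "1 / 2 < \<delta>" "0 < \<delta>" "real d < 2 * \<delta>" using d assms(2) by auto
  note ctx = d assms(2)
  let ?O = "Omega ((real d - 2) / 2)" and ?\<tau> = "tau d \<delta>"
  define s where "s = sphere_area ?E"
  have s: "0 < s" unfolding s_def by (rule sphere_area_pos)
  have \<tau>: "0 < ?\<tau>" by (rule tau_pos[OF ctx])
  have O_le: "\<bar>?O t\<bar> \<le> 1" if "0 \<le> t" for t
    using abs_DOmega_le[where 'a = "real ^ 'n", OF that] by (simp only: dim)
  have Psi_meas: "Psi d \<delta> \<in> borel_measurable borel"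
  proof -
    have "(\<lambda>t. indicator {0..} t *\<^sub>R Psi d \<delta> t) \<in> borel_measurable borel"
      by (rule borel_measurable_continuous_on_indicator[OF _ Psi_continuous[OF ctx]]) simp
    moreover have "(\<lambda>t. indicator {0..} t *\<^sub>R Psi d \<delta> t) = Psi d \<delta>"
      by (auto simp: fun_eq_iff indicator_def Psi_def)
    ultimately show ?thesis by simp
  qed
  have Q_meas: "Q \<delta> \<in> borel_measurable borel"
    by (intro borel_measurable_continuous_onI continuous_at_imp_continuous_on ballI isCont_Q \<delta>)
  note Q2 = Q_second_integral[OF ctx]
  \<comment> \<open>At r = 0 the factor \<open>Omega\<close> is 1, so the second representation
    there is already the integrability of \<open>Psi\<close>.\<close>
  have Psi_int: "integrable lborel (\<lambda>t. indicat_real {0..} t * (Psi d \<delta> t * t ^ (DIM(real ^ 'n) - 1)))"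
    using Q2[of 0] Omega_0[of "(real d - 2) / 2"] d unfolding dim by (simp add: has_bochner_integral_iff)
  have Q_int: "integrable lborel (\<lambda>r. indicat_real {0..} r * (Q \<delta> r * r ^ (DIM(real ^ 'n) - 1)))"
    unfolding dim by (rule Q_integrable_radial[OF \<delta>(1,3) d])
  have cosPsi: "(LINT y|lborel. cos (x \<bullet> y) * Psi d \<delta> (norm y)) = s / ?\<tau> * Q \<delta> (norm x)" for x :: "real ^ 'n"
    using integral_cos_radial[OF Psi_meas Psi_int, of x] Q2[of "norm x"]
    unfolding dim s_def[symmetric] by (simp add: has_bochner_integral_iff)
  have cosQ: "(LINT y|lborel. cos (x \<bullet> y) * Q \<delta> (norm y)) = s * (LINT r|lborel. indicat_real {0..} r * (?O (norm x * r) * Q \<delta> r * r ^ (d - 1)))" for x :: "real ^ 'n"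
    using integral_cos_radial[OF Q_meas Q_int, of x] unfolding dim s_def[symmetric] .
  have cont: "continuous_on UNIV (\<lambda>y::real ^ 'n. Psi d \<delta> (norm y))"
    by (rule continuous_on_compose2[OF Psi_continuous[OF ctx]]) (auto intro!: continuous_intros)
  obtain C where C: "\<And>y::real ^ 'n. \<bar>Psi d \<delta> (norm y)\<bar> \<le> C"
  proof -
    have "bounded (Psi d \<delta> ` {0..1})"
      by (intro compact_imp_bounded compact_continuous_image continuous_on_subset[OF Psi_continuous[OF ctx]]) auto
    then obtain C where "\<forall>x\<in>Psi d \<delta> ` {0..1}. norm x \<le> C"
      unfolding bounded_iff by blast
    hence C: "\<bar>Psi d \<delta> t\<bar> \<le> C" if "t \<in> {0..1}" for t using that by auto
    have "\<bar>Psi d \<delta> (norm y)\<bar> \<le> C" for y :: "real ^ 'n"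
      using C[of "norm y"] C[of 0] Psi_eq_0[OF ctx, of "norm y"] by (cases "norm y \<le> 1") auto
    thus ?thesis by (rule that)
  qed
  have PsiE: "integrable lborel (\<lambda>y::real ^ 'n. Psi d \<delta> (norm y))"
    using integrable_radial_iff[OF Psi_meas] Psi_int by blast
  have QE: "integrable lborel (\<lambda>y::real ^ 'n. Q \<delta> (norm y))"
    using integrable_radial_iff[OF Q_meas] Q_int by blast
  have inv: "(s / ?\<tau>) * (LINT x|lborel. cos (y \<bullet> x) * Q \<delta> (norm x)) = (2 * pi) ^ d * Psi d \<delta> (norm y)" for y :: "real ^ 'n"
  proof -
    have "(LINT x|lborel. cos (y \<bullet> x) * (LINT z|lborel. cos (x \<bullet> z) * Psi d \<delta> (norm z))) = (2 * pi) ^ DIM(real ^ 'n) * Psi d \<delta> (norm y)"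
    proof (rule Fourier_inversion_even[OF PsiE _ cont C])
      show "integrable lborel (\<lambda>x::real ^ 'n. LINT z|lborel. cos (x \<bullet> z) * Psi d \<delta> (norm z))"
        unfolding cosPsi using QE by (rule integrable_mult_right)
    qed simp
    thus ?thesis unfolding cosPsi dim by (simp add: mult.left_commute[of _ "s / ?\<tau>"] del: times_divide_eq_left times_divide_eq_right)
  qed
  have solve: "P = A / D * B" if "A * B = D * P" "D \<noteq> 0" for A B D P :: real
    using that by (simp add: nonzero_eq_divide_eq mult.commute)
  have Q_pd: "radially_positive_definite TYPE('n) (Q \<delta>)"
  proof -
    have "(Psi d \<delta> \<longlongrightarrow> Psi d \<delta> 0) (at 0 within {0..})"
      using Psi_continuous[OF ctx] by (auto simp: continuous_on_def)
    hence "\<forall>\<^sub>F t in at 0 within {0..}. 0 < Psi d \<delta> t"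
      by (rule order_tendstoD) (simp add: Psi_0[OF ctx])
    then obtain e where e: "0 < e" "\<And>t. t \<in> {0..} \<Longrightarrow> t \<noteq> 0 \<Longrightarrow> dist t 0 < e \<Longrightarrow> 0 < Psi d \<delta> t"
      unfolding eventually_at by blast
    show ?thesis
    proof (rule radially_positive_definiteI[OF PsiE _ e(1)])
      show "0 \<le> Psi d \<delta> t" for t by (rule Psi_nonneg[OF ctx])
      show "0 < Psi d \<delta> t" if "0 \<le> t" "t < e" for t
        using e(2)[of t] that Psi_0[OF ctx] by (cases "t = 0") (auto simp: dist_real_def)
      show "0 < ?\<tau> / s" using s \<tau> by simp
      show "Q \<delta> (norm x) = ?\<tau> / s * (LINT y|lborel. cos (x \<bullet> y) * Psi d \<delta> (norm y))" for x :: "real ^ 'n"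
        unfolding cosPsi using s \<tau> by simp
    qed
  qed
  have Psi_pd: "radially_positive_definite TYPE('n) (Psi d \<delta>)"
  \<comment> \<open>\<open>Q\<close> is positive everywhere, so any radius would do; it is taken to
    be 1.\<close>
  proof (rule radially_positive_definiteI[OF QE _ zero_less_one])
    show "0 \<le> Q \<delta> t" "0 < Q \<delta> t" for t using Q_pos[OF \<delta>(2), of t] by auto
    show "0 < s / ?\<tau> / (2 * pi) ^ d" using s \<tau> by simp
    show "Psi d \<delta> (norm x) = s / ?\<tau> / (2 * pi) ^ d * (LINT y|lborel. cos (x \<bullet> y) * Q \<delta> (norm y))" for x :: "real ^ 'n"
      by (rule solve[OF inv]) simp
  qed
  have first: "set_integrable lborel {0..}
           (\<lambda>t. Omega (\<delta> - 1 / 2) (r * t) * max 0 (1 - t) powr (2 * \<delta> - 1) * t powr (2 * \<delta> - 1)) \<and>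
         Q \<delta> r = 1 / Beta (2 * \<delta>) (2 * \<delta>) *
           (LINT t:{0..}|lborel.
             Omega (\<delta> - 1 / 2) (r * t) * max 0 (1 - t) powr (2 * \<delta> - 1) * t powr (2 * \<delta> - 1))" for r
  proof -
    \<comment> \<open>For t > 1 the cut-off factor is \<open>0 powr (2 * \<delta> - 1)\<close>,
      which is 0.\<close>
    have e: "(\<lambda>t. indicat_real {0..} t *\<^sub>R (Omega (\<delta> - 1 / 2) (r * t) * max 0 (1 - t) powr (2 * \<delta> - 1) * t powr (2 * \<delta> - 1)))
      = (\<lambda>t. indicat_real {0..1} t * (Omega (\<delta> - 1 / 2) (r * t) * (1 - t) powr (2 * \<delta> - 1) * t powr (2 * \<delta> - 1)))"
      by (auto simp: fun_eq_iff indicator_def max_def)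
    have "0 < Beta (2 * \<delta>) (2 * \<delta>)" using \<delta> by (intro Beta_pos) auto
    thus ?thesis unfolding set_integrable_def set_lebesgue_integral_def e
      using Q_first_integral[OF \<delta>(2), of r] by (simp add: has_bochner_integral_iff)
  qed
  have second: "set_integrable lborel {0..} (\<lambda>t. ?O (r * t) * Psi d \<delta> t * t ^ (d - 1)) \<and>
         Q \<delta> r = ?\<tau> * (LINT t:{0..}|lborel. ?O (r * t) * Psi d \<delta> t * t ^ (d - 1))" for r
    using Q2[of r] \<tau> by (simp add: has_bochner_integral_iff set_integrable_def set_lebesgue_integral_def)
  have bounds: "0 < Q \<delta> r \<and> Q \<delta> r \<le> 1" if r: "0 \<le> r" for r
  proof
    show "0 < Q \<delta> r" by (rule Q_pos[OF \<delta>(2)])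
    \<comment> \<open>The upper bound compares the second representation at r with that at 0, where
      \<open>Q\<close> is 1: \<open>Psi\<close> is nonnegative and \<open>Omega\<close> is at most
      1.\<close>
    have "Q \<delta> r / ?\<tau> \<le> Q \<delta> 0 / ?\<tau>"
      unfolding has_bochner_integral_integral_eq[OF Q2, symmetric]
    proof (rule integral_mono[OF integrable.intros[OF Q2] integrable.intros[OF Q2]])
      fix t
      show "indicat_real {0..} t * (?O (r * t) * Psi d \<delta> t * t ^ (d - 1)) \<le> indicat_real {0..} t * (?O (0 * t) * Psi d \<delta> t * t ^ (d - 1))"
      proof (cases "0 \<le> t")
        case True
        have "?O (r * t) \<le> 1" using O_le[of "r * t"] r True by simp
        hence "?O (r * t) * (Psi d \<delta> t * t ^ (d - 1)) \<le> 1 * (Psi d \<delta> t * t ^ (d - 1))"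
          using True Psi_nonneg[OF ctx, of t] by (intro mult_right_mono) auto
        moreover have "?O 0 = 1" using d by (intro Omega_0) simp
        ultimately show ?thesis using True by (simp add: mult.assoc)
      qed simp
    qed
    thus "Q \<delta> r \<le> 1" using \<tau> Q_0[of \<delta>] by (simp add: divide_le_cancel)
  qed
  have third: "set_integrable lborel {0..} (\<lambda>r. ?O (r * t) * Q \<delta> r * r ^ (d - 1)) \<and>
         Psi d \<delta> t = 1 / (2 powr (real d - 2) * (Gamma (real d / 2)) ^ 2 * ?\<tau>) *
           (LINT r:{0..}|lborel. ?O (r * t) * Q \<delta> r * r ^ (d - 1))" if t: "0 \<le> t" for t
  proof -
    \<comment> \<open>Any unit vector will do: inversion at a single point of norm t gives the value
      of the radial function at t.\<close>
    obtain b :: "real ^ 'n" where b: "b \<in> Basis" using nonempty_Basis by blast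
    define y where "y = t *\<^sub>R b"
    have ny: "norm y = t" using t b by (simp add: y_def)
    let ?J = "LINT r|lborel. indicat_real {0..} r * (?O (t * r) * Q \<delta> r * r ^ (d - 1))"
    have i: "integrable lborel (\<lambda>r. indicat_real {0..} r * (?O (t * r) * Q \<delta> r * r ^ (d - 1)))"
      using integrable_DOmega[OF Q_meas Q_int, of y] unfolding dim ny .
    have "(s / ?\<tau>) * (s * ?J) = (2 * pi) ^ d * Psi d \<delta> t"
      using inv[of y] unfolding cosQ ny .
    from solve[OF this] have "Psi d \<delta> t = s\<^sup>2 / (2 * pi) ^ d / ?\<tau> * ?J"
      by (simp add: power2_eq_square mult_ac)
    \<comment> \<open>The constant of part (iii): the squared area of the unit sphere over (2 pi)^d,
      in which the powers of pi cancel.\<close>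
    also have "s\<^sup>2 / (2 * pi) ^ d = 1 / (2 powr (real d - 2) * (Gamma (real d / 2)) ^ 2)"
    proof -
      have "0 < Gamma (real d / 2)" using d by (intro Gamma_real_pos) simp
      moreover have "(pi powr (real d / 2))\<^sup>2 = pi ^ d"
        by (simp add: power2_eq_square powr_add[symmetric] powr_realpow)
      moreover have E: "2 powr (real d - 2) = 2 ^ d / 4" by (simp add: powr_diff powr_realpow)
      ultimately show ?thesis unfolding s_def sphere_area_def dim E
        by (simp add: power_mult_distrib power_divide)
    qed
    finally show ?thesis using i unfolding set_integrable_def set_lebesgue_integral_def
      by (simp add: mult.commute[of t])
  qed
  have "continuous_on {0..} (Q \<delta>)"
    by (intro continuous_at_imp_continuous_on ballI isCont_Q \<delta>)
  moreover have "set_integrable lborel {0..} (\<lambda>r. Q \<delta> r * r ^ (d - 1))"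
    using Q_integrable_radial[OF \<delta>(1,3) d] by (simp add: set_integrable_def)
  ultimately show ?thesis
    using Q_pd first second bounds Q_asymptotic[OF \<delta>(1)] Q_comparable[OF \<delta>(1)] third Psi_pd by blast
qed

end
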